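(* Let $\mathcal E$ be a category with small limits. Suppose that a unit object $I$ and data $$\mu_n\ \text{ for } n\le 3,\qquad \alpha_{n,l,r}\ \text{ for } n\le2,\ \text{or for } n=3 \text{ and } 1\le r\le3,$$ are given on $\mathcal E$, satisfying the axioms of a normal oplax monoidal structure whenever all the terms are defined. Then one can define $\mu_n$ for $n\ge4$ and $\alpha_{n,l,r}$ for the remaining cases to obtain a normal oplax monoidal structure on $\mathcal E$. Moreover, there is a terminal object $(\mathcal E,\mu_n,\alpha_{n,l,r},I)$ among all such structures (with morphisms $(\mathrm{id}_{\mathcal E},t)$ such that $t_n=\mathrm{id}$ for $n\le3$). Therefore all such structures are equivalent.
   Context: A normal oplax monoidal structure $(\mathcal E,\mu_n,\alpha_{n,l,r},I)$ consists of an object $I\in\mathcal E$; functors $\mu_n:\mathcal E^n\to\mathcal E$ ($n\ge0$), with $\mu_0$ having value $I$ and $\mu_1=\mathrm{id}$; and natural transformations $$\alpha_{n,l,r}:\mu_n(X_1,\dots,X_n)\to\mu_{n-r+1}(X_1,\dots,X_l,\mu_r(X_{l+1},\dots,X_{l+r}),X_{l+r+1},\dots,X_n)$$ for $0\le l\le l+r\le n$, such that $\alpha_{n,l,1}$ and $\alpha_{n,0,n}$ are identities and: (i) for $0\le l\le l+r\le k\le k+s\le n$, $\alpha_{n-r+1,k-r+1,s}\circ\alpha_{n,l,r}=\alpha_{n-s+1,l,r}\circ\alpha_{n,k,s}$; (ii) for $0\le l\le k\le k+s\le l+r\le n$, $\mu_{n-r+1}(X_1,\dots,\alpha_{r,k-l,s},\dots,X_n)\circ\alpha_{n,l,r}=\alpha_{n-s+1,l,r-s+1}\circ\alpha_{n,k,s}$.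 A morphism $(\mathrm{id}_{\mathcal E},t)$ from $(\mathcal E,\mu_n,\alpha_{n,l,r},I)$ to $(\mathcal E,\nu_n,\beta_{n,l,r},I)$ consists of natural transformations $t_n:\mu_n\to\nu_n$ with $t_n=\mathrm{id}$ for $n\le1$ and $\beta_{n,l,r}\circ t_n=\nu_{n-r+1}(X_1,\dots,t_r,\dots,X_n)\circ t_{n-r+1}\circ\alpha_{n,l,r}$ for all $(n,l,r)$. Two normal oplax monoidal structures on $\mathcal E$ with the same unit are equivalent if they are connected by a finite zigzag of morphisms $(\mathrm{id}_{\mathcal E},t)$ with $t_n=\mathrm{id}$ for all $n\le3$. *)

theory Defs
  imports Main
begin

section \<open>Categories, functors, natural transformations, limits\<close>

text \<open>
  Categories are given by carrier sets of objects and arrows. All operations are total functions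
  whose values outside the carriers are irrelevant, so structures on a category are always compared
  on the carriers only. \<open>comp C g f\<close> is the composite ``\<open>g\<close> after \<open>f\<close>''.
\<close>

record ('o, 'm) cat =
  Obj :: "'o set"
  Arr :: "'m set"
  dom :: "'m \<Rightarrow> 'o"
  cod :: "'m \<Rightarrow> 'o"
  ident :: "'o \<Rightarrow> 'm"
  comp :: "'m \<Rightarrow> 'm \<Rightarrow> 'm"

definition hom :: "('o, 'm) cat \<Rightarrow> 'o \<Rightarrow> 'o \<Rightarrow> 'm set" where
  "hom C x y = {f \<in> Arr C. dom C f = x \<and> cod C f = y}"

locale category =
  fixes C :: "('o, 'm) cat"
  assumes dom_in_Obj: "f \<in> Arr C \<Longrightarrow> dom C f \<in> Obj C"
    and cod_in_Obj: "f \<in> Arr C \<Longrightarrow> cod C f \<in> Obj C"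
    and ident_in_hom: "x \<in> Obj C \<Longrightarrow> ident C x \<in> hom C x x"
    and comp_in_hom: "f \<in> hom C x y \<Longrightarrow> g \<in> hom C y z \<Longrightarrow> comp C g f \<in> hom C x z"
    and comp_ident_right: "f \<in> Arr C \<Longrightarrow> comp C f (ident C (dom C f)) = f"
    and comp_ident_left: "f \<in> Arr C \<Longrightarrow> comp C (ident C (cod C f)) f = f"
    and comp_assoc: "f \<in> hom C w x \<Longrightarrow> g \<in> hom C x y \<Longrightarrow> h \<in> hom C y z \<Longrightarrow>
      comp C h (comp C g f) = comp C (comp C h g) f"

record ('o1, 'm1, 'o2, 'm2) ftor =
  fobj :: "'o1 \<Rightarrow> 'o2"
  farr :: "'m1 \<Rightarrow> 'm2"

locale cat_functor = A: category A + B: category B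
  for A :: "('o1, 'm1) cat" and B :: "('o2, 'm2) cat" +
  fixes F :: "('o1, 'm1, 'o2, 'm2) ftor"
  assumes fobj_in_Obj: "x \<in> Obj A \<Longrightarrow> fobj F x \<in> Obj B"
    and farr_in_hom: "f \<in> hom A x y \<Longrightarrow> farr F f \<in> hom B (fobj F x) (fobj F y)"
    and farr_ident: "x \<in> Obj A \<Longrightarrow> farr F (ident A x) = ident B (fobj F x)"
    and farr_comp: "f \<in> hom A x y \<Longrightarrow> g \<in> hom A y z \<Longrightarrow>
      farr F (comp A g f) = comp B (farr F g) (farr F f)"

locale nat_trans = F: cat_functor A B F + G: cat_functor A B G
  for A :: "('o1, 'm1) cat" and B :: "('o2, 'm2) cat"
    and F G :: "('o1, 'm1, 'o2, 'm2) ftor" +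
  fixes \<tau> :: "'o1 \<Rightarrow> 'm2"
  assumes component_in_hom: "x \<in> Obj A \<Longrightarrow> \<tau> x \<in> hom B (fobj F x) (fobj G x)"
    and naturality: "f \<in> hom A x y \<Longrightarrow> comp B (\<tau> y) (farr F f) = comp B (farr G f) (\<tau> x)"

definition is_cone :: "('j, 'k) cat \<Rightarrow> ('o, 'm) cat \<Rightarrow> ('j, 'k, 'o, 'm) ftor \<Rightarrow> 'o \<Rightarrow> ('j \<Rightarrow> 'm) \<Rightarrow> bool"
  where "is_cone J C F x p \<longleftrightarrow> x \<in> Obj C \<and>
    (\<forall>j \<in> Obj J. p j \<in> hom C x (fobj F j)) \<and>
    (\<forall>a \<in> Arr J. comp C (farr F a) (p (dom J a)) = p (cod J a))"

definition is_limit :: "('j, 'k) cat \<Rightarrow> ('o, 'm) cat \<Rightarrow> ('j, 'k, 'o, 'm) ftor \<Rightarrow> 'o \<Rightarrow> ('j \<Rightarrow> 'm) \<Rightarrow> bool"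
  where "is_limit J C F x p \<longleftrightarrow> is_cone J C F x p \<and>
    (\<forall>y q. is_cone J C F y q \<longrightarrow>
      (\<exists>!h. h \<in> hom C y x \<and> (\<forall>j \<in> Obj J. comp C (p j) h = q j)))"

text \<open>
  HOL has no proper classes, so ``small'' is relative to a type \<open>'u\<close> playing the role of the
  universe: a small category is one whose objects and arrows are elements of \<open>'u\<close> (the carriers
  being arbitrary subsets of \<open>'u\<close>). The types of objects and arrows of \<open>C\<close> are unrelated to \<open>'u\<close>.
\<close>

definition has_small_limits :: "'u itself \<Rightarrow> ('o, 'm) cat \<Rightarrow> bool" where
  "has_small_limits U C \<longleftrightarrow>
    (\<forall>(J :: ('u, 'u) cat) F. cat_functor J C F \<longrightarrow> (\<exists>x p. is_limit J C F x p))"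


section \<open>Functors of several variables\<close>

text \<open>The \<open>n\<close>-fold power of \<open>C\<close>: \<open>n\<close>-tuples are lists of length \<open>n\<close>.\<close>

definition power_cat :: "('o, 'm) cat \<Rightarrow> nat \<Rightarrow> ('o list, 'm list) cat" where
  "power_cat C n =
    \<lparr> Obj = {X. length X = n \<and> set X \<subseteq> Obj C},
      Arr = {f. length f = n \<and> set f \<subseteq> Arr C},
      dom = map (dom C),
      cod = map (cod C),
      ident = map (ident C),
      comp = map2 (comp C) \<rparr>"

text \<open>
  \<open>plug l r u (X\<^sub>1, \<dots>, X\<^sub>n)\<close> is
  \<open>(X\<^sub>1, \<dots>, X\<^sub>l, u (X\<^bsub>l+1\<^esub>, \<dots>, X\<^bsub>l+r\<^esub>), X\<^bsub>l+r+1\<^esub>, \<dots>, X\<^sub>n)\<close>, of length \<open>n - r + 1\<close>.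
  It is used both for tuples of objects and for tuples of arrows.
\<close>

definition plug :: "nat \<Rightarrow> nat \<Rightarrow> ('a list \<Rightarrow> 'a) \<Rightarrow> 'a list \<Rightarrow> 'a list" where
  "plug l r u X = take l X @ u (take r (drop l X)) # drop (l + r) X"

text \<open>
  The tuple of arrows \<open>(X\<^sub>1, \<dots>, X\<^sub>l, \<tau> (X\<^bsub>l+1\<^esub>, \<dots>, X\<^bsub>l+r\<^esub>), X\<^bsub>l+r+1\<^esub>, \<dots>, X\<^sub>n)\<close>, where, as usual,
  objects stand for their identity arrows.
\<close>

definition plug_arr :: "('o, 'm) cat \<Rightarrow> nat \<Rightarrow> nat \<Rightarrow> ('o list \<Rightarrow> 'm) \<Rightarrow> 'o list \<Rightarrow> 'm list" where
  "plug_arr C l r \<tau> X =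
    map (ident C) (take l X) @ \<tau> (take r (drop l X)) # map (ident C) (drop (l + r) X)"

definition plug_ftor ::
  "nat \<Rightarrow> nat \<Rightarrow> ('o list, 'm list, 'o, 'm) ftor \<Rightarrow> ('o list, 'm list, 'o, 'm) ftor \<Rightarrow>
    ('o list, 'm list, 'o, 'm) ftor" where
  "plug_ftor l r G F =
    \<lparr> fobj = \<lambda>X. fobj G (plug l r (fobj F) X),
      farr = \<lambda>f. farr G (plug l r (farr F) f) \<rparr>"


section \<open>Normal oplax monoidal structures\<close>

text \<open>
  \<open>mult S n\<close> is the functor \<open>\<mu>\<^sub>n\<close>; \<open>oassoc S n l r X\<close> is the component of \<open>\<alpha>\<^bsub>n,l,r\<^esub>\<close> at the tuple \<open>X\<close>.
\<close>

record ('o, 'm) oplax_data =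
  unit_obj :: 'o
  mult :: "nat \<Rightarrow> ('o list, 'm list, 'o, 'm) ftor"
  oassoc :: "nat \<Rightarrow> nat \<Rightarrow> nat \<Rightarrow> 'o list \<Rightarrow> 'm"

text \<open>
  The axioms for possibly partial data: \<open>M n\<close> says that \<open>\<mu>\<^sub>n\<close> is defined and \<open>D n l r\<close> that
  \<open>\<alpha>\<^bsub>n,l,r\<^esub>\<close> is defined. Each axiom is required whenever all the terms in it are defined; the
  values of the fields outside \<open>M\<close> and \<open>D\<close> are not constrained.
\<close>

locale partial_oplax = category C
  for C :: "('o, 'm) cat" +
  fixes M :: "nat \<Rightarrow> bool" and D :: "nat \<Rightarrow> nat \<Rightarrow> nat \<Rightarrow> bool"
    and S :: "('o, 'm) oplax_data"
  assumes unit_obj: "unit_obj S \<in> Obj C"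
    and mult_functor: "M n \<Longrightarrow> cat_functor (power_cat C n) C (mult S n)"
    and mult_0: "M 0 \<Longrightarrow> fobj (mult S 0) [] = unit_obj S"
    and mult_1_obj: "M 1 \<Longrightarrow> x \<in> Obj C \<Longrightarrow> fobj (mult S 1) [x] = x"
    and mult_1_arr: "M 1 \<Longrightarrow> f \<in> Arr C \<Longrightarrow> farr (mult S 1) [f] = f"
    and oassoc_nat_trans:
      "l + r \<le> n \<Longrightarrow> D n l r \<Longrightarrow> M n \<Longrightarrow> M r \<Longrightarrow> M (n - r + 1) \<Longrightarrow>
        nat_trans (power_cat C n) C
          (mult S n) (plug_ftor l r (mult S (n - r + 1)) (mult S r)) (oassoc S n l r)"
    and oassoc_1:
      "l + 1 \<le> n \<Longrightarrow> D n l 1 \<Longrightarrow> M n \<Longrightarrow> X \<in> Obj (power_cat C n) \<Longrightarrow>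
        oassoc S n l 1 X = ident C (fobj (mult S n) X)"
    and oassoc_n:
      "D n 0 n \<Longrightarrow> M n \<Longrightarrow> X \<in> Obj (power_cat C n) \<Longrightarrow>
        oassoc S n 0 n X = ident C (fobj (mult S n) X)"
    and oassoc_parallel:
      "l + r \<le> k \<Longrightarrow> k + s \<le> n \<Longrightarrow> M r \<Longrightarrow> M s \<Longrightarrow>
        D n l r \<Longrightarrow> D (n - r + 1) (k - r + 1) s \<Longrightarrow>
        D n k s \<Longrightarrow> D (n - s + 1) l r \<Longrightarrow>
        X \<in> Obj (power_cat C n) \<Longrightarrow>
        comp C (oassoc S (n - r + 1) (k - r + 1) s (plug l r (fobj (mult S r)) X))
               (oassoc S n l r X)
        = comp C (oassoc S (n - s + 1) l r (plug k s (fobj (mult S s)) X))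
                 (oassoc S n k s X)"
    and oassoc_nested:
      "l \<le> k \<Longrightarrow> k + s \<le> l + r \<Longrightarrow> l + r \<le> n \<Longrightarrow> M s \<Longrightarrow> M (n - r + 1) \<Longrightarrow>
        D n l r \<Longrightarrow> D r (k - l) s \<Longrightarrow>
        D n k s \<Longrightarrow> D (n - s + 1) l (r - s + 1) \<Longrightarrow>
        X \<in> Obj (power_cat C n) \<Longrightarrow>
        comp C (farr (mult S (n - r + 1)) (plug_arr C l r (oassoc S r (k - l) s) X))
               (oassoc S n l r X)
        = comp C (oassoc S (n - s + 1) l (r - s + 1) (plug k s (fobj (mult S s)) X))
                 (oassoc S n k s X)"

definition normal_oplax :: "('o, 'm) cat \<Rightarrow> ('o, 'm) oplax_data \<Rightarrow> bool" where
  "normal_oplax C S \<longleftrightarrow> partial_oplax C (\<lambda>_. True) (\<lambda>_ _ _. True) S"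

definition low_mult :: "nat \<Rightarrow> bool" where
  "low_mult n \<longleftrightarrow> n \<le> 3"

definition low_assoc :: "nat \<Rightarrow> nat \<Rightarrow> nat \<Rightarrow> bool" where
  "low_assoc n l r \<longleftrightarrow> n \<le> 2 \<or> n = 3 \<and> 1 \<le> r \<and> r \<le> 3"

definition low_oplax :: "('o, 'm) cat \<Rightarrow> ('o, 'm) oplax_data \<Rightarrow> bool" where
  "low_oplax C P \<longleftrightarrow> partial_oplax C low_mult low_assoc P"

definition completes :: "('o, 'm) cat \<Rightarrow> ('o, 'm) oplax_data \<Rightarrow> ('o, 'm) oplax_data \<Rightarrow> bool" where
  "completes C P S \<longleftrightarrow> normal_oplax C S \<and> unit_obj S = unit_obj P \<and>
    (\<forall>n. low_mult n \<longrightarrow>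
      (\<forall>X \<in> Obj (power_cat C n). fobj (mult S n) X = fobj (mult P n) X) \<and>
      (\<forall>f \<in> Arr (power_cat C n). farr (mult S n) f = farr (mult P n) f)) \<and>
    (\<forall>n l r. l + r \<le> n \<and> low_assoc n l r \<longrightarrow>
      (\<forall>X \<in> Obj (power_cat C n). oassoc S n l r X = oassoc P n l r X))"


section \<open>Morphisms and equivalence\<close>

text \<open>Morphisms of the form \<open>(id, t)\<close>; \<open>t n X\<close> is the component of \<open>t\<^sub>n\<close> at the tuple \<open>X\<close>.\<close>

locale oplax_morphism =
  fixes C :: "('o, 'm) cat" and S T :: "('o, 'm) oplax_data" and t :: "nat \<Rightarrow> 'o list \<Rightarrow> 'm"
  assumes source: "normal_oplax C S"
    and target: "normal_oplax C T"
    and same_unit: "unit_obj S = unit_obj T"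
    and t_nat_trans: "nat_trans (power_cat C n) C (mult S n) (mult T n) (t n)"
    and t_low: "n \<le> 1 \<Longrightarrow> X \<in> Obj (power_cat C n) \<Longrightarrow> t n X = ident C (fobj (mult S n) X)"
    and t_compat:
      "l + r \<le> n \<Longrightarrow> X \<in> Obj (power_cat C n) \<Longrightarrow>
        comp C (oassoc T n l r X) (t n X)
        = comp C (farr (mult T (n - r + 1)) (plug_arr C l r (t r) X))
            (comp C (t (n - r + 1) (plug l r (fobj (mult S r)) X))
                    (oassoc S n l r X))"

text \<open>
  Morphisms with \<open>t\<^sub>n = id\<close> for \<open>n \<le> 3\<close>. Together with naturality, this makes \<open>mult S n\<close> and
  \<open>mult T n\<close> agree on objects and arrows for \<open>n \<le> 3\<close>.
\<close>

definition low_id_morphism ::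
  "('o, 'm) cat \<Rightarrow> ('o, 'm) oplax_data \<Rightarrow> ('o, 'm) oplax_data \<Rightarrow> (nat \<Rightarrow> 'o list \<Rightarrow> 'm) \<Rightarrow> bool" where
  "low_id_morphism C S T t \<longleftrightarrow> oplax_morphism C S T t \<and>
    (\<forall>n \<le> 3. \<forall>X \<in> Obj (power_cat C n). t n X = ident C (fobj (mult S n) X))"

definition same_components ::
  "('o, 'm) cat \<Rightarrow> (nat \<Rightarrow> 'o list \<Rightarrow> 'm) \<Rightarrow> (nat \<Rightarrow> 'o list \<Rightarrow> 'm) \<Rightarrow> bool" where
  "same_components C t t' \<longleftrightarrow> (\<forall>n. \<forall>X \<in> Obj (power_cat C n). t n X = t' n X)"

definition terminal_completion ::
  "('o, 'm) cat \<Rightarrow> ('o, 'm) oplax_data \<Rightarrow> ('o, 'm) oplax_data \<Rightarrow> bool" where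
  "terminal_completion C P T \<longleftrightarrow> completes C P T \<and>
    (\<forall>S. completes C P S \<longrightarrow>
      (\<exists>t. low_id_morphism C S T t \<and>
        (\<forall>t'. low_id_morphism C S T t' \<longrightarrow> same_components C t' t)))"

text \<open>\<open>equivclp\<close> (reflexive, symmetric, transitive closure) expresses finite zigzags.\<close>

definition oplax_equivalent ::
  "('o, 'm) cat \<Rightarrow> ('o, 'm) oplax_data \<Rightarrow> ('o, 'm) oplax_data \<Rightarrow> bool" where
  "oplax_equivalent C S T \<longleftrightarrow> normal_oplax C S \<and> normal_oplax C T \<and>
    equivclp (\<lambda>S T. \<exists>t. low_id_morphism C S T t) S T"

end

theory Submission
  imports Defs
begin

text \<open>
  The degree of a tuple is its length. Suppose that the multiplications are known in degrees at most
  \<open>N\<close>, and the structure maps \<open>\<alpha>\<close> whenever their source and their target have degree at most \<open>N\<close>.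
  For \<open>N = 3\<close> this is exactly the given data: \<open>\<alpha>\<^bsub>3,l,0\<^esub>\<close> is missing because its target has degree 4.
  Such data extend by one degree, and in a best possible way.

  In an extension, the object \<open>\<mu>(X)\<close> for a tuple \<open>X\<close> of degree \<open>N + 1\<close> has a map \<open>\<alpha>\<close> to
  \<open>\<mu>(A, \<mu>(B), Z)\<close> for every splitting \<open>X = (A, B, Z)\<close> with \<open>2 \<le> |B| \<le> N\<close>. These targets and all maps
  between them that occur in the axioms (i) and (ii) for \<open>X\<close> are already known, since they live in degrees at
  most \<open>N\<close>. Take for \<open>\<mu>(X)\<close> the universal object with such maps, which is a finite limit. Functoriality of
  \<open>\<mu>\<close>, naturality of the new \<open>\<alpha>\<close> and the axioms starting in degree \<open>N + 1\<close> then hold by construction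
  (locale \<open>limit_step\<close>).

  The remaining maps \<open>\<alpha> : \<mu>(A, Z) \<rightarrow> \<mu>(A, I, Z)\<close> from degree \<open>N\<close> to degree \<open>N + 1\<close> are determined by their
  composites with the limit projections, and axioms (i) and (ii) prescribe these: a block of \<open>(A, I, Z)\<close>
  lies to the left of the unit, to its right, or contains it, and each case expresses the composite by known
  maps. The prescribed maps form a cone, by the axioms in lower degrees; the same axioms show that inserting
  two units does not depend on the order (locale \<open>unit_step\<close>). Iterating gives a completion \<open>T\<close>.

  For any completion \<open>S\<close>, a morphism \<open>t : S \<rightarrow> T\<close> must satisfy
  \<open>\<beta> \<circ> t(A, B, Z) = \<nu>(A, t(B), Z) \<circ> t(A, \<mu>(B), Z) \<circ> \<alpha>\<close>, where the right-hand side only involves \<open>t\<close> in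
  smaller degrees. Since \<open>T\<close> is a limit in every degree above 3, this equation defines \<open>t\<close> by recursion on the
  degree and determines it uniquely (locale \<open>comparison_step\<close>). Hence \<open>T\<close> is terminal, and two completions
  are connected by the zigzag through \<open>T\<close>.

  All of this is carried out in a form in which \<open>\<mu>\<close> acts on lists and \<open>\<alpha>\<close> is indexed by the three parts
  \<open>A\<close>, \<open>B\<close>, \<open>Z\<close> of the list it acts on, instead of by numbers \<open>n, l, r\<close> (locale \<open>oplax_blocks\<close>).
\<close>

section \<open>Diagram chases in a category\<close>

context category
begin

abbreviation seq :: "'m \<Rightarrow> 'm \<Rightarrow> 'm" (infixr "\<cdot>" 70) where
  "g \<cdot> f \<equiv> comp C g f"

abbreviation objs :: "'o list set" where
  "objs \<equiv> lists (Obj C)"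

abbreviation arrs :: "'m list set" where
  "arrs \<equiv> lists (Arr C)"

lemma seq_in_Arr [simp]: "f \<in> Arr C \<Longrightarrow> g \<in> Arr C \<Longrightarrow> cod C f = dom C g \<Longrightarrow> g \<cdot> f \<in> Arr C"
  and dom_seq [simp]: "f \<in> Arr C \<Longrightarrow> g \<in> Arr C \<Longrightarrow> cod C f = dom C g \<Longrightarrow> dom C (g \<cdot> f) = dom C f"
  and cod_seq [simp]: "f \<in> Arr C \<Longrightarrow> g \<in> Arr C \<Longrightarrow> cod C f = dom C g \<Longrightarrow> cod C (g \<cdot> f) = cod C g"
  using comp_in_hom[of f "dom C f" "cod C f" g "cod C g"] by (auto simp: hom_def)

lemma seq_assoc:
  "f \<in> Arr C \<Longrightarrow> g \<in> Arr C \<Longrightarrow> h \<in> Arr C \<Longrightarrow> cod C f = dom C g \<Longrightarrow> cod C g = dom C h \<Longrightarrow>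
    (h \<cdot> g) \<cdot> f = h \<cdot> g \<cdot> f"
  using comp_assoc[of f "dom C f" "cod C f" g "cod C g" h "cod C h"] by (auto simp: hom_def)

lemma ident_in_Arr [simp]: "x \<in> Obj C \<Longrightarrow> ident C x \<in> Arr C"
  and dom_ident [simp]: "x \<in> Obj C \<Longrightarrow> dom C (ident C x) = x"
  and cod_ident [simp]: "x \<in> Obj C \<Longrightarrow> cod C (ident C x) = x"
  using ident_in_hom[of x] by (auto simp: hom_def)

lemma seq_ident [simp]: "f \<in> Arr C \<Longrightarrow> dom C f = x \<Longrightarrow> f \<cdot> ident C x = f"
  and ident_seq [simp]: "f \<in> Arr C \<Longrightarrow> cod C f = x \<Longrightarrow> ident C x \<cdot> f = f"
  using comp_ident_right comp_ident_left by auto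

lemma dom_Obj [simp]: "f \<in> Arr C \<Longrightarrow> dom C f \<in> Obj C"
  and cod_Obj [simp]: "f \<in> Arr C \<Longrightarrow> cod C f \<in> Obj C"
  using dom_in_Obj cod_in_Obj by auto

lemma map_dom_objs [simp]: "F \<in> arrs \<Longrightarrow> map (dom C) F \<in> objs"
  and map_cod_objs [simp]: "F \<in> arrs \<Longrightarrow> map (cod C) F \<in> objs"
  and map_ident_arrs [simp]: "X \<in> objs \<Longrightarrow> map (ident C) X \<in> arrs"
  by auto

lemma map_dom_ident [simp]: "X \<in> objs \<Longrightarrow> map (dom C) (map (ident C) X) = X"
  and map_cod_ident [simp]: "X \<in> objs \<Longrightarrow> map (cod C) (map (ident C) X) = X"
  by (induction X) auto

lemma map_dom_ident' [simp]: "X \<in> objs \<Longrightarrow> map (dom C \<circ> ident C) X = X"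
  and map_cod_ident' [simp]: "X \<in> objs \<Longrightarrow> map (cod C \<circ> ident C) X = X"
  by (induction X) auto

lemma map2_ident_left [simp]: "F \<in> arrs \<Longrightarrow> map (cod C) F = X \<Longrightarrow> map2 (comp C) (map (ident C) X) F = F"
  by (induction F arbitrary: X) auto

lemma map2_ident_right [simp]: "F \<in> arrs \<Longrightarrow> map (dom C) F = X \<Longrightarrow> map2 (comp C) F (map (ident C) X) = F"
  by (induction F arbitrary: X) auto

lemma map2_comp_typing:
  assumes "F \<in> arrs" "G \<in> arrs" "map (cod C) F = map (dom C) G"
  shows "map2 (comp C) G F \<in> arrs \<and> map (dom C) (map2 (comp C) G F) = map (dom C) F \<and>
    map (cod C) (map2 (comp C) G F) = map (cod C) G"
  using assms
proof (induction F arbitrary: G)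
  case (Cons f F)
  then show ?case
    by (cases G) auto
qed simp

lemma map2_comp_assoc:
  assumes "f \<in> arrs" "g \<in> arrs" "h \<in> arrs" "map (cod C) f = map (dom C) g" "map (cod C) g = map (dom C) h"
  shows "map2 (comp C) h (map2 (comp C) g f) = map2 (comp C) (map2 (comp C) h g) f"
  using assms
proof (induction f arbitrary: g h)
  case (Cons a f)
  then show ?case
    by (cases g; cases h) (auto simp: seq_assoc)
qed simp

text \<open>
  Three commuting squares, two of which share the arrow \<open>v\<close>, glue to a commuting hexagon. All
  verifications that a family of legs is a cone have this shape: the two legs are \<open>v1 \<cdot> a1\<close> and
  \<open>v2 \<cdot> a2\<close>, the maps \<open>x1\<close> and \<open>x2\<close> of the cone condition pass the last parts \<open>v1\<close>, \<open>v2\<close> of the legs,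
  and there remains a relation between the first parts in lower degree.
\<close>

lemma cube:
  assumes "x1 \<cdot> v1 = v \<cdot> y1" "x2 \<cdot> v2 = v \<cdot> y2" "y1 \<cdot> a1 = y2 \<cdot> a2"
    and "a1 \<in> Arr C" "v1 \<in> Arr C" "x1 \<in> Arr C" "a2 \<in> Arr C" "v2 \<in> Arr C" "x2 \<in> Arr C"
    and "v \<in> Arr C" "y1 \<in> Arr C" "y2 \<in> Arr C"
    and "cod C a1 = dom C v1" "cod C v1 = dom C x1" "cod C a2 = dom C v2" "cod C v2 = dom C x2"
    and "cod C a1 = dom C y1" "cod C a2 = dom C y2" "cod C y1 = dom C v" "cod C y2 = dom C v"
  shows "x1 \<cdot> v1 \<cdot> a1 = x2 \<cdot> v2 \<cdot> a2"
proof -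
  note typing = assms(4-)
  have "x1 \<cdot> v1 \<cdot> a1 = (x1 \<cdot> v1) \<cdot> a1"
    using typing by (simp add: seq_assoc)
  also have "\<dots> = v \<cdot> y1 \<cdot> a1"
    unfolding assms(1) using typing by (simp add: seq_assoc)
  also have "\<dots> = (v \<cdot> y2) \<cdot> a2"
    unfolding assms(3) using typing by (simp add: seq_assoc)
  also have "\<dots> = x2 \<cdot> v2 \<cdot> a2"
    unfolding assms(2)[symmetric] using typing by (simp add: seq_assoc)
  finally show ?thesis .
qed

text \<open>
  The shape of all verifications that two arrows \<open>u1 \<cdot> c1\<close> and \<open>u2 \<cdot> c2\<close> into a limit agree after
  the projection \<open>p\<close>: both composites are moved to the common first arrow \<open>b\<close>.
\<close>

lemma slide:
  assumes "p \<cdot> u1 = v1 \<cdot> b1" "p \<cdot> u2 = v2 \<cdot> b2" "b1 \<cdot> c1 = d1 \<cdot> b" "b2 \<cdot> c2 = d2 \<cdot> b"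
    and "v1 \<cdot> d1 = v2 \<cdot> d2"
    and "p \<in> Arr C" "u1 \<in> Arr C" "u2 \<in> Arr C" "v1 \<in> Arr C" "v2 \<in> Arr C" "b1 \<in> Arr C" "b2 \<in> Arr C"
    "c1 \<in> Arr C" "c2 \<in> Arr C" "d1 \<in> Arr C" "d2 \<in> Arr C" "b \<in> Arr C"
    and "cod C c1 = dom C u1" "cod C c2 = dom C u2" "cod C u1 = dom C p" "cod C u2 = dom C p"
    and "cod C c1 = dom C b1" "cod C c2 = dom C b2" "cod C b1 = dom C v1" "cod C b2 = dom C v2"
    and "cod C b = dom C d1" "cod C b = dom C d2" "cod C d1 = dom C v1" "cod C d2 = dom C v2"
  shows "p \<cdot> u1 \<cdot> c1 = p \<cdot> u2 \<cdot> c2"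
proof -
  note typing = assms(6-)
  have "p \<cdot> u1 \<cdot> c1 = (p \<cdot> u1) \<cdot> c1"
    using typing by (simp add: seq_assoc)
  also have "\<dots> = v1 \<cdot> b1 \<cdot> c1"
    unfolding assms(1) using typing by (simp add: seq_assoc)
  also have "\<dots> = (v1 \<cdot> d1) \<cdot> b"
    unfolding assms(3) using typing by (simp add: seq_assoc)
  also have "\<dots> = v2 \<cdot> b2 \<cdot> c2"
    unfolding assms(5) assms(4) using typing by (simp add: seq_assoc)
  also have "\<dots> = (p \<cdot> u2) \<cdot> c2"
    unfolding assms(2) using typing by (simp add: seq_assoc)
  also have "\<dots> = p \<cdot> u2 \<cdot> c2"
    using typing by (simp add: seq_assoc)
  finally show ?thesis .
qed

text \<open>
  Two squares side by side. A map of the form \<open>f \<cdot> g\<close> with \<open>f\<close> in one entry of a tuple and \<open>g\<close> a component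
  of a morphism is moved past \<open>x\<close> by naturality for \<open>f\<close> and by compatibility for \<open>g\<close>, or the other way round.
\<close>

lemma paste:
  assumes "x \<cdot> f = f' \<cdot> x'" "x' \<cdot> g = g' \<cdot> y"
    and "x \<in> Arr C" "f \<in> Arr C" "f' \<in> Arr C" "x' \<in> Arr C" "g \<in> Arr C" "g' \<in> Arr C" "y \<in> Arr C"
    and "cod C g = dom C f" "cod C f = dom C x" "cod C x' = dom C f'" "cod C g = dom C x'"
      "cod C y = dom C g'" "cod C g' = dom C f'"
  shows "x \<cdot> f \<cdot> g = (f' \<cdot> g') \<cdot> y"
proof -
  note typing = assms(3-)
  have "x \<cdot> f \<cdot> g = (x \<cdot> f) \<cdot> g"
    using typing by (simp add: seq_assoc)
  also have "\<dots> = f' \<cdot> x' \<cdot> g"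
    unfolding assms(1) using typing by (simp add: seq_assoc)
  also have "\<dots> = (f' \<cdot> g') \<cdot> y"
    unfolding assms(2) using typing by (simp add: seq_assoc)
  finally show ?thesis .
qed

lemma Obj_power_cat: "X \<in> Obj (power_cat C n) \<longleftrightarrow> X \<in> objs \<and> length X = n"
  by (auto simp: power_cat_def)

lemma Arr_power_cat: "f \<in> Arr (power_cat C n) \<longleftrightarrow> f \<in> arrs \<and> length f = n"
  by (auto simp: power_cat_def)

lemma power_cat_simps [simp]:
  "dom (power_cat C n) = map (dom C)" "cod (power_cat C n) = map (cod C)"
  "ident (power_cat C n) = map (ident C)" "comp (power_cat C n) = map2 (comp C)"
  by (simp_all add: power_cat_def)

lemma hom_power_cat: "f \<in> hom (power_cat C n) X Y \<longleftrightarrow>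
    f \<in> arrs \<and> length f = n \<and> map (dom C) f = X \<and> map (cod C) f = Y"
  by (auto simp: hom_def Arr_power_cat)

lemma power_cat_category: "category (power_cat C n)"
proof
  show "f \<in> hom (power_cat C n) x y \<Longrightarrow> g \<in> hom (power_cat C n) y z \<Longrightarrow>
      comp (power_cat C n) g f \<in> hom (power_cat C n) x z" for f g x y z
    using map2_comp_typing[of f g] by (auto simp: hom_power_cat)
  show "f \<in> hom (power_cat C n) w x \<Longrightarrow> g \<in> hom (power_cat C n) x y \<Longrightarrow> h \<in> hom (power_cat C n) y z \<Longrightarrow>
      comp (power_cat C n) h (comp (power_cat C n) g f) = comp (power_cat C n) (comp (power_cat C n) h g) f"
    for f g h w x y z
    using map2_comp_assoc[of f g h] by (auto simp: hom_power_cat)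
  show "f \<in> Arr (power_cat C n) \<Longrightarrow> comp (power_cat C n) f (ident (power_cat C n) (dom (power_cat C n) f)) =
      f" for f
    by (simp add: Arr_power_cat del: map_map)
  show "f \<in> Arr (power_cat C n) \<Longrightarrow> comp (power_cat C n) (ident (power_cat C n) (cod (power_cat C n) f)) f =
      f" for f
    by (simp add: Arr_power_cat del: map_map)
qed (auto simp: Obj_power_cat Arr_power_cat hom_power_cat)

end

section \<open>Limits of finite systems of equations\<close>

text \<open>
  The universal solution of finitely many equations \<open>f \<cdot> p i = g \<cdot> p j\<close> is the limit over a
  bipartite category: one object for each index, one for each
  equation, and two arrows into each equation from the indices it involves. Being finite, this category embeds
  into the infinite universe \<open>'u\<close>.
\<close>

lemma (in category) joint_limit:
  fixes Ix :: "'i set" and Rel :: "('i \<times> 'm \<times> 'i \<times> 'm) set" and a :: "'i \<Rightarrow> 'o"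
  assumes lims: "has_small_limits TYPE('u) C" and inf: "infinite (UNIV :: 'u set)"
    and fin: "finite Ix" "finite Rel"
    and a: "\<And>i. i \<in> Ix \<Longrightarrow> a i \<in> Obj C"
    and rel: "\<And>i f j g. (i, f, j, g) \<in> Rel \<Longrightarrow> i \<in> Ix \<and> j \<in> Ix \<and> f \<in> Arr C \<and> g \<in> Arr C \<and>
      dom C f = a i \<and> dom C g = a j \<and> cod C f = cod C g"
  shows "\<exists>x p. x \<in> Obj C \<and> (\<forall>i \<in> Ix. p i \<in> Arr C \<and> dom C (p i) = x \<and> cod C (p i) = a i) \<and>
    (\<forall>(i, f, j, g) \<in> Rel. f \<cdot> p i = g \<cdot> p j) \<and>
    (\<forall>y q. y \<in> Obj C \<and> (\<forall>i \<in> Ix. q i \<in> Arr C \<and> dom C (q i) = y \<and> cod C (q i) = a i) \<and>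
      (\<forall>(i, f, j, g) \<in> Rel. f \<cdot> q i = g \<cdot> q j) \<longrightarrow>
      (\<exists>!h. h \<in> Arr C \<and> dom C h = y \<and> cod C h = x \<and> (\<forall>i \<in> Ix. p i \<cdot> h = q i)))"
proof -
  \<comment> \<open>nodes of the diagram: indices and equations\<close>
  define Nd :: "('i + ('i \<times> 'm \<times> 'i \<times> 'm)) set" where "Nd = Inl ` Ix \<union> Inr ` Rel"
  \<comment> \<open>arrows of the diagram: identities of the nodes, and two arrows for each equation\<close>
  define Ks :: "(('i + ('i \<times> 'm \<times> 'i \<times> 'm)) + ('i \<times> 'm \<times> 'i \<times> 'm) \<times> bool) set"
    where "Ks = Inl ` Nd \<union> Inr ` (Rel \<times> UNIV)"
  have "finite Ks"
    unfolding Ks_def Nd_def using fin by simp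
  moreover obtain T :: "'u set" where "finite T" "card T = card Ks"
    using infinite_arbitrarily_large[OF inf] by blast
  ultimately obtain e where e: "bij_betw e Ks T"
    using finite_same_card_bij by metis
  define \<delta> where "\<delta> = inv_into Ks e"
  have \<delta>e [simp]: "k \<in> Ks \<Longrightarrow> \<delta> (e k) = k" for k
    unfolding \<delta>_def using e by (auto simp: bij_betw_def)
  have e_eq [simp]: "k \<in> Ks \<Longrightarrow> k' \<in> Ks \<Longrightarrow> e k = e k' \<longleftrightarrow> k = k'" for k k'
    using e by (auto simp: bij_betw_def inj_on_def)
  define src :: "('i \<times> 'm \<times> 'i \<times> 'm) \<Rightarrow> bool \<Rightarrow> 'i"
    where "src = (\<lambda>(i, f, j, g) b. if b then i else j)"
  define ar :: "('i \<times> 'm \<times> 'i \<times> 'm) \<Rightarrow> bool \<Rightarrow> 'm"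
    where "ar = (\<lambda>(i, f, j, g) b. if b then f else g)"
  define tgt :: "('i \<times> 'm \<times> 'i \<times> 'm) \<Rightarrow> 'o" where "tgt = (\<lambda>(i, f, j, g). cod C f)"
  have rel': "src r b \<in> Ix" "ar r b \<in> Arr C" "dom C (ar r b) = a (src r b)" "cod C (ar r b) = tgt r"
    "tgt r \<in> Obj C" if "r \<in> Rel" for r b
    using that rel by (cases r; auto simp: src_def ar_def tgt_def)+
  have in_Ks [simp]: "Inl (Inl i) \<in> Ks \<longleftrightarrow> i \<in> Ix" "Inl (Inr r) \<in> Ks \<longleftrightarrow> r \<in> Rel" "Inr (r, b) \<in> Ks \<longleftrightarrow> r \<in> Rel" for i
      r b
    by (auto simp: Ks_def Nd_def)
  define J :: "('u, 'u) cat" where "J = \<lparr> Obj = e ` Inl ` Nd, Arr = e ` Ks,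
    dom = (\<lambda>v. case \<delta> v of Inl _ \<Rightarrow> v | Inr (r, b) \<Rightarrow> e (Inl (Inl (src r b)))),
    cod = (\<lambda>v. case \<delta> v of Inl _ \<Rightarrow> v | Inr (r, b) \<Rightarrow> e (Inl (Inr r))),
    ident = (\<lambda>v. v), comp = (\<lambda>v v'. case \<delta> v of Inl _ \<Rightarrow> v' | Inr _ \<Rightarrow> v) \<rparr>"
  have J_simps: "Obj J = e ` Inl ` Nd" "Arr J = e ` Ks"
    "dom J = (\<lambda>v. case \<delta> v of Inl _ \<Rightarrow> v | Inr (r, b) \<Rightarrow> e (Inl (Inl (src r b))))"
    "cod J = (\<lambda>v. case \<delta> v of Inl _ \<Rightarrow> v | Inr (r, b) \<Rightarrow> e (Inl (Inr r)))"
    "ident J = (\<lambda>v. v)" "comp J = (\<lambda>v v'. case \<delta> v of Inl _ \<Rightarrow> v' | Inr _ \<Rightarrow> v)"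
    by (simp_all add: J_def)
  define F :: "('u, 'u, 'o, 'm) ftor" where "F = \<lparr>
    fobj = (\<lambda>v. case \<delta> v of Inl (Inl i) \<Rightarrow> a i | Inl (Inr r) \<Rightarrow> tgt r | Inr _ \<Rightarrow> undefined),
    farr = (\<lambda>v. case \<delta> v of Inl (Inl i) \<Rightarrow> ident C (a i) | Inl (Inr r) \<Rightarrow> ident C (tgt r) | Inr (r, b) \<Rightarrow> ar r b)
        \<rparr>"
  have F_simps: "fobj F = (\<lambda>v. case \<delta> v of Inl (Inl i) \<Rightarrow> a i | Inl (Inr r) \<Rightarrow> tgt r | Inr _ \<Rightarrow> undefined)"
    "farr F = (\<lambda>v. case \<delta> v of Inl (Inl i) \<Rightarrow> ident C (a i) | Inl (Inr r) \<Rightarrow> ident C (tgt r) | Inr (r, b) \<Rightarrow> ar r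
        b)"
    by (simp_all add: F_def)
  have J_arr: "v \<in> Arr J \<longleftrightarrow> (\<exists>i \<in> Ix. v = e (Inl (Inl i))) \<or> (\<exists>r \<in> Rel. v = e (Inl (Inr r))) \<or>
      (\<exists>r \<in> Rel. \<exists>b. v = e (Inr (r, b)))" for v
    by (auto simp: J_simps Ks_def Nd_def image_iff)
  have J_obj: "v \<in> Obj J \<longleftrightarrow> (\<exists>i \<in> Ix. v = e (Inl (Inl i))) \<or> (\<exists>r \<in> Rel. v = e (Inl (Inr r)))" for v
    by (auto simp: J_simps Nd_def image_iff)
  interpret J: category J
  proof
    show "f \<in> Arr J \<Longrightarrow> dom J f \<in> Obj J" for f
      unfolding J_arr J_obj by (auto simp: J_simps rel')
    show "f \<in> Arr J \<Longrightarrow> cod J f \<in> Obj J" for f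
      unfolding J_arr J_obj by (auto simp: J_simps rel')
    show "x \<in> Obj J \<Longrightarrow> ident J x \<in> hom J x x" for x
      unfolding hom_def J_arr J_obj by (auto simp: J_simps rel')
    show "f \<in> hom J x y \<Longrightarrow> g \<in> hom J y z \<Longrightarrow> comp J g f \<in> hom J x z" for f g x y z
      unfolding hom_def J_arr mem_Collect_eq by (auto simp: J_simps rel')
    show "f \<in> Arr J \<Longrightarrow> comp J f (ident J (dom J f)) = f" for f
      unfolding J_arr by (auto simp: J_simps rel')
    show "f \<in> Arr J \<Longrightarrow> comp J (ident J (cod J f)) f = f" for f
      unfolding J_arr by (auto simp: J_simps rel')
    show "f \<in> hom J w x \<Longrightarrow> g \<in> hom J x y \<Longrightarrow> h \<in> hom J y z \<Longrightarrow>
      comp J h (comp J g f) = comp J (comp J h g) f" for f g h w x y z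
      unfolding hom_def J_arr mem_Collect_eq by (auto simp: J_simps rel' split: sum.splits)
  qed
  have "cat_functor J C F"
  proof
    show "x \<in> Obj J \<Longrightarrow> fobj F x \<in> Obj C" for x
      unfolding J_obj by (auto simp: F_simps a rel')
    show "f \<in> hom J x y \<Longrightarrow> farr F f \<in> hom C (fobj F x) (fobj F y)" for f x y
      unfolding hom_def J_arr mem_Collect_eq by (auto simp: J_simps F_simps a rel')
    show "x \<in> Obj J \<Longrightarrow> farr F (ident J x) = ident C (fobj F x)" for x
      unfolding J_obj by (auto simp: J_simps F_simps a rel')
    show "f \<in> hom J x y \<Longrightarrow> g \<in> hom J y z \<Longrightarrow> farr F (comp J g f) = farr F g \<cdot> farr F f" for f g x y z
      unfolding hom_def J_arr mem_Collect_eq by (auto simp: J_simps F_simps a rel')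
  qed
  then obtain x p where lim: "is_limit J C F x p"
    using lims unfolding has_small_limits_def by blast
  define p' where "p' i = p (e (Inl (Inl i)))" for i
  have cone: "is_cone J C F x p"
    using lim by (simp add: is_limit_def)
  then have x: "x \<in> Obj C" and pj: "\<And>v. v \<in> Obj J \<Longrightarrow> p v \<in> hom C x (fobj F v)"
    and pa: "\<And>v. v \<in> Arr J \<Longrightarrow> farr F v \<cdot> p (dom J v) = p (cod J v)"
    by (auto simp: is_cone_def)
  have p': "p' i \<in> Arr C" "dom C (p' i) = x" "cod C (p' i) = a i" if "i \<in> Ix" for i
    using pj[of "e (Inl (Inl i))"] that by (auto simp: J_obj F_simps p'_def hom_def)
  have p_rel: "p (e (Inl (Inr r))) = ar r b \<cdot> p' (src r b)" if "r \<in> Rel" for r b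
    using pa[of "e (Inr (r, b))"] that by (auto simp: J_arr J_simps F_simps p'_def)
  have rels: "f \<cdot> p' i = g \<cdot> p' j" if "(i, f, j, g) \<in> Rel" for i f j g
    using p_rel[OF that, of True] p_rel[OF that, of False] by (simp add: ar_def src_def)
  have univ: "\<exists>!h. h \<in> Arr C \<and> dom C h = y \<and> cod C h = x \<and> (\<forall>i \<in> Ix. p' i \<cdot> h = q i)"
    if y: "y \<in> Obj C" and q: "\<And>i. i \<in> Ix \<Longrightarrow> q i \<in> Arr C \<and> dom C (q i) = y \<and> cod C (q i) = a i"
      and qr: "\<And>i f j g. (i, f, j, g) \<in> Rel \<Longrightarrow> f \<cdot> q i = g \<cdot> q j" for y q
  proof -
    define Q where "Q v = (case \<delta> v of Inl (Inl i) \<Rightarrow> q i | Inl (Inr r) \<Rightarrow> ar r True \<cdot> q (src r True) | Inr _ \<Rightarrow>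
        undefined)" for v
    have qr': "ar r b \<cdot> q (src r b) = ar r True \<cdot> q (src r True)" if "r \<in> Rel" for r b
      using qr that by (cases r; cases b) (auto simp: ar_def src_def)
    have Q_obj: "Q v \<in> hom C y (fobj F v)" if "v \<in> Obj J" for v
      using that[unfolded J_obj]
    proof
      assume "\<exists>i \<in> Ix. v = e (Inl (Inl i))"
      then show ?thesis
        using q by (auto simp: Q_def F_simps hom_def)
    next
      assume "\<exists>r \<in> Rel. v = e (Inl (Inr r))"
      then show ?thesis
        using q[OF rel'(1)] rel' by (auto simp: Q_def F_simps hom_def)
    qed
    have Q_arr: "farr F v \<cdot> Q (dom J v) = Q (cod J v)" if "v \<in> Arr J" for v
      using that[unfolded J_arr]
    proof (elim disjE bexE exE)
      fix i assume "i \<in> Ix" "v = e (Inl (Inl i))"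
      then show ?thesis
        using q[of i] by (simp add: Q_def F_simps J_simps)
    next
      fix r assume "r \<in> Rel" "v = e (Inl (Inr r))"
      then show ?thesis
        using q[OF rel'(1)[of r True]] rel'(1-4)[of r True] rel'(5)[of r] by (simp add: Q_def F_simps J_simps)
    next
      fix r b assume "r \<in> Rel" "v = e (Inr (r, b))"
      then show ?thesis
        using qr'[of r b] rel'(1)[of r b] by (simp add: Q_def F_simps J_simps)
    qed
    have "is_cone J C F y Q"
      using y Q_obj Q_arr by (simp add: is_cone_def)
    then have "\<exists>!h. h \<in> hom C y x \<and> (\<forall>j \<in> Obj J. p j \<cdot> h = Q j)"
      using lim by (simp add: is_limit_def)
    moreover have "(h \<in> hom C y x \<and> (\<forall>j \<in> Obj J. p j \<cdot> h = Q j)) \<longleftrightarrow>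
        (h \<in> Arr C \<and> dom C h = y \<and> cod C h = x \<and> (\<forall>i \<in> Ix. p' i \<cdot> h = q i))" (is "?L \<longleftrightarrow> ?R") for h
    proof
      assume ?L
      then show ?R
        by (auto simp: hom_def J_obj Q_def p'_def)
    next
      assume R: ?R
      have "p (e (Inl (Inr r))) \<cdot> h = ar r True \<cdot> q (src r True)" if "r \<in> Rel" for r
        using that R p_rel[OF that, of True] rel'(1-4)[OF that, of True] rel'(5)[OF that] p'[of "src r True"]
            by (simp add: seq_assoc)
      with R show ?L
        by (auto simp: hom_def J_obj Q_def p'_def)
    qed
    ultimately show ?thesis
      by simp
  qed
  show ?thesis
  proof (intro exI[of _ x] exI[of _ p'] conjI allI impI)
    fix y q
    assume "y \<in> Obj C \<and> (\<forall>i \<in> Ix. q i \<in> Arr C \<and> dom C (q i) = y \<and> cod C (q i) = a i) \<and>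
      (\<forall>(i, f, j, g) \<in> Rel. f \<cdot> q i = g \<cdot> q j)"
    then show "\<exists>!h. h \<in> Arr C \<and> dom C h = y \<and> cod C h = x \<and> (\<forall>i \<in> Ix. p' i \<cdot> h = q i)"
      by (intro univ) auto
  qed (use x p' rels in auto)
qed

section \<open>Splittings of tuples\<close>

text \<open>
  The position of a marked entry \<open>x\<close> relative to a block \<open>B\<close> of the same list: after it, before it or
  in it. All case distinctions about inserted units come from here.
\<close>

lemma append3_eq_insert_cases:
  assumes "A1 @ B @ Z1 = A @ x # Z"
  obtains (right) M where "A = A1 @ B @ M" "Z1 = M @ x # Z"
    | (left) M where "A1 = A @ x # M" "Z = M @ B @ Z1"
    | (inside) P R where "A = A1 @ P" "B = P @ x # R" "Z = R @ Z1"
  using assms by (fastforce simp: append_eq_append_conv2 append_eq_Cons_conv Cons_eq_append_conv)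

lemma map_eq_append3:
  assumes "map f F = A @ B @ Z"
  obtains F1 F2 F3 where "F = F1 @ F2 @ F3" "map f F1 = A" "map f F2 = B" "map f F3 = Z"
proof -
  obtain F1 F' where 1: "F = F1 @ F'" "A = map f F1" "B @ Z = map f F'"
    using assms by (auto simp: map_eq_append_conv)
  obtain F2 F3 where "F' = F2 @ F3" "B = map f F2" "Z = map f F3"
    using 1(3)[symmetric] by (auto simp: map_eq_append_conv)
  with 1 show ?thesis
    by (intro that[of F1 F2 F3]) simp_all
qed

lemma finite_append3_eq: "finite {(A, B, Z). X = A @ B @ Z}"
proof (rule finite_subset)
  let ?L = "{xs. set xs \<subseteq> set X \<and> length xs \<le> length X}"
  show "{(A, B, Z). X = A @ B @ Z} \<subseteq> ?L \<times> ?L \<times> ?L"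
    by auto
  show "finite (?L \<times> ?L \<times> ?L)"
    by (intro finite_cartesian_product finite_lists_length_le) simp_all
qed

lemma finite_append5_eq: "finite {(A, B, M, B', Z). X = A @ B @ M @ B' @ Z}"
proof (rule finite_subset)
  let ?L = "{xs. set xs \<subseteq> set X \<and> length xs \<le> length X}"
  show "{(A, B, M, B', Z). X = A @ B @ M @ B' @ Z} \<subseteq> ?L \<times> ?L \<times> ?L \<times> ?L \<times> ?L"
    by auto
  show "finite (?L \<times> ?L \<times> ?L \<times> ?L \<times> ?L)"
    by (intro finite_cartesian_product finite_lists_length_le) simp_all
qed

section \<open>Oplax structures in block form\<close>

text \<open>
  Oplax structures up to a degree. The functor \<open>\<mu>\<close> is \<open>m\<close> on objects and \<open>ma\<close> on arrows, and
  \<open>al A B Z\<close> is the component of \<open>\<alpha>\<close> that multiplies the block \<open>B\<close>. Multiplications exist up to degree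
  \<open>K\<close>. For a nonempty block, \<open>al A B Z\<close> exists as soon as its source has degree at most \<open>K\<close>; for an
  empty block, which inserts a unit, the source must have degree less than \<open>L\<close>. The single inequality
  \<open>length A + length Z < L + length B\<close> expresses both, because \<open>K\<close> is \<open>L\<close> or \<open>L + 1\<close>. With \<open>K = L = N\<close>
  source and target have degree at most \<open>N\<close>; the intermediate value \<open>K = N + 1\<close>, \<open>L = N\<close> describes the
  situation after the multiplication of degree \<open>N + 1\<close> has been added but before units can be inserted into
  tuples of degree \<open>N\<close>.
\<close>

locale oplax_blocks = category C
  for C :: "('o, 'm) cat" +
  fixes K L :: nat
    and m :: "'o list \<Rightarrow> 'o"
    and ma :: "'m list \<Rightarrow> 'm"
    and al :: "'o list \<Rightarrow> 'o list \<Rightarrow> 'o list \<Rightarrow> 'm"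
  assumes bounds: "L \<le> K" "K \<le> Suc L" "0 < K"
    and m_Obj [simp]: "X \<in> objs \<Longrightarrow> length X \<le> K \<Longrightarrow> m X \<in> Obj C"
    and ma_in_hom: "F \<in> arrs \<Longrightarrow> length F \<le> K \<Longrightarrow>
      ma F \<in> hom C (m (map (dom C) F)) (m (map (cod C) F))"
    and ma_ident: "X \<in> objs \<Longrightarrow> length X \<le> K \<Longrightarrow> ma (map (ident C) X) = ident C (m X)"
    and ma_comp: "F \<in> arrs \<Longrightarrow> G \<in> arrs \<Longrightarrow> map (cod C) F = map (dom C) G \<Longrightarrow> length F \<le> K \<Longrightarrow>
      ma (map2 (comp C) G F) = ma G \<cdot> ma F"
    and m_single [simp]: "x \<in> Obj C \<Longrightarrow> m [x] = x"
    and ma_single [simp]: "f \<in> Arr C \<Longrightarrow> ma [f] = f"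
    and al_in_hom: "A \<in> objs \<Longrightarrow> B \<in> objs \<Longrightarrow> Z \<in> objs \<Longrightarrow>
      length A + length B + length Z \<le> K \<Longrightarrow> length A + length Z < L + length B \<Longrightarrow>
      al A B Z \<in> hom C (m (A @ B @ Z)) (m (A @ m B # Z))"
    and al_natural: "F \<in> arrs \<Longrightarrow> G \<in> arrs \<Longrightarrow> H \<in> arrs \<Longrightarrow>
      length F + length G + length H \<le> K \<Longrightarrow> length F + length H < L + length G \<Longrightarrow>
      al (map (cod C) F) (map (cod C) G) (map (cod C) H) \<cdot> ma (F @ G @ H) =
      ma (F @ ma G # H) \<cdot> al (map (dom C) F) (map (dom C) G) (map (dom C) H)"
    and al_single: "A \<in> objs \<Longrightarrow> x \<in> Obj C \<Longrightarrow> Z \<in> objs \<Longrightarrow> length A + length Z < K \<Longrightarrow>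
      al A [x] Z = ident C (m (A @ x # Z))"
    and al_whole: "B \<in> objs \<Longrightarrow> length B \<le> K \<Longrightarrow> 0 < L + length B \<Longrightarrow>
      al [] B [] = ident C (m B)"
    and al_parallel: "A \<in> objs \<Longrightarrow> B \<in> objs \<Longrightarrow> M \<in> objs \<Longrightarrow> B' \<in> objs \<Longrightarrow> Z \<in> objs \<Longrightarrow>
      length A + length B + length M + length B' + length Z \<le> K \<Longrightarrow>
      length A + length M + length B' + length Z < L + length B \<Longrightarrow>
      length A + length B + length M + length Z < L + length B' \<Longrightarrow>
      Suc (length A + length M + length Z) < L + length B \<Longrightarrow>
      Suc (length A + length M + length Z) < L + length B' \<Longrightarrow>
      al (A @ m B # M) B' Z \<cdot> al A B (M @ B' @ Z) = al A B (M @ m B' # Z) \<cdot> al (A @ B @ M) B' Z"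
    and al_nested: "A \<in> objs \<Longrightarrow> P \<in> objs \<Longrightarrow> Q \<in> objs \<Longrightarrow> R \<in> objs \<Longrightarrow> Z \<in> objs \<Longrightarrow>
      length A + length P + length Q + length R + length Z \<le> K \<Longrightarrow>
      length A + length P + length R + length Z < L + length Q \<Longrightarrow>
      ma (map (ident C) A @ al P Q R # map (ident C) Z) \<cdot> al A (P @ Q @ R) Z =
      al A (P @ m Q # R) Z \<cdot> al (A @ P) Q (R @ Z)"
begin

text \<open>
  The action of the multiplication on a single arrow, all other entries being identities. Equations
  between structure maps at different places of a tuple are statements about whiskered arrows.
\<close>

definition whisker :: "'o list \<Rightarrow> 'm \<Rightarrow> 'o list \<Rightarrow> 'm" where
  "whisker A f Z = ma (map (ident C) A @ f # map (ident C) Z)"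

lemma ma_Arr [simp]: "F \<in> arrs \<Longrightarrow> length F \<le> K \<Longrightarrow> ma F \<in> Arr C"
  and dom_ma [simp]: "F \<in> arrs \<Longrightarrow> length F \<le> K \<Longrightarrow> dom C (ma F) = m (map (dom C) F)"
  and cod_ma [simp]: "F \<in> arrs \<Longrightarrow> length F \<le> K \<Longrightarrow> cod C (ma F) = m (map (cod C) F)"
  using ma_in_hom[of F] by (auto simp: hom_def)

lemma
  assumes "A \<in> objs" "B \<in> objs" "Z \<in> objs"
    "length A + length B + length Z \<le> K" "length A + length Z < L + length B"
  shows al_Arr [simp]: "al A B Z \<in> Arr C"
    and dom_al [simp]: "dom C (al A B Z) = m (A @ B @ Z)"
    and cod_al [simp]: "cod C (al A B Z) = m (A @ m B # Z)"
  using al_in_hom[OF assms] by (auto simp: hom_def)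

lemma
  assumes "A \<in> objs" "f \<in> Arr C" "Z \<in> objs" "length A + length Z < K"
  shows whisker_Arr [simp]: "whisker A f Z \<in> Arr C"
    and dom_whisker [simp]: "dom C (whisker A f Z) = m (A @ dom C f # Z)"
    and cod_whisker [simp]: "cod C (whisker A f Z) = m (A @ cod C f # Z)"
  using assms by (simp_all add: whisker_def)

lemma whisker_empty [simp]: "f \<in> Arr C \<Longrightarrow> whisker [] f [] = f"
  by (simp add: whisker_def)

lemma whisker_ident [simp]:
  assumes "A \<in> objs" "x \<in> Obj C" "Z \<in> objs" "length A + length Z < K"
  shows "whisker A (ident C x) Z = ident C (m (A @ x # Z))"
  using assms ma_ident[of "A @ x # Z"] by (simp add: whisker_def)

text \<open>
  Composition in one entry of a tuple of arrows, split off on either side.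
\<close>

lemma ma_whisker:
  assumes "F \<in> arrs" "H \<in> arrs" "f \<in> Arr C" "g \<in> Arr C" "cod C f = dom C g" "length F + length H < K"
  shows "ma (F @ (g \<cdot> f) # H) = whisker (map (cod C) F) g (map (cod C) H) \<cdot> ma (F @ f # H)"
    and "ma (F @ (g \<cdot> f) # H) = ma (F @ g # H) \<cdot> whisker (map (dom C) F) f (map (dom C) H)"
proof -
  have "ma (F @ (g \<cdot> f) # H) =
     ma (map2 (comp C) (map (ident C) (map (cod C) F) @ g # map (ident C) (map (cod C) H)) (F @ f # H))"
    using assms by (simp del: map_map)
  then show "ma (F @ (g \<cdot> f) # H) = whisker (map (cod C) F) g (map (cod C) H) \<cdot> ma (F @ f # H)"
    unfolding whisker_def using assms by (subst ma_comp[symmetric]) (simp_all del: map_map)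
  have "ma (F @ (g \<cdot> f) # H) =
     ma (map2 (comp C) (F @ g # H) (map (ident C) (map (dom C) F) @ f # map (ident C) (map (dom C) H)))"
    using assms by (simp del: map_map)
  then show "ma (F @ (g \<cdot> f) # H) = ma (F @ g # H) \<cdot> whisker (map (dom C) F) f (map (dom C) H)"
    unfolding whisker_def using assms by (subst ma_comp[symmetric]) (simp_all del: map_map)
qed

lemma whisker_seq:
  assumes "A \<in> objs" "Z \<in> objs" "f \<in> Arr C" "g \<in> Arr C" "cod C f = dom C g" "length A + length Z < K"
  shows "whisker A (g \<cdot> f) Z = whisker A g Z \<cdot> whisker A f Z"
  using ma_whisker(1)[of "map (ident C) A" "map (ident C) Z" f g] assms by (simp add: whisker_def)

lemma whisker_interchange:
  assumes "A \<in> objs" "M \<in> objs" "Z \<in> objs" "f \<in> Arr C" "g \<in> Arr C"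
    "Suc (length A + length M + length Z) < K"
    "dom C f = x" "cod C f = x'" "dom C g = y" "cod C g = y'"
  shows "whisker (A @ x' # M) g Z \<cdot> whisker A f (M @ y # Z) =
      whisker A f (M @ y' # Z) \<cdot> whisker (A @ x # M) g Z"
proof -
  have o: "x \<in> Obj C" "x' \<in> Obj C" "y \<in> Obj C" "y' \<in> Obj C"
    using assms by auto
  have "whisker (A @ x' # M) g Z \<cdot> whisker A f (M @ y # Z)
     = ma (map (ident C) A @ f # map (ident C) M @ g # map (ident C) Z)"
    unfolding whisker_def using assms o by (subst ma_comp[symmetric]) simp_all
  also have "\<dots> = whisker A f (M @ y' # Z) \<cdot> whisker (A @ x # M) g Z"
    unfolding whisker_def using assms o by (subst ma_comp[symmetric]) simp_all
  finally show ?thesis .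
qed

lemma al_natural_left:
  assumes "A1 \<in> objs" "A2 \<in> objs" "B \<in> objs" "Z \<in> objs" "f \<in> Arr C" "dom C f = x" "cod C f = y"
    "length A1 + length A2 + length B + length Z < K" "Suc (length A1 + length A2 + length Z) < L + length B"
  shows "al (A1 @ y # A2) B Z \<cdot> whisker A1 f (A2 @ B @ Z) = whisker A1 f (A2 @ m B # Z) \<cdot> al (A1 @ x # A2) B Z"
  using al_natural[of "map (ident C) A1 @ f # map (ident C) A2" "map (ident C) B" "map (ident C) Z"] assms
  by (simp add: whisker_def ma_ident)

lemma al_natural_right:
  assumes "A \<in> objs" "B \<in> objs" "Z1 \<in> objs" "Z2 \<in> objs" "f \<in> Arr C" "dom C f = x" "cod C f = y"
    "length A + length B + length Z1 + length Z2 < K" "Suc (length A + length Z1 + length Z2) < L + length B"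
  shows "al A B (Z1 @ y # Z2) \<cdot> whisker (A @ B @ Z1) f Z2 = whisker (A @ m B # Z1) f Z2 \<cdot> al A B (Z1 @ x # Z2)"
  using al_natural[of "map (ident C) A" "map (ident C) B" "map (ident C) Z1 @ f # map (ident C) Z2"] assms
  by (simp add: whisker_def ma_ident)

lemma al_natural_inside:
  assumes "A \<in> objs" "P \<in> objs" "R \<in> objs" "Z \<in> objs" "f \<in> Arr C" "dom C f = x" "cod C f = y"
    "length A + length P + length R + length Z < K"
  shows "al A (P @ y # R) Z \<cdot> whisker (A @ P) f (R @ Z) = whisker A (whisker P f R) Z \<cdot> al A (P @ x # R) Z"
proof -
  have "length A + length Z < L + Suc (length P + length R)"
    using assms bounds by simp
  then show ?thesis
    using al_natural[of "map (ident C) A" "map (ident C) P @ f # map (ident C) R" "map (ident C) Z"] assms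
    by (simp add: whisker_def ma_ident)
qed

lemma al_nested_whisker:
  assumes "A \<in> objs" "P \<in> objs" "Q \<in> objs" "R \<in> objs" "Z \<in> objs"
      "length A + length P + length Q + length R + length Z \<le> K"
      "length A + length P + length R + length Z < L + length Q"
  shows "whisker A (al P Q R) Z \<cdot> al A (P @ Q @ R) Z = al A (P @ m Q # R) Z \<cdot> al (A @ P) Q (R @ Z)"
  using al_nested[OF assms] by (simp add: whisker_def)

end

section \<open>Multiplications that are limits over their blocks\<close>

context oplax_blocks
begin

text \<open>
  The properties that the maps \<open>al A B Z\<close> out of \<open>m X\<close> have by the axioms for disjoint and for nested
  blocks. Only the blocks for which \<open>al\<close> is not an identity occur: those with at least two entries and
  not the whole of \<open>X\<close>. The inner block of a nested pair may coincide with the outer one; the equation is then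
  trivial.
\<close>

definition block_cone :: "'o list \<Rightarrow> 'o \<Rightarrow> ('o list \<Rightarrow> 'o list \<Rightarrow> 'o list \<Rightarrow> 'm) \<Rightarrow> bool" where
  "block_cone X y q \<longleftrightarrow> y \<in> Obj C \<and>
    (\<forall>A B Z. X = A @ B @ Z \<longrightarrow> 2 \<le> length B \<longrightarrow> length B < length X \<longrightarrow>
      q A B Z \<in> Arr C \<and> dom C (q A B Z) = y \<and> cod C (q A B Z) = m (A @ m B # Z)) \<and>
    (\<forall>A B M B' Z. X = A @ B @ M @ B' @ Z \<longrightarrow> 2 \<le> length B \<longrightarrow> 2 \<le> length B' \<longrightarrow>
      al (A @ m B # M) B' Z \<cdot> q A B (M @ B' @ Z) = al A B (M @ m B' # Z) \<cdot> q (A @ B @ M) B' Z) \<and>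
    (\<forall>A P Q R Z. X = A @ P @ Q @ R @ Z \<longrightarrow> 2 \<le> length Q \<longrightarrow> length (P @ Q @ R) < length X \<longrightarrow>
      whisker A (al P Q R) Z \<cdot> q A (P @ Q @ R) Z = al A (P @ m Q # R) Z \<cdot> q (A @ P) Q (R @ Z))"

definition mediates :: "'o list \<Rightarrow> 'o \<Rightarrow> ('o list \<Rightarrow> 'o list \<Rightarrow> 'o list \<Rightarrow> 'm) \<Rightarrow> 'm \<Rightarrow> bool" where
  "mediates X y q h \<longleftrightarrow> h \<in> Arr C \<and> dom C h = y \<and> cod C h = m X \<and>
    (\<forall>A B Z. X = A @ B @ Z \<longrightarrow> 2 \<le> length B \<longrightarrow> length B < length X \<longrightarrow> al A B Z \<cdot> h = q A B Z)"

definition block_limit :: "'o list \<Rightarrow> bool" where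
  "block_limit X \<longleftrightarrow> (\<forall>y q. block_cone X y q \<longrightarrow> (\<exists>!h. mediates X y q h))"

definition mediator :: "'o list \<Rightarrow> 'o \<Rightarrow> ('o list \<Rightarrow> 'o list \<Rightarrow> 'o list \<Rightarrow> 'm) \<Rightarrow> 'm" where
  "mediator X y q = (THE h. mediates X y q h)"

lemma mediator:
  assumes "block_limit X" "block_cone X y q"
  shows "mediator X y q \<in> Arr C" "dom C (mediator X y q) = y" "cod C (mediator X y q) = m X"
    "X = A @ B @ Z \<Longrightarrow> 2 \<le> length B \<Longrightarrow> length B < length X \<Longrightarrow> al A B Z \<cdot> mediator X y q = q A B Z"
proof -
  have "\<exists>!h. mediates X y q h"
    using assms by (auto simp: block_limit_def)
  then have "mediates X y q (mediator X y q)"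
    unfolding mediator_def by (rule theI')
  then show "mediator X y q \<in> Arr C" "dom C (mediator X y q) = y" "cod C (mediator X y q) = m X"
    "X = A @ B @ Z \<Longrightarrow> 2 \<le> length B \<Longrightarrow> length B < length X \<Longrightarrow> al A B Z \<cdot> mediator X y q = q A B Z"
    by (auto simp: mediates_def)
qed

text \<open>
  The structure maps out of \<open>m X\<close> are themselves a cone, hence so is everything obtained by
  precomposition. Uniqueness of mediating arrows thereby becomes joint monicity.
\<close>

lemma block_cone_precompose:
  assumes X: "X \<in> objs" "length X \<le> K" and h: "h \<in> Arr C" "cod C h = m X"
  shows "block_cone X (dom C h) (\<lambda>A B Z. al A B Z \<cdot> h)"
  unfolding block_cone_def
proof (intro conjI allI impI)
  show "dom C h \<in> Obj C"
    using h by simp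
next
  fix A B Z assume *: "X = A @ B @ Z" "2 \<le> length B" "length B < length X"
  then have t: "A \<in> objs" "B \<in> objs" "Z \<in> objs" "length A + length B + length Z \<le> K"
    "length A + length Z < L + length B"
    using X bounds by auto
  show "al A B Z \<cdot> h \<in> Arr C" "dom C (al A B Z \<cdot> h) = dom C h" "cod C (al A B Z \<cdot> h) = m (A @ m B # Z)"
    using * t h by simp_all
next
  fix A B M B' Z assume *: "X = A @ B @ M @ B' @ Z" "2 \<le> length B" "2 \<le> length B'"
  then have t: "A \<in> objs" "B \<in> objs" "M \<in> objs" "B' \<in> objs" "Z \<in> objs"
    "length A + length B + length M + length B' + length Z \<le> K"
    using X by auto
  have "al (A @ m B # M) B' Z \<cdot> al A B (M @ B' @ Z) = al A B (M @ m B' # Z) \<cdot> al (A @ B @ M) B' Z"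
    using * t bounds by (intro al_parallel) simp_all
  then have "(al (A @ m B # M) B' Z \<cdot> al A B (M @ B' @ Z)) \<cdot> h = (al A B (M @ m B' # Z) \<cdot> al (A @ B @ M) B' Z) \<cdot>
      h"
    by simp
  then show "al (A @ m B # M) B' Z \<cdot> al A B (M @ B' @ Z) \<cdot> h = al A B (M @ m B' # Z) \<cdot> al (A @ B @ M) B' Z \<cdot> h"
    using * t h bounds by (simp add: seq_assoc)
next
  fix A P Q R Z assume *: "X = A @ P @ Q @ R @ Z" "2 \<le> length Q" "length (P @ Q @ R) < length X"
  then have t: "A \<in> objs" "P \<in> objs" "Q \<in> objs" "R \<in> objs" "Z \<in> objs"
    "length A + length P + length Q + length R + length Z \<le> K"
    using X by auto
  have "whisker A (al P Q R) Z \<cdot> al A (P @ Q @ R) Z = al A (P @ m Q # R) Z \<cdot> al (A @ P) Q (R @ Z)"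
    using * t bounds by (intro al_nested_whisker) simp_all
  then have "(whisker A (al P Q R) Z \<cdot> al A (P @ Q @ R) Z) \<cdot> h = (al A (P @ m Q # R) Z \<cdot> al (A @ P) Q (R @ Z)) \<cdot>
      h"
    by simp
  then show "whisker A (al P Q R) Z \<cdot> al A (P @ Q @ R) Z \<cdot> h = al A (P @ m Q # R) Z \<cdot> al (A @ P) Q (R @ Z) \<cdot> h"
    using * t h bounds by (simp add: seq_assoc)
qed

lemma block_limit_jointly_monic:
  assumes "block_limit X" "X \<in> objs" "length X \<le> K"
    and "h \<in> Arr C" "cod C h = m X" "k \<in> Arr C" "cod C k = m X" "dom C h = dom C k"
    and "\<And>A B Z. X = A @ B @ Z \<Longrightarrow> A \<in> objs \<Longrightarrow> B \<in> objs \<Longrightarrow> Z \<in> objs \<Longrightarrow> 2 \<le> length B \<Longrightarrow>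
      length B < length X \<Longrightarrow> al A B Z \<cdot> h = al A B Z \<cdot> k"
  shows "h = k"
proof -
  let ?q = "\<lambda>A B Z. al A B Z \<cdot> k"
  have "block_cone X (dom C k) ?q"
    using assms by (intro block_cone_precompose)
  then have "\<exists>!f. mediates X (dom C k) ?q f"
    using assms(1) by (auto simp: block_limit_def)
  moreover have "mediates X (dom C k) ?q h" "mediates X (dom C k) ?q k"
    unfolding mediates_def using assms(2,4-8)
    by (intro conjI allI impI assms(9); simp)+
  ultimately show ?thesis
    by blast
qed

text \<open>
  All the data in a cone over a tuple of degree one above the known range are in the known range, so the
  universal cone is a limit of a finite system of equations.
\<close>

lemma block_limit_exists:
  assumes lims: "has_small_limits TYPE('u) C" and inf: "infinite (UNIV :: 'u set)"
    and KL: "L = K" and X: "X \<in> objs" "length X = Suc K"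
  shows "\<exists>x p. block_cone X x p \<and> (\<forall>y q. block_cone X y q \<longrightarrow> (\<exists>!h. h \<in> Arr C \<and> dom C h = y \<and> cod C h = x \<and>
      (\<forall>A B Z. X = A @ B @ Z \<longrightarrow> 2 \<le> length B \<longrightarrow> length B < length X \<longrightarrow> p A B Z \<cdot> h = q A B Z)))"
proof -
  define Ix where "Ix = {(A, B, Z). X = A @ B @ Z \<and> 2 \<le> length B \<and> length B < length X}"
  define a where "a = (\<lambda>(A, B, Z). m (A @ m B # Z))"
  define par where "par = (\<lambda>(A, B, M, B', Z).
    ((A, B, M @ B' @ Z), al (A @ m B # M) B' Z, (A @ B @ M, B', Z), al A B (M @ m B' # Z)))"
  define nest where "nest = (\<lambda>(A, P, Q, R, Z).
    ((A, P @ Q @ R, Z), whisker A (al P Q R) Z, (A @ P, Q, R @ Z), al A (P @ m Q # R) Z))"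
  define Rel where "Rel =
    par ` {(A, B, M, B', Z). X = A @ B @ M @ B' @ Z \<and> 2 \<le> length B \<and> 2 \<le> length B'} \<union>
    nest ` {(A, P, Q, R, Z). X = A @ P @ Q @ R @ Z \<and> 2 \<le> length Q \<and> length (P @ Q @ R) < length X}"
  have fin: "finite Ix" "finite Rel"
    unfolding Ix_def Rel_def
    by (auto intro!: finite_imageI intro: finite_subset[OF _ finite_append3_eq[of X]] finite_subset[OF _
        finite_append5_eq[of X]])
  have a: "a i \<in> Obj C" if i: "i \<in> Ix" for i
  proof -
    obtain A B Z where *: "i = (A, B, Z)" "X = A @ B @ Z" "2 \<le> length B" "length B < length X"
      using i unfolding Ix_def by blast
    have o: "A \<in> objs" "B \<in> objs" "Z \<in> objs" and len: "length A + length B + length Z = Suc K"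
      using *(2) X by auto
    have "length B \<le> K"
      using *(4) X(2) by simp
    with o len show ?thesis
      using *(1,3) by (simp add: a_def)
  qed
  have rel: "i \<in> Ix \<and> j \<in> Ix \<and> f \<in> Arr C \<and> g \<in> Arr C \<and> dom C f = a i \<and> dom C g = a j \<and> cod C f = cod C g"
    if "(i, f, j, g) \<in> Rel" for i f j g
    using that[unfolded Rel_def]
  proof
    assume "(i, f, j, g) \<in> par ` {(A, B, M, B', Z). X = A @ B @ M @ B' @ Z \<and> 2 \<le> length B \<and> 2 \<le> length B'}"
    then obtain A B M B' Z where *: "X = A @ B @ M @ B' @ Z" "2 \<le> length B" "2 \<le> length B'"
      and [simp]: "i = (A, B, M @ B' @ Z)" "f = al (A @ m B # M) B' Z" "j = (A @ B @ M, B', Z)" "g =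
          al A B (M @ m B' # Z)"
      by (auto simp: par_def)
    have o: "A \<in> objs" "B \<in> objs" "M \<in> objs" "B' \<in> objs" "Z \<in> objs"
      and len: "length A + length B + length M + length B' + length Z = Suc K"
      using X * by auto
    have "length B < length X" "length B' < length X"
      using *(2,3) len X(2) by linarith+
    then have "i \<in> Ix" "j \<in> Ix"
      unfolding Ix_def using *(1-3) by simp_all
    then show ?thesis
      using o len *(2,3) KL by (simp add: a_def)
  next
    assume "(i, f, j, g) \<in> nest ` {(A, P, Q, R, Z). X = A @ P @ Q @ R @ Z \<and> 2 \<le> length Q \<and>
        length (P @ Q @ R) < length X}"
    then obtain A P Q R Z where *: "X = A @ P @ Q @ R @ Z" "2 \<le> length Q" "length (P @ Q @ R) < length X"
      and [simp]: "i = (A, P @ Q @ R, Z)" "f = whisker A (al P Q R) Z" "j = (A @ P, Q, R @ Z)" "g =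
          al A (P @ m Q # R) Z"
      by (auto simp: nest_def)
    have o: "A \<in> objs" "P \<in> objs" "Q \<in> objs" "R \<in> objs" "Z \<in> objs"
      and len: "length A + length P + length Q + length R + length Z = Suc K"
      using X *(1) by auto
    have len2: "length P + length Q + length R \<le> K"
      using *(3) X(2) by simp
    have "length (P @ Q @ R) < length X" "length Q < length X" "2 \<le> length (P @ Q @ R)"
      using *(2,3) len2 X(2) by simp_all
    then have "i \<in> Ix" "j \<in> Ix"
      unfolding Ix_def using *(1,2) by auto
    then show ?thesis
      using o len len2 *(2) KL by (simp add: a_def)
  qed
  have Ix_all: "(\<forall>i \<in> Ix. Pr i) \<longleftrightarrow>
      (\<forall>A B Z. X = A @ B @ Z \<longrightarrow> 2 \<le> length B \<longrightarrow> length B < length X \<longrightarrow> Pr (A, B, Z))" for Pr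
    unfolding Ix_def by blast
  have Rel_all: "(\<forall>(i, f, j, g) \<in> Rel. Pr i f j g) \<longleftrightarrow>
      (\<forall>A B M B' Z. X = A @ B @ M @ B' @ Z \<longrightarrow> 2 \<le> length B \<longrightarrow> 2 \<le> length B' \<longrightarrow>
        Pr (A, B, M @ B' @ Z) (al (A @ m B # M) B' Z) (A @ B @ M, B', Z) (al A B (M @ m B' # Z))) \<and>
      (\<forall>A P Q R Z. X = A @ P @ Q @ R @ Z \<longrightarrow> 2 \<le> length Q \<longrightarrow> length (P @ Q @ R) < length X \<longrightarrow>
        Pr (A, P @ Q @ R, Z) (whisker A (al P Q R) Z) (A @ P, Q, R @ Z) (al A (P @ m Q # R) Z))" for Pr
    by (simp only: Rel_def ball_Un ball_simps(8,9) split_paired_All par_def nest_def prod.case imp_conjL)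
  have cone_iff: "block_cone X y q \<longleftrightarrow> y \<in> Obj C \<and>
      (\<forall>i \<in> Ix. (case i of (A, B, Z) \<Rightarrow> q A B Z) \<in> Arr C \<and> dom C (case i of (A, B, Z) \<Rightarrow> q A B Z) = y \<and>
        cod C (case i of (A, B, Z) \<Rightarrow> q A B Z) = a i) \<and>
      (\<forall>(i, f, j, g) \<in> Rel. f \<cdot> (case i of (A, B, Z) \<Rightarrow> q A B Z) = g \<cdot> (case j of (A, B, Z) \<Rightarrow> q A B Z))" for y q
    unfolding block_cone_def Ix_all Rel_all a_def by simp
  obtain x p where x: "x \<in> Obj C" and p: "\<forall>i \<in> Ix. p i \<in> Arr C \<and> dom C (p i) = x \<and> cod C (p i) = a i"
    and pr: "\<forall>(i, f, j, g) \<in> Rel. f \<cdot> p i = g \<cdot> p j"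
    and univ: "\<forall>y q. y \<in> Obj C \<and> (\<forall>i \<in> Ix. q i \<in> Arr C \<and> dom C (q i) = y \<and> cod C (q i) = a i) \<and>
      (\<forall>(i, f, j, g) \<in> Rel. f \<cdot> q i = g \<cdot> q j) \<longrightarrow>
      (\<exists>!h. h \<in> Arr C \<and> dom C h = y \<and> cod C h = x \<and> (\<forall>i \<in> Ix. p i \<cdot> h = q i))"
    by atomize_elim (rule joint_limit[OF lims inf fin, of a], fact a, fact rel)
  have [simp]: "(case i of (A, B, Z) \<Rightarrow> p (A, B, Z)) = p i" for i
    by (cases i) simp
  show ?thesis
  proof (intro exI[of _ x] exI[of _ "\<lambda>A B Z. p (A, B, Z)"] conjI allI impI)
    show "block_cone X x (\<lambda>A B Z. p (A, B, Z))"
      unfolding cone_iff using x p pr by simp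
    fix y q assume "block_cone X y q"
    then have "\<exists>!h. h \<in> Arr C \<and> dom C h = y \<and> cod C h = x \<and> (\<forall>i \<in> Ix. p i \<cdot> h =
        (case i of (A, B, Z) \<Rightarrow> q A B Z))"
      unfolding cone_iff by (intro univ[rule_format])
    then show "\<exists>!h. h \<in> Arr C \<and> dom C h = y \<and> cod C h = x \<and>
      (\<forall>A B Z. X = A @ B @ Z \<longrightarrow> 2 \<le> length B \<longrightarrow> length B < length X \<longrightarrow> p (A, B, Z) \<cdot> h = q A B Z)"
      unfolding Ix_all by simp
  qed
qed

end

section \<open>A new multiplication as a limit\<close>

text \<open>
  A choice of universal cones over all tuples of degree \<open>N + 1\<close>. The multiplication of these tuples is
  their vertex, and the projections are the structure maps for proper blocks.
\<close>

locale limit_step = oplax_blocks C N N m ma al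
  for C :: "('o, 'm) cat" and N m ma al +
  fixes lim :: "'o list \<Rightarrow> 'o"
    and pr :: "'o list \<Rightarrow> 'o list \<Rightarrow> 'o list \<Rightarrow> 'o list \<Rightarrow> 'm"
  assumes lim_cone: "X \<in> objs \<Longrightarrow> length X = Suc N \<Longrightarrow> block_cone X (lim X) (pr X)"
    and lim_universal: "X \<in> objs \<Longrightarrow> length X = Suc N \<Longrightarrow> block_cone X y q \<Longrightarrow>
      \<exists>!h. h \<in> Arr C \<and> dom C h = y \<and> cod C h = lim X \<and>
        (\<forall>A B Z. X = A @ B @ Z \<longrightarrow> 2 \<le> length B \<longrightarrow> length B < length X \<longrightarrow> pr X A B Z \<cdot> h = q A B Z)"
begin

definition proj :: "'o list \<Rightarrow> 'o list \<Rightarrow> 'o list \<Rightarrow> 'm" where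
  "proj A B Z = pr (A @ B @ Z) A B Z"

lemma lim_Obj [simp]: "X \<in> objs \<Longrightarrow> length X = Suc N \<Longrightarrow> lim X \<in> Obj C"
  using lim_cone[of X] by (auto simp: block_cone_def)

lemma
  assumes o: "A \<in> objs" "B \<in> objs" "Z \<in> objs" and len: "length A + length B + length Z = Suc N"
    and B: "2 \<le> length B" "length B \<le> N"
  shows proj_Arr [simp]: "proj A B Z \<in> Arr C"
    and dom_proj [simp]: "dom C (proj A B Z) = lim (A @ B @ Z)"
    and cod_proj [simp]: "cod C (proj A B Z) = m (A @ m B # Z)"
proof -
  have "length B < length (A @ B @ Z)"
    unfolding length_append using len B by linarith
  then show "proj A B Z \<in> Arr C" "dom C (proj A B Z) = lim (A @ B @ Z)" "cod C (proj A B Z) = m (A @ m B # Z)"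
    using lim_cone[of "A @ B @ Z"] o len B unfolding block_cone_def proj_def by simp_all
qed

lemma proj_parallel:
  assumes "A \<in> objs" "B \<in> objs" "M \<in> objs" "B' \<in> objs" "Z \<in> objs"
    and "length A + length B + length M + length B' + length Z = Suc N" "2 \<le> length B" "2 \<le> length B'"
  shows "al (A @ m B # M) B' Z \<cdot> proj A B (M @ B' @ Z) = al A B (M @ m B' # Z) \<cdot> proj (A @ B @ M) B' Z"
  using lim_cone[of "A @ B @ M @ B' @ Z"] assms unfolding block_cone_def proj_def by simp

lemma proj_nested:
  assumes "A \<in> objs" "P \<in> objs" "Q \<in> objs" "R \<in> objs" "Z \<in> objs"
    and "length A + length P + length Q + length R + length Z = Suc N" "2 \<le> length Q"
    and "length P + length Q + length R \<le> N"
  shows "whisker A (al P Q R) Z \<cdot> proj A (P @ Q @ R) Z = al A (P @ m Q # R) Z \<cdot> proj (A @ P) Q (R @ Z)"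
proof -
  have "length (P @ Q @ R) < length (A @ P @ Q @ R @ Z)"
    unfolding length_append using assms(6-8) by linarith
  then show ?thesis
    using lim_cone[of "A @ P @ Q @ R @ Z"] assms unfolding block_cone_def proj_def by simp
qed

text \<open>
  The counterpart of \<open>block_limit_jointly_monic\<close> at a stage where the vertex is not yet the value of
  a multiplication.
\<close>

lemma lim_monic:
  assumes X: "X \<in> objs" "length X = Suc N"
    and h: "h \<in> Arr C" "cod C h = lim X" and k: "k \<in> Arr C" "cod C k = lim X" "dom C h = dom C k"
    and eq: "\<And>A B Z. A @ B @ Z = X \<Longrightarrow> A \<in> objs \<Longrightarrow> B \<in> objs \<Longrightarrow> Z \<in> objs \<Longrightarrow>
      length A + length B + length Z = Suc N \<Longrightarrow> 2 \<le> length B \<Longrightarrow> length B \<le> N \<Longrightarrow>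
      proj A B Z \<cdot> h = proj A B Z \<cdot> k"
  shows "h = k"
proof -
  have split: "A \<in> objs \<and> B \<in> objs \<and> Z \<in> objs \<and> length A + length B + length Z = Suc N \<and> length B \<le> N"
    if "X = A @ B @ Z" "length B < length X" for A B Z
    using that(1) X that(2)[unfolded X(2)] by auto
  let ?q = "\<lambda>A B Z. proj A B Z \<cdot> k"
  have "block_cone X (dom C k) ?q"
    unfolding block_cone_def
  proof (intro conjI allI impI)
    show "dom C k \<in> Obj C"
      using k by simp
  next
    fix A B Z assume *: "X = A @ B @ Z" "2 \<le> length B" "length B < length X"
    then show "proj A B Z \<cdot> k \<in> Arr C" "dom C (proj A B Z \<cdot> k) = dom C k" "cod C (proj A B Z \<cdot> k) =
        m (A @ m B # Z)"
      using split[OF *(1,3)] k by simp_all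
  next
    fix A B M B' Z assume *: "X = A @ B @ M @ B' @ Z" "2 \<le> length B" "2 \<le> length B'"
    then have t: "A \<in> objs" "B \<in> objs" "M \<in> objs" "B' \<in> objs" "Z \<in> objs"
      "length A + length B + length M + length B' + length Z = Suc N"
      using X by auto
    have "(al (A @ m B # M) B' Z \<cdot> proj A B (M @ B' @ Z)) \<cdot> k =
        (al A B (M @ m B' # Z) \<cdot> proj (A @ B @ M) B' Z) \<cdot> k"
      using proj_parallel[OF t *(2,3)] by simp
    then show "al (A @ m B # M) B' Z \<cdot> proj A B (M @ B' @ Z) \<cdot> k =
        al A B (M @ m B' # Z) \<cdot> proj (A @ B @ M) B' Z \<cdot> k"
      using * t k by (simp add: seq_assoc)
  next
    fix A P Q R Z assume *: "X = A @ P @ Q @ R @ Z" "2 \<le> length Q" "length (P @ Q @ R) < length X"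
    then have t: "A \<in> objs" "P \<in> objs" "Q \<in> objs" "R \<in> objs" "Z \<in> objs"
      "length A + length P + length Q + length R + length Z = Suc N"
      using X by auto
    have t2: "length P + length Q + length R \<le> N"
      using *(3) X(2) by simp
    have "(whisker A (al P Q R) Z \<cdot> proj A (P @ Q @ R) Z) \<cdot> k =
        (al A (P @ m Q # R) Z \<cdot> proj (A @ P) Q (R @ Z)) \<cdot> k"
      using proj_nested[OF t *(2) t2] by simp
    then show "whisker A (al P Q R) Z \<cdot> proj A (P @ Q @ R) Z \<cdot> k =
        al A (P @ m Q # R) Z \<cdot> proj (A @ P) Q (R @ Z) \<cdot> k"
      using *(1,2) t t2 k by (simp add: seq_assoc)
  qed
  from lim_universal[OF X this]
  have ex1: "\<exists>!f. f \<in> Arr C \<and> dom C f = dom C k \<and> cod C f = lim X \<and>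
      (\<forall>A B Z. X = A @ B @ Z \<longrightarrow> 2 \<le> length B \<longrightarrow> length B < length X \<longrightarrow> pr X A B Z \<cdot> f = proj A B Z \<cdot> k)" .
  have "\<forall>A B Z. X = A @ B @ Z \<longrightarrow> 2 \<le> length B \<longrightarrow> length B < length X \<longrightarrow> pr X A B Z \<cdot> h = proj A B Z \<cdot> k"
  proof (intro allI impI)
    fix A B Z assume *: "X = A @ B @ Z" "2 \<le> length B" "length B < length X"
    then have "pr X A B Z = proj A B Z"
      by (simp add: proj_def)
    then show "pr X A B Z \<cdot> h = proj A B Z \<cdot> k"
      using eq[of A B Z] split[OF *(1,3)] * by simp
  qed
  moreover have "\<forall>A B Z. X = A @ B @ Z \<longrightarrow> 2 \<le> length B \<longrightarrow> length B < length X \<longrightarrow> pr X A B Z \<cdot> k = proj A B Z \<cdot> k"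
    by (simp add: proj_def)
  ultimately show ?thesis
    using ex1 h k by blast
qed

text \<open>
  The legs of the cone that defines the multiplication of a tuple \<open>F\<close> of arrows. They make the
  projections natural; the block of \<open>F\<close> to be multiplied is recovered from the
  lengths of the parts of its tuple of codomains.
\<close>

definition lim_arr_leg :: "'m list \<Rightarrow> 'o list \<Rightarrow> 'o list \<Rightarrow> 'o list \<Rightarrow> 'm" where
  "lim_arr_leg F A B Z =
    (let F1 = take (length A) F; G = take (length B) (drop (length A) F); H = drop (length A + length B) F
     in ma (F1 @ ma G # H) \<cdot> proj (map (dom C) F1) (map (dom C) G) (map (dom C) H))"

lemma lim_arr_leg_append: "lim_arr_leg (F1 @ G @ H) (map (cod C) F1) (map (cod C) G) (map (cod C) H) =
    ma (F1 @ ma G # H) \<cdot> proj (map (dom C) F1) (map (dom C) G) (map (dom C) H)"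
  by (simp add: lim_arr_leg_def)

lemma lim_arr_leg_cone:
  assumes F: "F \<in> arrs" "length F = Suc N"
  shows "block_cone (map (cod C) F) (lim (map (dom C) F)) (lim_arr_leg F)"
  unfolding block_cone_def
proof (intro conjI allI impI)
  let ?c = "map (cod C)" and ?d = "map (dom C)"
  show "lim (?d F) \<in> Obj C"
    using F by simp
  {
    fix A B Z assume *: "?c F = A @ B @ Z" "2 \<le> length B" "length B < length (?c F)"
    then obtain F1 G H where e: "F = F1 @ G @ H" "?c F1 = A" "?c G = B" "?c H = Z"
      by (metis map_eq_append3)
    have o: "F1 \<in> arrs" "G \<in> arrs" "H \<in> arrs" and len: "length F1 + length G + length H = Suc N"
      using F e by auto
    have G: "2 \<le> length G" "length G \<le> N"
      using *(2,3) e(3) F(2) by auto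
    show "lim_arr_leg F A B Z \<in> Arr C" "dom C (lim_arr_leg F A B Z) = lim (?d F)" "cod C (lim_arr_leg F A B Z) =
        m (A @ m B # Z)"
      using o len G e lim_arr_leg_append[of F1 G H] by simp_all
  }
  {
    fix A B M B' Z assume *: "?c F = A @ B @ M @ B' @ Z" "2 \<le> length B" "2 \<le> length B'"
    obtain F1 G F' where e1: "F = F1 @ G @ F'" "?c F1 = A" "?c G = B" "?c F' = M @ B' @ Z"
      using map_eq_append3[OF *(1)] by metis
    obtain FM G' H where e2: "F' = FM @ G' @ H" "?c FM = M" "?c G' = B'" "?c H = Z"
      using map_eq_append3[OF e1(4)] by metis
    note e = e1(1-3) e2
    have o: "F1 \<in> arrs" "G \<in> arrs" "FM \<in> arrs" "G' \<in> arrs" "H \<in> arrs"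
      and len: "length F1 + length G + length FM + length G' + length H = Suc N"
      and G: "2 \<le> length G" "2 \<le> length G'"
      using F e * by auto
    have s1: "al (?c F1 @ m (?c G) # ?c FM) (?c G') (?c H) \<cdot> ma (F1 @ ma G # FM @ G' @ H) =
        ma (F1 @ ma G # FM @ ma G' # H) \<cdot> al (?d F1 @ m (?d G) # ?d FM) (?d G') (?d H)"
      using al_natural[of "F1 @ ma G # FM" G' H] o len G by simp
    have s2: "al (?c F1) (?c G) (?c FM @ m (?c G') # ?c H) \<cdot> ma (F1 @ G @ FM @ ma G' # H) =
        ma (F1 @ ma G # FM @ ma G' # H) \<cdot> al (?d F1) (?d G) (?d FM @ m (?d G') # ?d H)"
      using al_natural[of F1 G "FM @ ma G' # H"] o len G by simp
    have s3: "al (?d F1 @ m (?d G) # ?d FM) (?d G') (?d H) \<cdot> proj (?d F1) (?d G) (?d FM @ ?d G' @ ?d H) =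
        al (?d F1) (?d G) (?d FM @ m (?d G') # ?d H) \<cdot> proj (?d F1 @ ?d G @ ?d FM) (?d G') (?d H)"
      using proj_parallel[of "?d F1" "?d G" "?d FM" "?d G'" "?d H"] o len G by simp
    have "al (?c F1 @ m (?c G) # ?c FM) (?c G') (?c H) \<cdot> ma (F1 @ ma G # FM @ G' @ H) \<cdot>
        proj (?d F1) (?d G) (?d FM @ ?d G' @ ?d H) =
      al (?c F1) (?c G) (?c FM @ m (?c G') # ?c H) \<cdot> ma (F1 @ G @ FM @ ma G' # H) \<cdot> proj (?d F1 @ ?d G @ ?d FM)
          (?d G') (?d H)"
      by (rule cube[OF s1 s2 s3]) (use o len G in simp_all)
    then show "al (A @ m B # M) B' Z \<cdot> lim_arr_leg F A B (M @ B' @ Z) =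
        al A B (M @ m B' # Z) \<cdot> lim_arr_leg F (A @ B @ M) B' Z"
      using lim_arr_leg_append[of F1 G "FM @ G' @ H"] lim_arr_leg_append[of "F1 @ G @ FM" G' H] e by simp
  }
  {
    fix A P Q R Z assume *: "?c F = A @ P @ Q @ R @ Z" "2 \<le> length Q" "length (P @ Q @ R) < length (?c F)"
    obtain F1 FP F' where e1: "F = F1 @ FP @ F'" "?c F1 = A" "?c FP = P" "?c F' = Q @ R @ Z"
      using map_eq_append3[OF *(1)] by metis
    obtain FQ FR H where e2: "F' = FQ @ FR @ H" "?c FQ = Q" "?c FR = R" "?c H = Z"
      using map_eq_append3[OF e1(4)] by metis
    note e = e1(1-3) e2
    have o: "F1 \<in> arrs" "FP \<in> arrs" "FQ \<in> arrs" "FR \<in> arrs" "H \<in> arrs"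
      and len: "length F1 + length FP + length FQ + length FR + length H = Suc N"
      and Q: "2 \<le> length FQ"
      using F e *(1,2) by auto
    have "length P + length Q + length R \<le> N"
      using *(3) F(2) by simp
    then have len2: "length FP + length FQ + length FR \<le> N"
      by (simp flip: e(3) e2(2,3))
    have s0: "al (?c FP) (?c FQ) (?c FR) \<cdot> ma (FP @ FQ @ FR) =
        ma (FP @ ma FQ # FR) \<cdot> al (?d FP) (?d FQ) (?d FR)"
      using al_natural[of FP FQ FR] o len2 Q by simp
    have s1: "whisker (?c F1) (al (?c FP) (?c FQ) (?c FR)) (?c H) \<cdot> ma (F1 @ ma (FP @ FQ @ FR) # H) =
        ma (F1 @ ma (FP @ ma FQ # FR) # H) \<cdot> whisker (?d F1) (al (?d FP) (?d FQ) (?d FR)) (?d H)"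
      using ma_whisker(1)[of F1 H "ma (FP @ FQ @ FR)" "al (?c FP) (?c FQ) (?c FR)"]
        ma_whisker(2)[of F1 H "al (?d FP) (?d FQ) (?d FR)" "ma (FP @ ma FQ # FR)"] s0 o len len2 Q by simp
    have s2: "al (?c F1) (?c FP @ m (?c FQ) # ?c FR) (?c H) \<cdot> ma (F1 @ FP @ ma FQ # FR @ H) =
        ma (F1 @ ma (FP @ ma FQ # FR) # H) \<cdot> al (?d F1) (?d FP @ m (?d FQ) # ?d FR) (?d H)"
      using al_natural[of F1 "FP @ ma FQ # FR" H] o len len2 Q by simp
    have s3: "whisker (?d F1) (al (?d FP) (?d FQ) (?d FR)) (?d H) \<cdot> proj (?d F1) (?d FP @ ?d FQ @ ?d FR) (?d H)
        =
        al (?d F1) (?d FP @ m (?d FQ) # ?d FR) (?d H) \<cdot> proj (?d F1 @ ?d FP) (?d FQ) (?d FR @ ?d H)"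
      using proj_nested[of "?d F1" "?d FP" "?d FQ" "?d FR" "?d H"] o len len2 Q by simp
    have "whisker (?c F1) (al (?c FP) (?c FQ) (?c FR)) (?c H) \<cdot> ma (F1 @ ma (FP @ FQ @ FR) # H) \<cdot>
        proj (?d F1) (?d FP @ ?d FQ @ ?d FR) (?d H) =
      al (?c F1) (?c FP @ m (?c FQ) # ?c FR) (?c H) \<cdot> ma (F1 @ FP @ ma FQ # FR @ H) \<cdot>
          proj (?d F1 @ ?d FP) (?d FQ) (?d FR @ ?d H)"
      by (rule cube[OF s1 s2 s3]) (use o len len2 Q in simp_all)
    then show "whisker A (al P Q R) Z \<cdot> lim_arr_leg F A (P @ Q @ R) Z =
        al A (P @ m Q # R) Z \<cdot> lim_arr_leg F (A @ P) Q (R @ Z)"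
      using lim_arr_leg_append[of F1 "FP @ FQ @ FR" H] lim_arr_leg_append[of "F1 @ FP" FQ "FR @ H"] e by simp
  }
qed

definition lim_arr :: "'m list \<Rightarrow> 'm" where
  "lim_arr F = (THE h. h \<in> Arr C \<and> dom C h = lim (map (dom C) F) \<and> cod C h = lim (map (cod C) F) \<and>
    (\<forall>A B Z. map (cod C) F = A @ B @ Z \<longrightarrow> 2 \<le> length B \<longrightarrow> length B < length (map (cod C) F) \<longrightarrow>
      pr (map (cod C) F) A B Z \<cdot> h = lim_arr_leg F A B Z))"

lemma lim_arr_spec:
  assumes F: "F \<in> arrs" "length F = Suc N"
  shows "lim_arr F \<in> Arr C \<and> dom C (lim_arr F) = lim (map (dom C) F) \<and> cod C (lim_arr F) = lim (map (cod C) F) \<and>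
    (\<forall>A B Z. map (cod C) F = A @ B @ Z \<longrightarrow> 2 \<le> length B \<longrightarrow> length B < length (map (cod C) F) \<longrightarrow>
      pr (map (cod C) F) A B Z \<cdot> lim_arr F = lim_arr_leg F A B Z)"
  unfolding lim_arr_def by (rule theI', rule lim_universal) (use F in \<open>simp_all add: lim_arr_leg_cone\<close>)

lemma
  assumes "F \<in> arrs" "length F = Suc N"
  shows lim_arr_Arr [simp]: "lim_arr F \<in> Arr C"
    and dom_lim_arr [simp]: "dom C (lim_arr F) = lim (map (dom C) F)"
    and cod_lim_arr [simp]: "cod C (lim_arr F) = lim (map (cod C) F)"
  using lim_arr_spec[OF assms] by auto

lemma proj_lim_arr:
  assumes "F \<in> arrs" "G \<in> arrs" "H \<in> arrs" "length F + length G + length H = Suc N"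
    "2 \<le> length G" "length G \<le> N"
  shows "proj (map (cod C) F) (map (cod C) G) (map (cod C) H) \<cdot> lim_arr (F @ G @ H) =
    ma (F @ ma G # H) \<cdot> proj (map (dom C) F) (map (dom C) G) (map (dom C) H)"
proof -
  have "length (map (cod C) G) < length (map (cod C) (F @ G @ H))"
    unfolding length_map length_append using assms(4,6) by linarith
  then have "pr (map (cod C) (F @ G @ H)) (map (cod C) F) (map (cod C) G) (map (cod C) H) \<cdot>
      lim_arr (F @ G @ H) =
      lim_arr_leg (F @ G @ H) (map (cod C) F) (map (cod C) G) (map (cod C) H)"
    using lim_arr_spec[of "F @ G @ H"] assms by simp
  then show ?thesis
    by (simp add: proj_def lim_arr_leg_append)
qed

lemma lim_arr_ident:
  assumes X: "X \<in> objs" "length X = Suc N"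
  shows "lim_arr (map (ident C) X) = ident C (lim X)"
proof (rule lim_monic[OF X])
  fix A B Z assume *: "A @ B @ Z = X" "A \<in> objs" "B \<in> objs" "Z \<in> objs"
    "length A + length B + length Z = Suc N" "2 \<le> length B" "length B \<le> N"
  have "proj A B Z \<cdot> lim_arr (map (ident C) (A @ B @ Z)) =
      ma (map (ident C) A @ ma (map (ident C) B) # map (ident C) Z) \<cdot> proj A B Z"
    using proj_lim_arr[of "map (ident C) A" "map (ident C) B" "map (ident C) Z"] *(2-) by simp
  also have "\<dots> = proj A B Z"
    using *(2-) ma_ident[of "A @ m B # Z"] by (simp add: ma_ident)
  finally show "proj A B Z \<cdot> lim_arr (map (ident C) X) = proj A B Z \<cdot> ident C (lim X)"
    using * by simp
qed (use X in simp_all)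

text \<open>
  Both sides have the same composites with the projections, because the multiplication is functorial on
  tuples of smaller degree.
\<close>

lemma lim_arr_comp:
  assumes FG: "F \<in> arrs" "G \<in> arrs" "map (cod C) F = map (dom C) G" and len: "length F = Suc N"
  shows "lim_arr (map2 (comp C) G F) = lim_arr G \<cdot> lim_arr F"
proof (rule lim_monic[of "map (cod C) G"])
  let ?c = "map (cod C)" and ?d = "map (dom C)"
  have lenG: "length G = Suc N"
    using FG(3) len by (metis length_map)
  note t = map2_comp_typing[OF FG]
  show "?c G \<in> objs" "length (?c G) = Suc N" "lim_arr G \<cdot> lim_arr F \<in> Arr C" "cod C (lim_arr G \<cdot> lim_arr F) =
      lim (?c G)"
    "lim_arr (map2 (comp C) G F) \<in> Arr C" "cod C (lim_arr (map2 (comp C) G F)) = lim (?c G)"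
    "dom C (lim_arr (map2 (comp C) G F)) = dom C (lim_arr G \<cdot> lim_arr F)"
    using FG t len lenG by (simp_all del: map_map)
  fix A B Z
  assume *: "A @ B @ Z = ?c G" "2 \<le> length B" "length B \<le> N"
  obtain G1 G2 G3 where G: "G = G1 @ G2 @ G3" "?c G1 = A" "?c G2 = B" "?c G3 = Z"
    using map_eq_append3[OF *(1)[symmetric]] by metis
  have "?c F = ?d G1 @ ?d G2 @ ?d G3"
    using FG(3) G(1) by simp
  then obtain F1 F2 F3 where F: "F = F1 @ F2 @ F3" "?c F1 = ?d G1" "?c F2 = ?d G2" "?c F3 = ?d G3"
    using map_eq_append3 by metis
  have o: "F1 \<in> arrs" "F2 \<in> arrs" "F3 \<in> arrs" "G1 \<in> arrs" "G2 \<in> arrs" "G3 \<in> arrs"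
    using FG F(1) G(1) by auto
  have l: "length F1 = length G1" "length F2 = length G2" "length F3 = length G3"
    using F(2-4) by (metis length_map)+
  have len': "length G1 + length G2 + length G3 = Suc N" "2 \<le> length G2" "length G2 \<le> N"
    using lenG * G by auto
  have zips: "map2 (comp C) G F = map2 (comp C) G1 F1 @ map2 (comp C) G2 F2 @ map2 (comp C) G3 F3"
    using l F(1) G(1) by simp
  note t1 = map2_comp_typing[OF o(1,4) F(2)] and t2 = map2_comp_typing[OF o(2,5) F(3)]
    and t3 = map2_comp_typing[OF o(3,6) F(4)]
  have "proj A B Z \<cdot> lim_arr (map2 (comp C) G F) =
      ma (map2 (comp C) G1 F1 @ ma (map2 (comp C) G2 F2) # map2 (comp C) G3 F3) \<cdot> proj (?d F1) (?d F2) (?d F3)"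
    using proj_lim_arr[of "map2 (comp C) G1 F1" "map2 (comp C) G2 F2" "map2 (comp C) G3 F3"] t1 t2 t3 len' l
        G(2-4)
    unfolding zips by (simp del: map_map)
  also have "ma (map2 (comp C) G1 F1 @ ma (map2 (comp C) G2 F2) # map2 (comp C) G3 F3) =
      ma (map2 (comp C) (G1 @ ma G2 # G3) (F1 @ ma F2 # F3))"
    using ma_comp[OF o(2,5) F(3)] l len' by simp
  also have "\<dots> = ma (G1 @ ma G2 # G3) \<cdot> ma (F1 @ ma F2 # F3)"
    using o l len' F(2-4) by (intro ma_comp) simp_all
  also have "\<dots> \<cdot> proj (?d F1) (?d F2) (?d F3) = ma (G1 @ ma G2 # G3) \<cdot> ma (F1 @ ma F2 # F3) \<cdot>
      proj (?d F1) (?d F2) (?d F3)"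
    using o l len' F(2-4) by (simp add: seq_assoc)
  also have "\<dots> = ma (G1 @ ma G2 # G3) \<cdot> proj (?c F1) (?c F2) (?c F3) \<cdot> lim_arr F"
    using proj_lim_arr[of F1 F2 F3] o l len' F(1) by simp
  also have "\<dots> = (ma (G1 @ ma G2 # G3) \<cdot> proj (?d G1) (?d G2) (?d G3)) \<cdot> lim_arr F"
    using o l len' F len by (simp add: seq_assoc)
  also have "\<dots> = (proj A B Z \<cdot> lim_arr G) \<cdot> lim_arr F"
    using proj_lim_arr[of G1 G2 G3] o len' G by simp
  also have "\<dots> = proj A B Z \<cdot> lim_arr G \<cdot> lim_arr F"
  proof -
    have "proj A B Z \<in> Arr C" "dom C (proj A B Z) = lim (?c G)"
      unfolding G(2-4)[symmetric] G(1) using o len' by simp_all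
    then show ?thesis
      using FG len lenG by (simp add: seq_assoc)
  qed
  finally show "proj A B Z \<cdot> lim_arr (map2 (comp C) G F) = proj A B Z \<cdot> lim_arr G \<cdot> lim_arr F" .
qed

definition m' :: "'o list \<Rightarrow> 'o" where
  "m' X = (if length X \<le> N then m X else lim X)"

definition ma' :: "'m list \<Rightarrow> 'm" where
  "ma' F = (if length F \<le> N then ma F else lim_arr F)"

definition al' :: "'o list \<Rightarrow> 'o list \<Rightarrow> 'o list \<Rightarrow> 'm" where
  "al' A B Z = (if length A + length B + length Z \<le> N then al A B Z
     else if length B = 1 \<or> A = [] \<and> Z = [] then ident C (lim (A @ B @ Z)) else proj A B Z)"

lemma m'_low [simp]: "length X \<le> N \<Longrightarrow> m' X = m X"
  and m'_top [simp]: "length X = Suc N \<Longrightarrow> m' X = lim X"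
  and ma'_low [simp]: "length F \<le> N \<Longrightarrow> ma' F = ma F"
  and ma'_top [simp]: "length F = Suc N \<Longrightarrow> ma' F = lim_arr F"
  and al'_low [simp]: "length A + length B + length Z \<le> N \<Longrightarrow> al' A B Z = al A B Z"
  by (simp_all add: m'_def ma'_def al'_def)

lemma al'_top [simp]:
  assumes "length A + length B + length Z = Suc N" "2 \<le> length B" "length B \<le> N"
  shows "al' A B Z = proj A B Z"
  using assms by (auto simp: al'_def)

lemma m'_Obj [simp]: "X \<in> objs \<Longrightarrow> length X \<le> Suc N \<Longrightarrow> m' X \<in> Obj C"
  by (cases "length X = Suc N") auto

lemma ma'_in_hom:
  "F \<in> arrs \<Longrightarrow> length F \<le> Suc N \<Longrightarrow> ma' F \<in> hom C (m' (map (dom C) F)) (m' (map (cod C) F))"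
  by (cases "length F = Suc N") (auto simp: hom_def)

lemma ma'_ident: "X \<in> objs \<Longrightarrow> length X \<le> Suc N \<Longrightarrow> ma' (map (ident C) X) = ident C (m' X)"
  by (cases "length X = Suc N") (auto simp: ma_ident lim_arr_ident)

lemma ma'_comp:
  assumes "F \<in> arrs" "G \<in> arrs" "map (cod C) F = map (dom C) G" "length F \<le> Suc N"
  shows "ma' (map2 (comp C) G F) = ma' G \<cdot> ma' F"
proof -
  have "length F = length G"
    using assms(3) by (metis length_map)
  then show ?thesis
    using assms by (cases "length F = Suc N") (auto simp: ma_comp lim_arr_comp)
qed

lemma m'_single [simp]: "x \<in> Obj C \<Longrightarrow> m' [x] = x"
  and ma'_single [simp]: "f \<in> Arr C \<Longrightarrow> ma' [f] = f"
  using bounds by (simp_all add: m'_def ma'_def)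

lemma al'_single:
  "A \<in> objs \<Longrightarrow> x \<in> Obj C \<Longrightarrow> Z \<in> objs \<Longrightarrow> length A + length Z \<le> N \<Longrightarrow>
    al' A [x] Z = ident C (m' (A @ x # Z))"
  by (cases "length A + length Z = N") (auto simp: al'_def al_single)

lemma al'_whole: "B \<in> objs \<Longrightarrow> length B \<le> Suc N \<Longrightarrow> al' [] B [] = ident C (m' B)"
  using bounds by (cases "length B = Suc N") (auto simp: al'_def al_whole)

text \<open>
  In the new degree, a structure map is an identity (for a block that is a single entry or the whole
  tuple) or a projection.
\<close>

lemma top_block_cases:
  assumes "length A + length B + length Z \<le> Suc N" "length A + length Z < N + length B"
  obtains (low) "length A + length B + length Z \<le> N" "length A + length Z < N"
    | (single) x where "B = [x]" "length A + length Z = N"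
    | (whole) "A = []" "Z = []" "length B = Suc N"
    | (proper) "length A + length B + length Z = Suc N" "2 \<le> length B" "length B \<le> N"
proof -
  consider "length A + length B + length Z \<le> N" | "length A + length B + length Z = Suc N"
    using assms(1) by linarith
  then show ?thesis
  proof cases
    case 1
    then have "length A + length Z < N"
      using assms(2) by linarith
    with 1 show ?thesis
      by (rule low)
  next
    case 2
    then have "length B \<noteq> 0"
      using assms(2) by linarith
    then consider "length B = 1" | "length B = Suc N" | "2 \<le> length B" "length B \<le> N"
      using 2 by linarith
    then show ?thesis
    proof cases
      case 1
      then show ?thesis
        using single 2 by (auto simp: length_Suc_conv)
    next
      case b: 2
      then show ?thesis
        using whole 2 by simp
    next
      case 3
      then show ?thesis
        using proper 2 by simp
    qed
  qed
qed

lemma al'_in_hom: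
  assumes o: "A \<in> objs" "B \<in> objs" "Z \<in> objs"
    and len: "length A + length B + length Z \<le> Suc N" "length A + length Z < N + length B"
  shows "al' A B Z \<in> hom C (m' (A @ B @ Z)) (m' (A @ m' B # Z))"
  using len
proof (cases rule: top_block_cases)
  case low
  then show ?thesis
    using o by (simp add: hom_def)
next
  case (single x)
  then show ?thesis
    using o by (simp add: hom_def al'_single)
next
  case whole
  then show ?thesis
    using o by (simp add: hom_def al'_whole)
next
  case proper
  then have "Suc (length A + length Z) \<le> N"
    by linarith
  then show ?thesis
    using o proper by (simp add: hom_def)
qed

lemma
  assumes "A \<in> objs" "B \<in> objs" "Z \<in> objs"
    "length A + length B + length Z \<le> Suc N" "length A + length Z < N + length B"
  shows al'_Arr: "al' A B Z \<in> Arr C"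
    and dom_al': "dom C (al' A B Z) = m' (A @ B @ Z)"
    and cod_al': "cod C (al' A B Z) = m' (A @ m' B # Z)"
  using al'_in_hom[OF assms] by (auto simp: hom_def)

lemma al'_natural:
  assumes o: "F \<in> arrs" "G \<in> arrs" "H \<in> arrs"
    and len: "length F + length G + length H \<le> Suc N" "length F + length H < N + length G"
  shows "al' (map (cod C) F) (map (cod C) G) (map (cod C) H) \<cdot> ma' (F @ G @ H) =
    ma' (F @ ma' G # H) \<cdot> al' (map (dom C) F) (map (dom C) G) (map (dom C) H)"
  using len
proof (cases rule: top_block_cases)
  case low
  then show ?thesis
    using o al_natural[of F G H] by simp
next
  case (single f)
  then show ?thesis
    using o by (simp add: al'_single)
next
  case whole
  then show ?thesis
    using o by (simp add: al'_whole)
next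
  case proper
  then have "Suc (length F + length H) \<le> N"
    by linarith
  then show ?thesis
    using o proper proj_lim_arr[of F G H] by simp
qed

lemma al'_parallel:
  assumes o: "A \<in> objs" "B \<in> objs" "M \<in> objs" "B' \<in> objs" "Z \<in> objs"
    and len: "length A + length B + length M + length B' + length Z \<le> Suc N"
      "length A + length M + length B' + length Z < N + length B"
      "length A + length B + length M + length Z < N + length B'"
      "Suc (length A + length M + length Z) < N + length B"
      "Suc (length A + length M + length Z) < N + length B'"
  shows "al' (A @ m' B # M) B' Z \<cdot> al' A B (M @ B' @ Z) = al' A B (M @ m' B' # Z) \<cdot> al' (A @ B @ M) B' Z"
proof -
  consider (low) "length A + length B + length M + length B' + length Z \<le> N"
    | (top) "length A + length B + length M + length B' + length Z = Suc N"
    using len(1) by linarith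
  then show ?thesis
  proof cases
    case low
    have "length B \<le> N" "length B' \<le> N"
      "length A + 1 + length M + length B' + length Z \<le> N" "length A + length B + length M + 1 + length Z \<le> N"
      using low len by linarith+
    then show ?thesis
      using low o len al_parallel[of A B M B' Z] by simp
  next
    case top
    then have "length B \<noteq> 0" "length B' \<noteq> 0"
      using len(2,3) by linarith+
    then consider b where "B = [b]" | b' where "B' = [b']" | "2 \<le> length B" "2 \<le> length B'"
      by (cases B; cases B'; cases "tl B"; cases "tl B'") auto
    then show ?thesis
    proof cases
      case (1 b)
      have typing: "A @ b # M \<in> objs" "B' \<in> objs" "Z \<in> objs"
          "length (A @ b # M) + length B' + length Z \<le> Suc N"
        using 1 o top by simp_all
      have "length (A @ b # M) + length Z < N + length B'"
        using len(5) by simp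
      note t = al'_Arr[OF typing this] dom_al'[OF typing this] cod_al'[OF typing this]
      have "length B' \<le> N" "length A + length M + Suc (length Z) \<le> N"
          "length A + length M + length B' + length Z = N"
        using arg_cong[OF 1, of length, simplified] top \<open>length B' \<noteq> 0\<close> by linarith+
      then show ?thesis
        using 1 o t by (simp add: al'_single)
    next
      case (2 b')
      have typing: "A \<in> objs" "B \<in> objs" "M @ b' # Z \<in> objs"
          "length A + length B + length (M @ b' # Z) \<le> Suc N"
        using 2 o top by simp_all
      have "length A + length (M @ b' # Z) < N + length B"
        using len(4) by simp
      note t = al'_Arr[OF typing this] dom_al'[OF typing this] cod_al'[OF typing this]
      have "length B \<le> N" "Suc (length A + length M + length Z) \<le> N"
          "length A + length B + length M + length Z = N"
        using arg_cong[OF 2, of length, simplified] top \<open>length B \<noteq> 0\<close> by linarith+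
      then show ?thesis
        using 2 o t by (simp add: al'_single)
    next
      case 3
      have "length B \<le> N" "length B' \<le> N"
        "Suc (length A + length M + length B' + length Z) \<le> N"
            "Suc (length A + length B + length M + length Z) \<le> N"
        using 3 top by linarith+
      then show ?thesis
        using 3 top o proj_parallel[of A B M B' Z] by simp
    qed
  qed
qed

lemma al'_nested:
  assumes o: "A \<in> objs" "P \<in> objs" "Q \<in> objs" "R \<in> objs" "Z \<in> objs"
    and len: "length A + length P + length Q + length R + length Z \<le> Suc N"
      "length A + length P + length R + length Z < N + length Q"
  shows "ma' (map (ident C) A @ al' P Q R # map (ident C) Z) \<cdot> al' A (P @ Q @ R) Z =
    al' A (P @ m' Q # R) Z \<cdot> al' (A @ P) Q (R @ Z)"
proof -
  consider (low) "length A + length P + length Q + length R + length Z \<le> N"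
    | (top) "length A + length P + length Q + length R + length Z = Suc N"
    using len(1) by linarith
  then show ?thesis
  proof cases
    case low
    have "length Q \<le> N" "length A + length P + length R + length Z < N"
      using low len by linarith+
    then show ?thesis
      using low o len al_nested[of A P Q R Z] by simp
  next
    case top
    then have "length Q \<noteq> 0"
      using len(2) by linarith
    then consider (single) x where "Q = [x]" | (whole) "2 \<le> length Q" "A = []" "Z = []"
      | (proper) "2 \<le> length Q" "length P + length Q + length R \<le> N"
      using top by (cases Q; cases "tl Q"; cases A; cases Z) auto
    then show ?thesis
    proof cases
      case (single x)
      have "ma' (map (ident C) A @ al' P Q R # map (ident C) Z) = ident C (m' (A @ m' (P @ Q @ R) # Z))"
        using single o top ma'_ident[of "A @ m' (P @ Q @ R) # Z"] by (simp add: al'_single)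
      moreover have "al' A (P @ Q @ R) Z \<in> Arr C" "dom C (al' A (P @ Q @ R) Z) = m' (A @ P @ Q @ R @ Z)"
          "cod C (al' A (P @ Q @ R) Z) = m' (A @ m' (P @ Q @ R) # Z)"
        using o single top al'_Arr[of A "P @ Q @ R" Z] dom_al'[of A "P @ Q @ R" Z] cod_al'[of A "P @ Q @ R" Z]
        by simp_all
      moreover have "al' (A @ P) Q (R @ Z) = ident C (m' (A @ P @ Q @ R @ Z))"
        using single o top al'_single[of "A @ P" x "R @ Z"] by simp
      ultimately show ?thesis
        using single o by simp
    next
      case whole
      have t: "al' P Q R \<in> Arr C" "dom C (al' P Q R) = m' (P @ Q @ R)" "cod C (al' P Q R) = m' (P @ m' Q # R)"
        using o whole top al'_Arr[of P Q R] dom_al'[of P Q R] cod_al'[of P Q R] by simp_all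
      have "length Q \<le> Suc N" "Suc (length P + length R) \<le> N"
        using whole top by simp_all
      then show ?thesis
        using whole o top t by (simp add: al'_whole al_whole)
    next
      case proper
      have "length Q \<le> N" "Suc (length A + length P + length R + length Z) \<le> N" "length A + length Z < N"
        "2 \<le> length P + length Q + length R" "length P + length R < N"
        using proper top by linarith+
      then show ?thesis
        using proper top o proj_nested[of A P Q R Z] by (simp add: whisker_def)
    qed
  qed
qed

lemma limit_extension: "oplax_blocks C (Suc N) N m' ma' al'"
proof
  show "N \<le> Suc N" "Suc N \<le> Suc N" "0 < Suc N"
    by simp_all
  show "al' [] B [] = ident C (m' B)" if "B \<in> objs" "length B \<le> Suc N" "0 < N + length B" for B
    using that by (simp add: al'_whole)
  show "al' A [x] Z = ident C (m' (A @ x # Z))"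
    if "A \<in> objs" "x \<in> Obj C" "Z \<in> objs" "length A + length Z < Suc N" for A x Z
    using that by (simp add: al'_single)
qed (fact m'_Obj ma'_in_hom ma'_ident ma'_comp m'_single ma'_single al'_in_hom al'_natural al'_parallel
    al'_nested)+

lemma limit_extension_limit:
  assumes X: "X \<in> objs" "length X = Suc N"
  shows "oplax_blocks.block_limit C m' ma' al' X"
proof -
  interpret E: oplax_blocks C "Suc N" N m' ma' al'
    by (rule limit_extension)
  have lens: "length A + length B + length Z = Suc N \<and> length B \<le> N" if "X = A @ B @ Z"
      "length B < length X" for A B Z
    using that(1) that(2)[unfolded X(2)] X(2) by auto
  have whisker_eq: "E.whisker A f Z = whisker A f Z" if "length A + length Z < N" for A f Z
    using that by (simp add: E.whisker_def whisker_def)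
  have cone_iff: "E.block_cone X y q \<longleftrightarrow> block_cone X y q" for y q
  proof -
    have "m' (A @ m' B # Z) = m (A @ m B # Z)" if "X = A @ B @ Z" "2 \<le> length B" "length B < length X" for A B Z
    proof -
      have "Suc (length A + length Z) \<le> N" "length B \<le> N"
        using lens[OF that(1,3)] that(2) by linarith+
      then show ?thesis
        by simp
    qed
    moreover have "al' (A @ m' B # M) B' Z = al (A @ m B # M) B' Z" "al' A B (M @ m' B' # Z) =
        al A B (M @ m B' # Z)"
      if "X = A @ B @ M @ B' @ Z" "2 \<le> length B" "2 \<le> length B'" for A B M B' Z
    proof -
      have "length A + length B + length M + length B' + length Z = Suc N"
        using that(1) X(2) by simp
      then have "length A + Suc (length M) + length B' + length Z \<le> N"
        "length A + length B + Suc (length M + length Z) \<le> N" "length B \<le> N" "length B' \<le> N"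
        using that(2,3) by linarith+
      then show "al' (A @ m' B # M) B' Z = al (A @ m B # M) B' Z" "al' A B (M @ m' B' # Z) =
          al A B (M @ m B' # Z)"
        by simp_all
    qed
    moreover have "E.whisker A (al' P Q R) Z = whisker A (al P Q R) Z" "al' A (P @ m' Q # R) Z =
        al A (P @ m Q # R) Z"
      if "X = A @ P @ Q @ R @ Z" "2 \<le> length Q" "length (P @ Q @ R) < length X" for A P Q R Z
    proof -
      have "length A + length P + length Q + length R + length Z = Suc N"
        using that(1) X(2) by simp
      moreover have "length P + length Q + length R \<le> N"
        using that(3) X(2) by simp
      ultimately have "length P + length Q + length R \<le> N" "length A + length Z < N" "length Q \<le> N"
        "length A + Suc (length P + length R) + length Z \<le> N"
        using that(2) by linarith+
      then show "E.whisker A (al' P Q R) Z = whisker A (al P Q R) Z" "al' A (P @ m' Q # R) Z =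
          al A (P @ m Q # R) Z"
        by (simp_all add: whisker_eq)
    qed
    ultimately show ?thesis
      unfolding E.block_cone_def block_cone_def by (intro conj_cong) (simp_all cong: imp_cong)
  qed
  have "al' A B Z = pr X A B Z" if "X = A @ B @ Z" "2 \<le> length B" "length B < length X" for A B Z
    using lens[OF that(1,3)] that by (simp add: proj_def)
  then have "E.mediates X y q = (\<lambda>h. h \<in> Arr C \<and> dom C h = y \<and> cod C h = lim X \<and>
        (\<forall>A B Z. X = A @ B @ Z \<longrightarrow> 2 \<le> length B \<longrightarrow> length B < length X \<longrightarrow> pr X A B Z \<cdot> h = q A B Z))" for y q
    unfolding E.mediates_def fun_eq_iff using X(2) by simp
  then show ?thesis
    unfolding E.block_limit_def cone_iff using lim_universal[OF X] by simp
qed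

end

section \<open>Inserting a unit by the universal property\<close>

text \<open>
  The multiplication of degree \<open>N + 1\<close> is a limit, and it remains to construct the maps that insert a
  unit into a tuple of degree \<open>N\<close>.
\<close>

locale unit_step = oplax_blocks C "Suc N" N m ma al
  for C :: "('o, 'm) cat" and N m ma al +
  assumes N_pos: "0 < N"
    and top_limit: "X \<in> objs \<Longrightarrow> length X = Suc N \<Longrightarrow> block_limit X"
begin

abbreviation I :: 'o where
  "I \<equiv> m []"

text \<open>
  The composite of the map \<open>m (A @ Z) \<rightarrow> m (A @ I # Z)\<close>, still to be constructed, with the projection to
  the block \<open>B\<close> of \<open>A @ I # Z = A1 @ B @ Z1\<close>. If the unit is outside the block, the axiom for disjoint
  blocks prescribes to multiply the block first and to insert the unit afterwards; if it is inside, the axiom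
  for nested blocks prescribes to multiply the block without the unit and to insert the unit into it afterwards.
\<close>

definition unit_leg :: "'o list \<Rightarrow> 'o list \<Rightarrow> 'o list \<Rightarrow> 'o list \<Rightarrow> 'o list \<Rightarrow> 'm" where
  "unit_leg A Z A1 B Z1 =
    (if length A1 + length B \<le> length A then
       let M = drop (length A1 + length B) A in al (A1 @ m B # M) [] Z \<cdot> al A1 B (M @ Z)
     else if length A < length A1 then
       let M = drop (Suc (length A)) A1 in al A [] (M @ m B # Z1) \<cdot> al (A @ M) B Z1
     else
       let P = drop (length A1) A; R = drop (Suc (length P)) B in
       whisker A1 (al P [] R) Z1 \<cdot> al A1 (P @ R) Z1)"

lemma unit_leg_right: "unit_leg (A1 @ B @ M) Z A1 B (M @ I # Z) = al (A1 @ m B # M) [] Z \<cdot> al A1 B (M @ Z)"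
  by (simp add: unit_leg_def)

lemma unit_leg_left: "B \<noteq> [] \<Longrightarrow>
    unit_leg A (M @ B @ Z1) (A @ I # M) B Z1 = al A [] (M @ m B # Z1) \<cdot> al (A @ M) B Z1"
  by (simp add: unit_leg_def)

lemma unit_leg_inside: "unit_leg (A1 @ P) (R @ Z1) A1 (P @ I # R) Z1 =
    whisker A1 (al P [] R) Z1 \<cdot> al A1 (P @ R) Z1"
  by (simp add: unit_leg_def)

lemma unit_leg_typing:
  assumes AZ: "A \<in> objs" "Z \<in> objs" "length A + length Z = N"
    and X: "A1 @ B @ Z1 = A @ I # Z" "2 \<le> length B" "length B < Suc N"
  shows "unit_leg A Z A1 B Z1 \<in> Arr C \<and> dom C (unit_leg A Z A1 B Z1) = m (A @ Z) \<and>
    cod C (unit_leg A Z A1 B Z1) = m (A1 @ m B # Z1)"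
  using X(1)
proof (cases rule: append3_eq_insert_cases)
  case (right M)
  then show ?thesis
    using AZ X(2,3) by (simp add: unit_leg_right)
next
  case (left M)
  moreover have "B \<noteq> []"
    using X(2) by auto
  ultimately show ?thesis
    using AZ X(2,3) by (simp add: unit_leg_left)
next
  case (inside P R)
  then show ?thesis
    using AZ X(2,3) by (simp add: unit_leg_inside)
qed

text \<open>
  There are five positions of the unit relative to two disjoint blocks. In each of them the unit insertion
      commutes with both multiplications by naturality or by an
  axiom, and before the insertion the two multiplications commute.
\<close>

lemma unit_leg_parallel:
  assumes AZ: "A \<in> objs" "Z \<in> objs" "length A + length Z = N"
    and X: "A1 @ B1 @ M1 @ B2 @ Z1 = A @ I # Z" "2 \<le> length B1" "2 \<le> length B2"
  shows "al (A1 @ m B1 # M1) B2 Z1 \<cdot> unit_leg A Z A1 B1 (M1 @ B2 @ Z1) =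
    al A1 B1 (M1 @ m B2 # Z1) \<cdot> unit_leg A Z (A1 @ B1 @ M1) B2 Z1"
proof -
  have ne: "B1 \<noteq> []" "B2 \<noteq> []"
    using X by auto
  show ?thesis
    using X(1)
  proof (cases rule: append3_eq_insert_cases)
    case (left A2)
    then have o: "A \<in> objs" "A2 \<in> objs" "B1 \<in> objs" "M1 \<in> objs" "B2 \<in> objs" "Z1 \<in> objs"
      and len: "length A + length A2 + length B1 + length M1 + length B2 + length Z1 = N"
      using AZ by auto
    have e1: "al (A @ I # A2 @ m B1 # M1) B2 Z1 \<cdot> al A [] (A2 @ m B1 # M1 @ B2 @ Z1) =
        al A [] (A2 @ m B1 # M1 @ m B2 # Z1) \<cdot> al (A @ A2 @ m B1 # M1) B2 Z1"
      using al_parallel[of A "[]" "A2 @ m B1 # M1" B2 Z1] o len X by simp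
    have e2: "al (A @ I # A2) B1 (M1 @ m B2 # Z1) \<cdot> al A [] (A2 @ B1 @ M1 @ m B2 # Z1) =
        al A [] (A2 @ m B1 # M1 @ m B2 # Z1) \<cdot> al (A @ A2) B1 (M1 @ m B2 # Z1)"
      using al_parallel[of A "[]" A2 B1 "M1 @ m B2 # Z1"] o len X by simp
    have e3: "al (A @ A2 @ m B1 # M1) B2 Z1 \<cdot> al (A @ A2) B1 (M1 @ B2 @ Z1) =
        al (A @ A2) B1 (M1 @ m B2 # Z1) \<cdot> al (A @ A2 @ B1 @ M1) B2 Z1"
      using al_parallel[of "A @ A2" B1 M1 B2 Z1] o len X by simp
    have "al (A @ I # A2 @ m B1 # M1) B2 Z1 \<cdot> al A [] (A2 @ m B1 # M1 @ B2 @ Z1) \<cdot> al (A @ A2) B1 (M1 @ B2 @ Z1)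
        =
      al (A @ I # A2) B1 (M1 @ m B2 # Z1) \<cdot> al A [] (A2 @ B1 @ M1 @ m B2 # Z1) \<cdot> al (A @ A2 @ B1 @ M1) B2 Z1"
      by (rule cube[OF e1 e2 e3]) (use o len X(2,3) in simp_all)
    then show ?thesis
      using unit_leg_left[of B1 A A2 "M1 @ B2 @ Z1"] unit_leg_left[of B2 A "A2 @ B1 @ M1" Z1] left ne by simp
  next
    case (inside P R)
    then have o: "A1 \<in> objs" "P \<in> objs" "R \<in> objs" "M1 \<in> objs" "B2 \<in> objs" "Z1 \<in> objs"
      and len: "length A1 + length P + length R + length M1 + length B2 + length Z1 = N"
      using AZ by auto
    have pr: "1 \<le> length P + length R"
      using X(2) inside by simp
    have e1: "al (A1 @ m (P @ I # R) # M1) B2 Z1 \<cdot> whisker A1 (al P [] R) (M1 @ B2 @ Z1) =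
        whisker A1 (al P [] R) (M1 @ m B2 # Z1) \<cdot> al (A1 @ m (P @ R) # M1) B2 Z1"
      using al_natural_left[of A1 M1 B2 Z1 "al P [] R"] o len X(3) by simp
    have e2: "al A1 (P @ I # R) (M1 @ m B2 # Z1) \<cdot> al (A1 @ P) [] (R @ M1 @ m B2 # Z1) =
        whisker A1 (al P [] R) (M1 @ m B2 # Z1) \<cdot> al A1 (P @ R) (M1 @ m B2 # Z1)"
      using al_nested_whisker[of A1 P "[]" R "M1 @ m B2 # Z1"] o len X(3) by simp
    have e3: "al (A1 @ m (P @ R) # M1) B2 Z1 \<cdot> al A1 (P @ R) (M1 @ B2 @ Z1) =
        al A1 (P @ R) (M1 @ m B2 # Z1) \<cdot> al (A1 @ P @ R @ M1) B2 Z1"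
      using al_parallel[of A1 "P @ R" M1 B2 Z1] o len X(3) pr by simp
    have "al (A1 @ m (P @ I # R) # M1) B2 Z1 \<cdot> whisker A1 (al P [] R) (M1 @ B2 @ Z1) \<cdot>
        al A1 (P @ R) (M1 @ B2 @ Z1) =
       al A1 (P @ I # R) (M1 @ m B2 # Z1) \<cdot> al (A1 @ P) [] (R @ M1 @ m B2 # Z1) \<cdot> al (A1 @ P @ R @ M1) B2 Z1"
      by (rule cube[OF e1 e2 e3]) (use o len X(3) pr in simp_all)
    then show ?thesis
      using unit_leg_inside[of A1 P R "M1 @ B2 @ Z1"] unit_leg_left[of B2 "A1 @ P" "R @ M1" Z1] inside ne
          by simp
  next
    case (right M)
    note first = right
    show ?thesis
      using right(2)
    proof (cases rule: append3_eq_insert_cases)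
      case (left Mb)
      then have o: "A1 \<in> objs" "B1 \<in> objs" "M \<in> objs" "Mb \<in> objs" "B2 \<in> objs" "Z1 \<in> objs"
        and len: "length A1 + length B1 + length M + length Mb + length B2 + length Z1 = N"
        using AZ first by auto
      have e1: "al (A1 @ m B1 # M @ I # Mb) B2 Z1 \<cdot> al (A1 @ m B1 # M) [] (Mb @ B2 @ Z1) =
          al (A1 @ m B1 # M) [] (Mb @ m B2 # Z1) \<cdot> al (A1 @ m B1 # M @ Mb) B2 Z1"
        using al_parallel[of "A1 @ m B1 # M" "[]" Mb B2 Z1] o len X by simp
      have e2: "al A1 B1 (M @ I # Mb @ m B2 # Z1) \<cdot> al (A1 @ B1 @ M) [] (Mb @ m B2 # Z1) =
          al (A1 @ m B1 # M) [] (Mb @ m B2 # Z1) \<cdot> al A1 B1 (M @ Mb @ m B2 # Z1)"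
        using al_parallel[of A1 B1 M "[]" "Mb @ m B2 # Z1"] o len X by simp
      have e3: "al (A1 @ m B1 # M @ Mb) B2 Z1 \<cdot> al A1 B1 (M @ Mb @ B2 @ Z1) =
          al A1 B1 (M @ Mb @ m B2 # Z1) \<cdot> al (A1 @ B1 @ M @ Mb) B2 Z1"
        using al_parallel[of A1 B1 "M @ Mb" B2 Z1] o len X by simp
      have "al (A1 @ m B1 # M @ I # Mb) B2 Z1 \<cdot> al (A1 @ m B1 # M) [] (Mb @ B2 @ Z1) \<cdot>
          al A1 B1 (M @ Mb @ B2 @ Z1) =
        al A1 B1 (M @ I # Mb @ m B2 # Z1) \<cdot> al (A1 @ B1 @ M) [] (Mb @ m B2 # Z1) \<cdot> al (A1 @ B1 @ M @ Mb) B2 Z1"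
        by (rule cube[OF e1 e2 e3]) (use o len X(2,3) in simp_all)
      then show ?thesis
        using unit_leg_right[of A1 B1 M "Mb @ B2 @ Z1"] unit_leg_left[of B2 "A1 @ B1 @ M" Mb Z1] first left ne
            by simp
    next
      case (inside P R)
      then have o: "A1 \<in> objs" "B1 \<in> objs" "M1 \<in> objs" "P \<in> objs" "R \<in> objs" "Z1 \<in> objs"
        and len: "length A1 + length B1 + length M1 + length P + length R + length Z1 = N"
        using AZ first by auto
      have pr: "1 \<le> length P + length R"
        using X(3) inside by simp
      have e1: "al (A1 @ m B1 # M1) (P @ I # R) Z1 \<cdot> al (A1 @ m B1 # M1 @ P) [] (R @ Z1) =
          whisker (A1 @ m B1 # M1) (al P [] R) Z1 \<cdot> al (A1 @ m B1 # M1) (P @ R) Z1"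
        using al_nested_whisker[of "A1 @ m B1 # M1" P "[]" R Z1] o len X(2) by simp
      have e2: "al A1 B1 (M1 @ m (P @ I # R) # Z1) \<cdot> whisker (A1 @ B1 @ M1) (al P [] R) Z1 =
          whisker (A1 @ m B1 # M1) (al P [] R) Z1 \<cdot> al A1 B1 (M1 @ m (P @ R) # Z1)"
        using al_natural_right[of A1 B1 M1 Z1 "al P [] R"] o len X(2) by simp
      have e3: "al (A1 @ m B1 # M1) (P @ R) Z1 \<cdot> al A1 B1 (M1 @ P @ R @ Z1) =
          al A1 B1 (M1 @ m (P @ R) # Z1) \<cdot> al (A1 @ B1 @ M1) (P @ R) Z1"
        using al_parallel[of A1 B1 M1 "P @ R" Z1] o len X(2) pr by simp
      have "al (A1 @ m B1 # M1) (P @ I # R) Z1 \<cdot> al (A1 @ m B1 # M1 @ P) [] (R @ Z1) \<cdot>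
          al A1 B1 (M1 @ P @ R @ Z1) =
        al A1 B1 (M1 @ m (P @ I # R) # Z1) \<cdot> whisker (A1 @ B1 @ M1) (al P [] R) Z1 \<cdot> al (A1 @ B1 @ M1) (P @ R)
            Z1"
        by (rule cube[OF e1 e2 e3]) (use o len X(2) pr in simp_all)
      then show ?thesis
        using unit_leg_right[of A1 B1 "M1 @ P" "R @ Z1"] unit_leg_inside[of "A1 @ B1 @ M1" P R Z1] first inside
            ne by simp
    next
      case (right Z2)
      then have o: "A1 \<in> objs" "B1 \<in> objs" "M1 \<in> objs" "B2 \<in> objs" "Z2 \<in> objs" "Z \<in> objs"
        and len: "length A1 + length B1 + length M1 + length B2 + length Z2 + length Z = N"
        using AZ first by auto
      have e1: "al (A1 @ m B1 # M1) B2 (Z2 @ I # Z) \<cdot> al (A1 @ m B1 # M1 @ B2 @ Z2) [] Z =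
          al (A1 @ m B1 # M1 @ m B2 # Z2) [] Z \<cdot> al (A1 @ m B1 # M1) B2 (Z2 @ Z)"
        using al_parallel[of "A1 @ m B1 # M1" B2 Z2 "[]" Z] o len X by simp
      have e2: "al A1 B1 (M1 @ m B2 # Z2 @ I # Z) \<cdot> al (A1 @ B1 @ M1 @ m B2 # Z2) [] Z =
          al (A1 @ m B1 # M1 @ m B2 # Z2) [] Z \<cdot> al A1 B1 (M1 @ m B2 # Z2 @ Z)"
        using al_parallel[of A1 B1 "M1 @ m B2 # Z2" "[]" Z] o len X by simp
      have e3: "al (A1 @ m B1 # M1) B2 (Z2 @ Z) \<cdot> al A1 B1 (M1 @ B2 @ Z2 @ Z) =
          al A1 B1 (M1 @ m B2 # Z2 @ Z) \<cdot> al (A1 @ B1 @ M1) B2 (Z2 @ Z)"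
        using al_parallel[of A1 B1 M1 B2 "Z2 @ Z"] o len X by simp
      have "al (A1 @ m B1 # M1) B2 (Z2 @ I # Z) \<cdot> al (A1 @ m B1 # M1 @ B2 @ Z2) [] Z \<cdot>
          al A1 B1 (M1 @ B2 @ Z2 @ Z) =
        al A1 B1 (M1 @ m B2 # Z2 @ I # Z) \<cdot> al (A1 @ B1 @ M1 @ m B2 # Z2) [] Z \<cdot> al (A1 @ B1 @ M1) B2 (Z2 @ Z)"
        by (rule cube[OF e1 e2 e3]) (use o len X(2,3) in simp_all)
      then show ?thesis
        using unit_leg_right[of A1 B1 "M1 @ B2 @ Z2" Z] unit_leg_right[of "A1 @ B1 @ M1" B2 Z2 Z] first right ne
            by simp
    qed
  qed
qed

text \<open>
  There are again five positions of the unit. If it lies in the outer block, the first equation is an axiom in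
      lower degree, whiskered into its place.
\<close>

lemma unit_leg_nested:
  assumes AZ: "A \<in> objs" "Z \<in> objs" "length A + length Z = N"
    and X: "A1 @ P @ Q @ R @ Z1 = A @ I # Z" "2 \<le> length Q" "length P + length Q + length R < Suc N"
  shows "whisker A1 (al P Q R) Z1 \<cdot> unit_leg A Z A1 (P @ Q @ R) Z1 =
    al A1 (P @ m Q # R) Z1 \<cdot> unit_leg A Z (A1 @ P) Q (R @ Z1)"
proof -
  have ne: "Q \<noteq> []"
    using X by auto
  have "A1 @ (P @ Q @ R) @ Z1 = A @ I # Z"
    using X(1) by simp
  then show ?thesis
  proof (cases rule: append3_eq_insert_cases)
    case (left A2)
    then have o: "A \<in> objs" "A2 \<in> objs" "P \<in> objs" "Q \<in> objs" "R \<in> objs" "Z1 \<in> objs"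
      and len: "length A + length A2 + length P + length Q + length R + length Z1 = N"
      using AZ by auto
    have e1: "whisker (A @ I # A2) (al P Q R) Z1 \<cdot> al A [] (A2 @ m (P @ Q @ R) # Z1) =
        al A [] (A2 @ m (P @ m Q # R) # Z1) \<cdot> whisker (A @ A2) (al P Q R) Z1"
      using al_natural_right[of A "[]" A2 Z1 "al P Q R"] o len X(2) by simp
    have e2: "al (A @ I # A2) (P @ m Q # R) Z1 \<cdot> al A [] (A2 @ P @ m Q # R @ Z1) =
        al A [] (A2 @ m (P @ m Q # R) # Z1) \<cdot> al (A @ A2) (P @ m Q # R) Z1"
      using al_parallel[of A "[]" A2 "P @ m Q # R" Z1] o len X(2) by simp
    have e3: "whisker (A @ A2) (al P Q R) Z1 \<cdot> al (A @ A2) (P @ Q @ R) Z1 =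
        al (A @ A2) (P @ m Q # R) Z1 \<cdot> al (A @ A2 @ P) Q (R @ Z1)"
      using al_nested_whisker[of "A @ A2" P Q R Z1] o len X(2) by simp
    have "whisker (A @ I # A2) (al P Q R) Z1 \<cdot> al A [] (A2 @ m (P @ Q @ R) # Z1) \<cdot> al (A @ A2) (P @ Q @ R) Z1 =
      al (A @ I # A2) (P @ m Q # R) Z1 \<cdot> al A [] (A2 @ P @ m Q # R @ Z1) \<cdot> al (A @ A2 @ P) Q (R @ Z1)"
      by (rule cube[OF e1 e2 e3]) (use o len X(2) in simp_all)
    then show ?thesis
      using unit_leg_left[of "P @ Q @ R" A A2 Z1] unit_leg_left[of Q A "A2 @ P" "R @ Z1"] left ne by simp
  next
    case (right Z2)
    then have o: "A1 \<in> objs" "P \<in> objs" "Q \<in> objs" "R \<in> objs" "Z2 \<in> objs" "Z \<in> objs"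
      and len: "length A1 + length P + length Q + length R + length Z2 + length Z = N"
      using AZ by auto
    have e1: "whisker A1 (al P Q R) (Z2 @ I # Z) \<cdot> al (A1 @ m (P @ Q @ R) # Z2) [] Z =
        al (A1 @ m (P @ m Q # R) # Z2) [] Z \<cdot> whisker A1 (al P Q R) (Z2 @ Z)"
      using al_natural_left[of A1 Z2 "[]" Z "al P Q R"] o len X(2) by simp
    have e2: "al A1 (P @ m Q # R) (Z2 @ I # Z) \<cdot> al (A1 @ P @ m Q # R @ Z2) [] Z =
        al (A1 @ m (P @ m Q # R) # Z2) [] Z \<cdot> al A1 (P @ m Q # R) (Z2 @ Z)"
      using al_parallel[of A1 "P @ m Q # R" Z2 "[]" Z] o len X(2) by simp
    have e3: "whisker A1 (al P Q R) (Z2 @ Z) \<cdot> al A1 (P @ Q @ R) (Z2 @ Z) =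
        al A1 (P @ m Q # R) (Z2 @ Z) \<cdot> al (A1 @ P) Q (R @ Z2 @ Z)"
      using al_nested_whisker[of A1 P Q R "Z2 @ Z"] o len X(2) by simp
    have "whisker A1 (al P Q R) (Z2 @ I # Z) \<cdot> al (A1 @ m (P @ Q @ R) # Z2) [] Z \<cdot> al A1 (P @ Q @ R) (Z2 @ Z) =
      al A1 (P @ m Q # R) (Z2 @ I # Z) \<cdot> al (A1 @ P @ m Q # R @ Z2) [] Z \<cdot> al (A1 @ P) Q (R @ Z2 @ Z)"
      by (rule cube[OF e1 e2 e3]) (use o len X(2) in simp_all)
    then show ?thesis
      using unit_leg_right[of A1 "P @ Q @ R" Z2 Z] unit_leg_right[of "A1 @ P" Q "R @ Z2" Z] right ne by simp
  next
    case (inside P' R')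
    note first = inside
    from inside(2) show ?thesis
    proof (cases rule: append3_eq_insert_cases)
      case (left P2)
      then have o: "A1 \<in> objs" "P' \<in> objs" "P2 \<in> objs" "Q \<in> objs" "R \<in> objs" "Z1 \<in> objs"
        and len: "length A1 + length P' + length P2 + length Q + length R + length Z1 = N"
        using AZ first by auto
      have proper: "length P' + length P2 + length Q + length R < N"
        using X(3) left by simp
      have e0: "al (P' @ I # P2) Q R \<cdot> al P' [] (P2 @ Q @ R) = al P' [] (P2 @ m Q # R) \<cdot> al (P' @ P2) Q R"
        using al_parallel[of P' "[]" P2 Q R] o len proper X(2) by simp
      have e1: "whisker A1 (al (P' @ I # P2) Q R) Z1 \<cdot> whisker A1 (al P' [] (P2 @ Q @ R)) Z1 =
          whisker A1 (al P' [] (P2 @ m Q # R)) Z1 \<cdot> whisker A1 (al (P' @ P2) Q R) Z1"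
        using arg_cong[OF e0, of "\<lambda>f. whisker A1 f Z1"] o len proper X(2) by (simp add: whisker_seq)
      have e2: "al A1 (P' @ I # P2 @ m Q # R) Z1 \<cdot> al (A1 @ P') [] (P2 @ m Q # R @ Z1) =
          whisker A1 (al P' [] (P2 @ m Q # R)) Z1 \<cdot> al A1 (P' @ P2 @ m Q # R) Z1"
        using al_nested_whisker[of A1 P' "[]" "P2 @ m Q # R" Z1] o len X(2) by simp
      have e3: "whisker A1 (al (P' @ P2) Q R) Z1 \<cdot> al A1 (P' @ P2 @ Q @ R) Z1 =
          al A1 (P' @ P2 @ m Q # R) Z1 \<cdot> al (A1 @ P' @ P2) Q (R @ Z1)"
        using al_nested_whisker[of A1 "P' @ P2" Q R Z1] o len X(2) by simp
      have "whisker A1 (al (P' @ I # P2) Q R) Z1 \<cdot> whisker A1 (al P' [] (P2 @ Q @ R)) Z1 \<cdot>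
          al A1 (P' @ P2 @ Q @ R) Z1 =
        al A1 (P' @ I # P2 @ m Q # R) Z1 \<cdot> al (A1 @ P') [] (P2 @ m Q # R @ Z1) \<cdot> al (A1 @ P' @ P2) Q (R @ Z1)"
        by (rule cube[OF e1 e2 e3]) (use o len X(2) proper in simp_all)
      then show ?thesis
        using unit_leg_inside[of A1 P' "P2 @ Q @ R" Z1] unit_leg_left[of Q "A1 @ P'" P2 "R @ Z1"] first left ne
            by simp
    next
      case (right R1)
      then have o: "A1 \<in> objs" "P \<in> objs" "Q \<in> objs" "R1 \<in> objs" "R' \<in> objs" "Z1 \<in> objs"
        and len: "length A1 + length P + length Q + length R1 + length R' + length Z1 = N"
        using AZ first by auto
      have proper: "length P + length Q + length R1 + length R' < N"
        using X(3) right by simp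
      have e0: "al P Q (R1 @ I # R') \<cdot> al (P @ Q @ R1) [] R' = al (P @ m Q # R1) [] R' \<cdot> al P Q (R1 @ R')"
        using al_parallel[of P Q R1 "[]" R'] o len proper X(2) by simp
      have e1: "whisker A1 (al P Q (R1 @ I # R')) Z1 \<cdot> whisker A1 (al (P @ Q @ R1) [] R') Z1 =
          whisker A1 (al (P @ m Q # R1) [] R') Z1 \<cdot> whisker A1 (al P Q (R1 @ R')) Z1"
        using arg_cong[OF e0, of "\<lambda>f. whisker A1 f Z1"] o len proper X(2) by (simp add: whisker_seq)
      have e2: "al A1 (P @ m Q # R1 @ I # R') Z1 \<cdot> al (A1 @ P @ m Q # R1) [] (R' @ Z1) =
          whisker A1 (al (P @ m Q # R1) [] R') Z1 \<cdot> al A1 (P @ m Q # R1 @ R') Z1"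
        using al_nested_whisker[of A1 "P @ m Q # R1" "[]" R' Z1] o len X(2) by simp
      have e3: "whisker A1 (al P Q (R1 @ R')) Z1 \<cdot> al A1 (P @ Q @ R1 @ R') Z1 =
          al A1 (P @ m Q # R1 @ R') Z1 \<cdot> al (A1 @ P) Q (R1 @ R' @ Z1)"
        using al_nested_whisker[of A1 P Q "R1 @ R'" Z1] o len X(2) by simp
      have "whisker A1 (al P Q (R1 @ I # R')) Z1 \<cdot> whisker A1 (al (P @ Q @ R1) [] R') Z1 \<cdot>
          al A1 (P @ Q @ R1 @ R') Z1 =
        al A1 (P @ m Q # R1 @ I # R') Z1 \<cdot> al (A1 @ P @ m Q # R1) [] (R' @ Z1) \<cdot> al (A1 @ P) Q (R1 @ R' @ Z1)"
        by (rule cube[OF e1 e2 e3]) (use o len X(2) proper in simp_all)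
      then show ?thesis
        using unit_leg_inside[of A1 "P @ Q @ R1" R' Z1] unit_leg_right[of "A1 @ P" Q R1 "R' @ Z1"] first right
            ne by simp
    next
      case (inside Q1 Q2)
      then have o: "A1 \<in> objs" "P \<in> objs" "Q1 \<in> objs" "Q2 \<in> objs" "R \<in> objs" "Z1 \<in> objs"
        and len: "length A1 + length P + length Q1 + length Q2 + length R + length Z1 = N"
        using AZ first by auto
      have proper: "length P + length Q1 + length Q2 + length R < N"
        using X(3) inside by simp
      have q: "1 \<le> length Q1 + length Q2"
        using X(2) inside by simp
      have e0: "al P (Q1 @ I # Q2) R \<cdot> al (P @ Q1) [] (Q2 @ R) = whisker P (al Q1 [] Q2) R \<cdot> al P (Q1 @ Q2) R"
        using al_nested_whisker[of P Q1 "[]" Q2 R] o len proper by simp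
      have e1: "whisker A1 (al P (Q1 @ I # Q2) R) Z1 \<cdot> whisker A1 (al (P @ Q1) [] (Q2 @ R)) Z1 =
          whisker A1 (whisker P (al Q1 [] Q2) R) Z1 \<cdot> whisker A1 (al P (Q1 @ Q2) R) Z1"
        using arg_cong[OF e0, of "\<lambda>f. whisker A1 f Z1"] o len proper q by (simp add: whisker_seq)
      have e2: "al A1 (P @ m (Q1 @ I # Q2) # R) Z1 \<cdot> whisker (A1 @ P) (al Q1 [] Q2) (R @ Z1) =
          whisker A1 (whisker P (al Q1 [] Q2) R) Z1 \<cdot> al A1 (P @ m (Q1 @ Q2) # R) Z1"
        using al_natural_inside[of A1 P R Z1 "al Q1 [] Q2"] o len proper q by simp
      have e3: "whisker A1 (al P (Q1 @ Q2) R) Z1 \<cdot> al A1 (P @ Q1 @ Q2 @ R) Z1 =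
          al A1 (P @ m (Q1 @ Q2) # R) Z1 \<cdot> al (A1 @ P) (Q1 @ Q2) (R @ Z1)"
        using al_nested_whisker[of A1 P "Q1 @ Q2" R Z1] o len q by simp
      have "whisker A1 (al P (Q1 @ I # Q2) R) Z1 \<cdot> whisker A1 (al (P @ Q1) [] (Q2 @ R)) Z1 \<cdot>
          al A1 (P @ Q1 @ Q2 @ R) Z1 =
        al A1 (P @ m (Q1 @ I # Q2) # R) Z1 \<cdot> whisker (A1 @ P) (al Q1 [] Q2) (R @ Z1) \<cdot>
            al (A1 @ P) (Q1 @ Q2) (R @ Z1)"
        by (rule cube[OF e1 e2 e3]) (use o len q proper in simp_all)
      then show ?thesis
        using unit_leg_inside[of A1 "P @ Q1" "Q2 @ R" Z1] unit_leg_inside[of "A1 @ P" Q1 Q2 "R @ Z1"] first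
            inside ne by simp
    qed
  qed
qed

lemma unit_leg_cone:
  assumes "A \<in> objs" "Z \<in> objs" "length A + length Z = N"
  shows "block_cone (A @ I # Z) (m (A @ Z)) (unit_leg A Z)"
  unfolding block_cone_def
proof (intro conjI allI impI)
  show "m (A @ Z) \<in> Obj C"
    using assms by simp
next
  fix A1 B Z1 assume *: "A @ I # Z = A1 @ B @ Z1" "2 \<le> length B" "length B < length (A @ I # Z)"
  have "length B < Suc N"
    using *(3) assms(3) by simp
  then show "unit_leg A Z A1 B Z1 \<in> Arr C" "dom C (unit_leg A Z A1 B Z1) = m (A @ Z)"
    "cod C (unit_leg A Z A1 B Z1) = m (A1 @ m B # Z1)"
    using unit_leg_typing[OF assms *(1)[symmetric] *(2)] by simp_all
next
  fix A1 B1 M1 B2 Z1 assume "A @ I # Z = A1 @ B1 @ M1 @ B2 @ Z1" "2 \<le> length B1" "2 \<le> length B2"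
  then show "al (A1 @ m B1 # M1) B2 Z1 \<cdot> unit_leg A Z A1 B1 (M1 @ B2 @ Z1) =
    al A1 B1 (M1 @ m B2 # Z1) \<cdot> unit_leg A Z (A1 @ B1 @ M1) B2 Z1"
    by (intro unit_leg_parallel[OF assms]) simp_all
next
  fix A1 P Q R Z1
  assume *: "A @ I # Z = A1 @ P @ Q @ R @ Z1" "2 \<le> length Q" "length (P @ Q @ R) < length (A @ I # Z)"
  have "length P + length Q + length R < Suc N"
    using *(3) assms(3) by simp
  then show "whisker A1 (al P Q R) Z1 \<cdot> unit_leg A Z A1 (P @ Q @ R) Z1 =
    al A1 (P @ m Q # R) Z1 \<cdot> unit_leg A Z (A1 @ P) Q (R @ Z1)"
    using *(1,2) by (intro unit_leg_nested[OF assms]) simp_all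
qed

definition insert_unit :: "'o list \<Rightarrow> 'o list \<Rightarrow> 'm" where
  "insert_unit A Z = mediator (A @ I # Z) (m (A @ Z)) (unit_leg A Z)"

lemma
  assumes "A \<in> objs" "Z \<in> objs" "length A + length Z = N"
  shows insert_unit_Arr [simp]: "insert_unit A Z \<in> Arr C"
    and dom_insert_unit [simp]: "dom C (insert_unit A Z) = m (A @ Z)"
    and cod_insert_unit [simp]: "cod C (insert_unit A Z) = m (A @ I # Z)"
  using mediator[OF top_limit unit_leg_cone[OF assms]] assms by (simp_all add: insert_unit_def)

lemma al_insert_unit:
  assumes "A \<in> objs" "Z \<in> objs" "length A + length Z = N"
    and "A @ I # Z = A1 @ B @ Z1" "2 \<le> length B" "length B \<le> N"
  shows "al A1 B Z1 \<cdot> insert_unit A Z = unit_leg A Z A1 B Z1"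
proof -
  have "length B < length (A @ I # Z)"
    using assms(3,6) by simp
  then show ?thesis
    unfolding insert_unit_def using mediator(4)[OF top_limit unit_leg_cone[OF assms(1-3)] assms(4,5)] assms(1-3)
        by simp
qed

lemma al_insert_unit_right:
  assumes "A1 \<in> objs" "B \<in> objs" "M \<in> objs" "Z \<in> objs"
    and "length A1 + length B + length M + length Z = N" "2 \<le> length B"
  shows "al A1 B (M @ I # Z) \<cdot> insert_unit (A1 @ B @ M) Z = al (A1 @ m B # M) [] Z \<cdot> al A1 B (M @ Z)"
  using al_insert_unit[of "A1 @ B @ M" Z A1 B "M @ I # Z"] assms by (simp add: unit_leg_right)

lemma al_insert_unit_left:
  assumes "A \<in> objs" "M \<in> objs" "B \<in> objs" "Z1 \<in> objs"
    and "length A + length M + length B + length Z1 = N" "2 \<le> length B"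
  shows "al (A @ I # M) B Z1 \<cdot> insert_unit A (M @ B @ Z1) = al A [] (M @ m B # Z1) \<cdot> al (A @ M) B Z1"
proof -
  have "B \<noteq> []"
    using assms by auto
  then show ?thesis
    using al_insert_unit[of A "M @ B @ Z1" "A @ I # M" B Z1] assms by (simp add: unit_leg_left)
qed

lemma al_insert_unit_inside:
  assumes "A1 \<in> objs" "P \<in> objs" "R \<in> objs" "Z1 \<in> objs"
    and "length A1 + length P + length R + length Z1 = N" "1 \<le> length P + length R"
    "length P + length R < N"
  shows "al A1 (P @ I # R) Z1 \<cdot> insert_unit (A1 @ P) (R @ Z1) = whisker A1 (al P [] R) Z1 \<cdot> al A1 (P @ R) Z1"
proof -
  have "2 \<le> length (P @ I # R)" "length (P @ I # R) \<le> N"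
    using assms(6,7) by simp_all
  moreover have "(A1 @ P) @ I # R @ Z1 = A1 @ (P @ I # R) @ Z1"
    by simp
  ultimately show ?thesis
    using al_insert_unit[of "A1 @ P" "R @ Z1" A1 "P @ I # R" Z1] assms by (simp add: unit_leg_inside)
qed

lemma top_monic:
  assumes "X \<in> objs" "length X = Suc N"
    and "h \<in> Arr C" "cod C h = m X" "k \<in> Arr C" "cod C k = m X" "dom C h = dom C k"
    and "\<And>A B Z. A @ B @ Z = X \<Longrightarrow> A \<in> objs \<Longrightarrow> B \<in> objs \<Longrightarrow> Z \<in> objs \<Longrightarrow>
      length A + length B + length Z = Suc N \<Longrightarrow> 2 \<le> length B \<Longrightarrow>
      length B \<le> N \<Longrightarrow> al A B Z \<cdot> h = al A B Z \<cdot> k"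
  shows "h = k"
proof (rule block_limit_jointly_monic[OF top_limit])
  fix A B Z
  assume *: "X = A @ B @ Z" "A \<in> objs" "B \<in> objs" "Z \<in> objs" "2 \<le> length B" "length B < length X"
  have "length A + length B + length Z = Suc N"
    using *(1) assms(2) by simp
  moreover have "length B \<le> N"
    using *(6) assms(2) by simp
  ultimately show "al A B Z \<cdot> h = al A B Z \<cdot> k"
    using assms(8)[of A B Z] * by simp
qed (use assms in simp_all)

text \<open>
  The legs that define \<open>insert_unit\<close> are natural, so the map is natural by joint monicity.
\<close>

lemma insert_unit_natural:
  assumes F: "F \<in> arrs" "H \<in> arrs" "length F + length H = N"
  shows "insert_unit (map (cod C) F) (map (cod C) H) \<cdot> ma (F @ H) =
    ma (F @ ma [] # H) \<cdot> insert_unit (map (dom C) F) (map (dom C) H)"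
proof (rule top_monic[of "map (cod C) F @ I # map (cod C) H"])
  have [simp]: "ma [] = ident C I"
    using ma_ident[of "[]"] by simp
  let ?c = "map (cod C)" and ?d = "map (dom C)"
  show "?c F @ I # ?c H \<in> objs" "length (?c F @ I # ?c H) = Suc N"
    "insert_unit (?c F) (?c H) \<cdot> ma (F @ H) \<in> Arr C" "cod C (insert_unit (?c F) (?c H) \<cdot> ma (F @ H)) =
        m (?c F @ I # ?c H)"
    "ma (F @ ma [] # H) \<cdot> insert_unit (?d F) (?d H) \<in> Arr C"
    "cod C (ma (F @ ma [] # H) \<cdot> insert_unit (?d F) (?d H)) = m (?c F @ I # ?c H)"
    "dom C (insert_unit (?c F) (?c H) \<cdot> ma (F @ H)) = dom C (ma (F @ ma [] # H) \<cdot> insert_unit (?d F) (?d H))"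
    using F by simp_all
  fix A1 B Z1
  assume X: "A1 @ B @ Z1 = ?c F @ I # ?c H" and B: "2 \<le> length B" "length B \<le> N"
  show "al A1 B Z1 \<cdot> insert_unit (?c F) (?c H) \<cdot> ma (F @ H) = al A1 B Z1 \<cdot> ma (F @ ma [] # H) \<cdot>
      insert_unit (?d F) (?d H)"
    using X
  proof (cases rule: append3_eq_insert_cases)
    case (right M)
    then obtain F1 G F2 where [simp]: "F = F1 @ G @ F2" "A1 = ?c F1" "B = ?c G" "M = ?c F2"
      by (metis map_eq_append3)
    have o: "F1 \<in> arrs" "G \<in> arrs" "F2 \<in> arrs" "H \<in> arrs"
      and len: "length F1 + length G + length F2 + length H = N" and G: "2 \<le> length G"
      using F B by auto
    have e1: "al A1 B Z1 \<cdot> insert_unit (?c F) (?c H) = al (?c F1 @ m (?c G) # ?c F2) [] (?c H) \<cdot>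
        al (?c F1) (?c G) (?c F2 @ ?c H)"
      using al_insert_unit_right[of "?c F1" "?c G" "?c F2" "?c H"] o len G right by simp
    have e2: "al A1 B Z1 \<cdot> ma (F @ ma [] # H) =
      ma (F1 @ ma G # F2 @ ma [] # H) \<cdot> al (?d F1) (?d G) (?d F2 @ I # ?d H)"
      using al_natural[of F1 G "F2 @ ma [] # H"] o len G right by simp
    have e3: "al (?c F1) (?c G) (?c F2 @ ?c H) \<cdot> ma (F @ H) =
        ma (F1 @ ma G # F2 @ H) \<cdot> al (?d F1) (?d G) (?d F2 @ ?d H)"
      using al_natural[of F1 G "F2 @ H"] o len G by simp
    have e4: "al (?d F1) (?d G) (?d F2 @ I # ?d H) \<cdot> insert_unit (?d F) (?d H) =
        al (?d F1 @ m (?d G) # ?d F2) [] (?d H) \<cdot> al (?d F1) (?d G) (?d F2 @ ?d H)"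
      using al_insert_unit_right[of "?d F1" "?d G" "?d F2" "?d H"] o len G by simp
    have e5: "al (?c F1 @ m (?c G) # ?c F2) [] (?c H) \<cdot> ma (F1 @ ma G # F2 @ H) =
        ma (F1 @ ma G # F2 @ ma [] # H) \<cdot> al (?d F1 @ m (?d G) # ?d F2) [] (?d H)"
      using al_natural[of "F1 @ ma G # F2" "[]" H] o len G by simp
    show ?thesis
      by (rule slide[OF e1 e2 e3 e4 e5]) (use o len G right in simp_all)
  next
    case (left M)
    then obtain H1 G H2 where [simp]: "H = H1 @ G @ H2" "M = ?c H1" "B = ?c G" "Z1 = ?c H2"
      by (metis map_eq_append3)
    have o: "F \<in> arrs" "H1 \<in> arrs" "G \<in> arrs" "H2 \<in> arrs"
      and len: "length F + length H1 + length G + length H2 = N" and G: "2 \<le> length G"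
      using F B by auto
    have e1: "al A1 B Z1 \<cdot> insert_unit (?c F) (?c H) = al (?c F) [] (?c H1 @ m (?c G) # ?c H2) \<cdot>
        al (?c F @ ?c H1) (?c G) (?c H2)"
      using al_insert_unit_left[of "?c F" "?c H1" "?c G" "?c H2"] o len G left by simp
    have e2: "al A1 B Z1 \<cdot> ma (F @ ma [] # H) =
      ma (F @ ma [] # H1 @ ma G # H2) \<cdot> al (?d F @ I # ?d H1) (?d G) (?d H2)"
      using al_natural[of "F @ ma [] # H1" G H2] o len G left by simp
    have e3: "al (?c F @ ?c H1) (?c G) (?c H2) \<cdot> ma (F @ H) =
        ma (F @ H1 @ ma G # H2) \<cdot> al (?d F @ ?d H1) (?d G) (?d H2)"
      using al_natural[of "F @ H1" G H2] o len G by simp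
    have e4: "al (?d F @ I # ?d H1) (?d G) (?d H2) \<cdot> insert_unit (?d F) (?d H) =
        al (?d F) [] (?d H1 @ m (?d G) # ?d H2) \<cdot> al (?d F @ ?d H1) (?d G) (?d H2)"
      using al_insert_unit_left[of "?d F" "?d H1" "?d G" "?d H2"] o len G by simp
    have e5: "al (?c F) [] (?c H1 @ m (?c G) # ?c H2) \<cdot> ma (F @ H1 @ ma G # H2) =
        ma (F @ ma [] # H1 @ ma G # H2) \<cdot> al (?d F) [] (?d H1 @ m (?d G) # ?d H2)"
      using al_natural[of F "[]" "H1 @ ma G # H2"] o len G by simp
    show ?thesis
      by (rule slide[OF e1 e2 e3 e4 e5]) (use o len G left in simp_all)
  next
    case (inside P R)
    then obtain F1 FP FR H2 where [simp]: "F = F1 @ FP" "H = FR @ H2" "A1 = ?c F1" "P = ?c FP" "R = ?c FR" "Z1 =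
        ?c H2"
      by (auto simp: map_eq_append_conv)
    have o: "F1 \<in> arrs" "FP \<in> arrs" "FR \<in> arrs" "H2 \<in> arrs"
      and len: "length F1 + length FP + length FR + length H2 = N" and G: "1 \<le> length FP + length FR"
        "length FP + length FR < N"
      using F B inside by auto
    have e1: "al A1 B Z1 \<cdot> insert_unit (?c F) (?c H) = whisker (?c F1) (al (?c FP) [] (?c FR)) (?c H2) \<cdot>
        al (?c F1) (?c FP @ ?c FR) (?c H2)"
      using al_insert_unit_inside[of "?c F1" "?c FP" "?c FR" "?c H2"] o len G inside by simp
    have e2: "al A1 B Z1 \<cdot> ma (F @ ma [] # H) =
      ma (F1 @ ma (FP @ ma [] # FR) # H2) \<cdot> al (?d F1) (?d FP @ I # ?d FR) (?d H2)"
      using al_natural[of F1 "FP @ ma [] # FR" H2] o len G inside by simp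
    have e3: "al (?c F1) (?c FP @ ?c FR) (?c H2) \<cdot> ma (F @ H) =
        ma (F1 @ ma (FP @ FR) # H2) \<cdot> al (?d F1) (?d FP @ ?d FR) (?d H2)"
      using al_natural[of F1 "FP @ FR" H2] o len G by simp
    have e4: "al (?d F1) (?d FP @ I # ?d FR) (?d H2) \<cdot> insert_unit (?d F) (?d H) =
        whisker (?d F1) (al (?d FP) [] (?d FR)) (?d H2) \<cdot> al (?d F1) (?d FP @ ?d FR) (?d H2)"
      using al_insert_unit_inside[of "?d F1" "?d FP" "?d FR" "?d H2"] o len G by simp
    have e0: "al (?c FP) [] (?c FR) \<cdot> ma (FP @ FR) = ma (FP @ ma [] # FR) \<cdot> al (?d FP) [] (?d FR)"
      using al_natural[of FP "[]" FR] o len G by simp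
    have e5: "whisker (?c F1) (al (?c FP) [] (?c FR)) (?c H2) \<cdot> ma (F1 @ ma (FP @ FR) # H2) =
        ma (F1 @ ma (FP @ ma [] # FR) # H2) \<cdot> whisker (?d F1) (al (?d FP) [] (?d FR)) (?d H2)"
      using ma_whisker(1)[of F1 H2 "ma (FP @ FR)" "al (?c FP) [] (?c FR)"]
        ma_whisker(2)[of F1 H2 "al (?d FP) [] (?d FR)" "ma (FP @ ma [] # FR)"] e0 o len G by simp
    show ?thesis
      by (rule slide[OF e1 e2 e3 e4 e5]) (use o len G inside in simp_all)
  qed
qed

text \<open>
  The one axiom between two maps that insert a unit. Its target is a limit, and for each of the six
  positions of a block relative to the two units the projection reduces it to an axiom in lower degree.
\<close>

lemma insert_unit_insert_unit:
  assumes AMZ: "A \<in> objs" "M \<in> objs" "Z \<in> objs" "Suc (length A + length M + length Z) = N"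
  shows "insert_unit (A @ I # M) Z \<cdot> al A [] (M @ Z) = insert_unit A (M @ I # Z) \<cdot> al (A @ M) [] Z"
proof (rule top_monic[of "A @ I # M @ I # Z"])
  show "A @ I # M @ I # Z \<in> objs" "length (A @ I # M @ I # Z) = Suc N"
    "insert_unit (A @ I # M) Z \<cdot> al A [] (M @ Z) \<in> Arr C"
    "cod C (insert_unit (A @ I # M) Z \<cdot> al A [] (M @ Z)) = m (A @ I # M @ I # Z)"
    "insert_unit A (M @ I # Z) \<cdot> al (A @ M) [] Z \<in> Arr C"
    "cod C (insert_unit A (M @ I # Z) \<cdot> al (A @ M) [] Z) = m (A @ I # M @ I # Z)"
    "dom C (insert_unit (A @ I # M) Z \<cdot> al A [] (M @ Z)) = dom C (insert_unit A (M @ I # Z) \<cdot> al (A @ M) [] Z)"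
    using AMZ by simp_all
  fix A1 B Z1
  assume X: "A1 @ B @ Z1 = A @ I # M @ I # Z" and B: "2 \<le> length B" "length B \<le> N"
  show "al A1 B Z1 \<cdot> insert_unit (A @ I # M) Z \<cdot> al A [] (M @ Z) = al A1 B Z1 \<cdot> insert_unit A (M @ I # Z) \<cdot>
      al (A @ M) [] Z"
    using X
  proof (cases rule: append3_eq_insert_cases)
    case (right V)
    then have o: "A1 \<in> objs" "B \<in> objs" "V \<in> objs" "M \<in> objs" "Z \<in> objs"
      and len: "Suc (length A1 + length B + length V + length M + length Z) = N"
      using AMZ by auto
    have e1: "al A1 B Z1 \<cdot> insert_unit (A @ I # M) Z = al (A1 @ m B # V @ I # M) [] Z \<cdot> al A1 B (V @ I # M @ Z)"
      using al_insert_unit_right[of A1 B "V @ I # M" Z] o len B right by simp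
    have e2: "al A1 B Z1 \<cdot> insert_unit A (M @ I # Z) = al (A1 @ m B # V) [] (M @ I # Z) \<cdot>
        al A1 B (V @ M @ I # Z)"
      using al_insert_unit_right[of A1 B V "M @ I # Z"] o len B right by simp
    have e3: "al A1 B (V @ I # M @ Z) \<cdot> al A [] (M @ Z) = al (A1 @ m B # V) [] (M @ Z) \<cdot> al A1 B (V @ M @ Z)"
      using al_parallel[of A1 B V "[]" "M @ Z"] o len B right by simp
    have e4: "al A1 B (V @ M @ I # Z) \<cdot> al (A @ M) [] Z = al (A1 @ m B # V @ M) [] Z \<cdot> al A1 B (V @ M @ Z)"
      using al_parallel[of A1 B "V @ M" "[]" Z] o len B right by simp
    have e5: "al (A1 @ m B # V @ I # M) [] Z \<cdot> al (A1 @ m B # V) [] (M @ Z) =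
        al (A1 @ m B # V) [] (M @ I # Z) \<cdot> al (A1 @ m B # V @ M) [] Z"
      using al_parallel[of "A1 @ m B # V" "[]" M "[]" Z] o len B by simp
    show ?thesis
      by (rule slide[OF e1 e2 e3 e4 e5]) (use o len B right in simp_all)
  next
    case (inside P R)
    note first = inside
    from inside(3) have "R @ Z1 = M @ I # Z"
      by simp
    then consider (both) R' where "R = M @ I # R'" "Z = R' @ Z1" | (one) V where "M = R @ V" "Z1 = V @ I # Z"
      by (fastforce simp: append_eq_append_conv2 append_eq_Cons_conv Cons_eq_append_conv)
    then show ?thesis
    proof cases
      case (both R')
      then have o: "A1 \<in> objs" "P \<in> objs" "M \<in> objs" "R' \<in> objs" "Z1 \<in> objs"
        and len: "Suc (length A1 + length P + length M + length R' + length Z1) = N"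
        using AMZ first by auto
      have len': "Suc (length P + length M + length R') < N"
        using B first both by simp
      have e1: "al A1 B Z1 \<cdot> insert_unit (A @ I # M) Z = whisker A1 (al (P @ I # M) [] R') Z1 \<cdot>
          al A1 (P @ I # M @ R') Z1"
        using al_insert_unit_inside[of A1 "P @ I # M" R' Z1] o len len' first both by simp
      have e2: "al A1 B Z1 \<cdot> insert_unit A (M @ I # Z) = whisker A1 (al P [] (M @ I # R')) Z1 \<cdot>
          al A1 (P @ M @ I # R') Z1"
        using al_insert_unit_inside[of A1 P "M @ I # R'" Z1] o len len' first both by simp
      have e3: "al A1 (P @ I # M @ R') Z1 \<cdot> al A [] (M @ Z) = whisker A1 (al P [] (M @ R')) Z1 \<cdot>
          al A1 (P @ M @ R') Z1"
        using al_nested_whisker[of A1 P "[]" "M @ R'" Z1] o len len' first both by simp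
      have e4: "al A1 (P @ M @ I # R') Z1 \<cdot> al (A @ M) [] Z = whisker A1 (al (P @ M) [] R') Z1 \<cdot>
          al A1 (P @ M @ R') Z1"
        using al_nested_whisker[of A1 "P @ M" "[]" R' Z1] o len len' first both by simp
      have e0: "al (P @ I # M) [] R' \<cdot> al P [] (M @ R') = al P [] (M @ I # R') \<cdot> al (P @ M) [] R'"
        using al_parallel[of P "[]" M "[]" R'] o len len' by simp
      have e5: "whisker A1 (al (P @ I # M) [] R') Z1 \<cdot> whisker A1 (al P [] (M @ R')) Z1 =
          whisker A1 (al P [] (M @ I # R')) Z1 \<cdot> whisker A1 (al (P @ M) [] R') Z1"
        using arg_cong[OF e0, of "\<lambda>f. whisker A1 f Z1"] o len len' by (simp add: whisker_seq)
      show ?thesis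
        by (rule slide[OF e1 e2 e3 e4 e5]) (use o len len' first both in simp_all)
    next
      case (one V)
      then have o: "A1 \<in> objs" "P \<in> objs" "R \<in> objs" "V \<in> objs" "Z \<in> objs"
        and len: "Suc (length A1 + length P + length R + length V + length Z) = N"
        using AMZ first by auto
      have len': "1 \<le> length P + length R" "length P + length R < N"
        using B first one by simp_all
      have e1: "al A1 B Z1 \<cdot> insert_unit (A @ I # M) Z = al (A1 @ m (P @ I # R) # V) [] Z \<cdot>
          al A1 (P @ I # R) (V @ Z)"
        using al_insert_unit_right[of A1 "P @ I # R" V Z] o len len' first one by simp
      have e2: "al A1 B Z1 \<cdot> insert_unit A (M @ I # Z) = whisker A1 (al P [] R) (V @ I # Z) \<cdot>
          al A1 (P @ R) (V @ I # Z)"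
        using al_insert_unit_inside[of A1 P R "V @ I # Z"] o len len' first one by simp
      have e3: "al A1 (P @ I # R) (V @ Z) \<cdot> al A [] (M @ Z) = whisker A1 (al P [] R) (V @ Z) \<cdot>
          al A1 (P @ R) (V @ Z)"
        using al_nested_whisker[of A1 P "[]" R "V @ Z"] o len len' first one by simp
      have e4: "al A1 (P @ R) (V @ I # Z) \<cdot> al (A @ M) [] Z = al (A1 @ m (P @ R) # V) [] Z \<cdot>
          al A1 (P @ R) (V @ Z)"
        using al_parallel[of A1 "P @ R" V "[]" Z] o len len' first one by simp
      have e5: "al (A1 @ m (P @ I # R) # V) [] Z \<cdot> whisker A1 (al P [] R) (V @ Z) =
          whisker A1 (al P [] R) (V @ I # Z) \<cdot> al (A1 @ m (P @ R) # V) [] Z"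
        using al_natural_left[of A1 V "[]" Z "al P [] R"] o len len' by simp
      show ?thesis
        by (rule slide[OF e1 e2 e3 e4 e5]) (use o len len' first one in simp_all)
    qed
  next
    case (left N')
    note first = left
    from left(2) have "N' @ B @ Z1 = M @ I # Z"
      by simp
    then show ?thesis
    proof (cases rule: append3_eq_insert_cases)
      case (right V)
      then have o: "A \<in> objs" "N' \<in> objs" "B \<in> objs" "V \<in> objs" "Z \<in> objs"
        and len: "Suc (length A + length N' + length B + length V + length Z) = N"
        using AMZ by auto
      have e1: "al A1 B Z1 \<cdot> insert_unit (A @ I # M) Z = al (A @ I # N' @ m B # V) [] Z \<cdot>
          al (A @ I # N') B (V @ Z)"
        using al_insert_unit_right[of "A @ I # N'" B V Z] o len B first right by simp
      have e2: "al A1 B Z1 \<cdot> insert_unit A (M @ I # Z) = al A [] (N' @ m B # V @ I # Z) \<cdot>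
          al (A @ N') B (V @ I # Z)"
        using al_insert_unit_left[of A N' B "V @ I # Z"] o len B first right by simp
      have e3: "al (A @ I # N') B (V @ Z) \<cdot> al A [] (M @ Z) =
          al A [] (N' @ m B # V @ Z) \<cdot> al (A @ N') B (V @ Z)"
        using al_parallel[of A "[]" N' B "V @ Z"] o len B right by simp
      have e4: "al (A @ N') B (V @ I # Z) \<cdot> al (A @ M) [] Z =
          al (A @ N' @ m B # V) [] Z \<cdot> al (A @ N') B (V @ Z)"
        using al_parallel[of "A @ N'" B V "[]" Z] o len B right by simp
      have e5: "al (A @ I # N' @ m B # V) [] Z \<cdot> al A [] (N' @ m B # V @ Z) =
          al A [] (N' @ m B # V @ I # Z) \<cdot> al (A @ N' @ m B # V) [] Z"
        using al_parallel[of A "[]" "N' @ m B # V" "[]" Z] o len B by simp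
      show ?thesis
        by (rule slide[OF e1 e2 e3 e4 e5]) (use o len B first right in simp_all)
    next
      case (inside P R)
      then have o: "A \<in> objs" "N' \<in> objs" "P \<in> objs" "R \<in> objs" "Z1 \<in> objs"
        and len: "Suc (length A + length N' + length P + length R + length Z1) = N"
        using AMZ by auto
      have len': "1 \<le> length P + length R" "length P + length R < N"
        using B inside by simp_all
      have e1: "al A1 B Z1 \<cdot> insert_unit (A @ I # M) Z = whisker (A @ I # N') (al P [] R) Z1 \<cdot>
          al (A @ I # N') (P @ R) Z1"
        using al_insert_unit_inside[of "A @ I # N'" P R Z1] o len len' first inside by simp
      have e2: "al A1 B Z1 \<cdot> insert_unit A (M @ I # Z) = al A [] (N' @ m (P @ I # R) # Z1) \<cdot>
          al (A @ N') (P @ I # R) Z1"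
        using al_insert_unit_left[of A N' "P @ I # R" Z1] o len len' first inside by simp
      have e3: "al (A @ I # N') (P @ R) Z1 \<cdot> al A [] (M @ Z) = al A [] (N' @ m (P @ R) # Z1) \<cdot>
          al (A @ N') (P @ R) Z1"
        using al_parallel[of A "[]" N' "P @ R" Z1] o len len' inside by simp
      have e4: "al (A @ N') (P @ I # R) Z1 \<cdot> al (A @ M) [] Z = whisker (A @ N') (al P [] R) Z1 \<cdot>
          al (A @ N') (P @ R) Z1"
        using al_nested_whisker[of "A @ N'" P "[]" R Z1] o len len' inside by simp
      have e5: "whisker (A @ I # N') (al P [] R) Z1 \<cdot> al A [] (N' @ m (P @ R) # Z1) =
          al A [] (N' @ m (P @ I # R) # Z1) \<cdot> whisker (A @ N') (al P [] R) Z1"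
        using al_natural_right[of A "[]" N' Z1 "al P [] R"] o len len' by simp
      show ?thesis
        by (rule slide[OF e1 e2 e3 e4 e5]) (use o len len' first inside in simp_all)
    next
      case (left V)
      then have o: "A \<in> objs" "M \<in> objs" "V \<in> objs" "B \<in> objs" "Z1 \<in> objs"
        and len: "Suc (length A + length M + length V + length B + length Z1) = N"
        using AMZ by auto
      have e1: "al A1 B Z1 \<cdot> insert_unit (A @ I # M) Z = al (A @ I # M) [] (V @ m B # Z1) \<cdot>
          al (A @ I # M @ V) B Z1"
        using al_insert_unit_left[of "A @ I # M" V B Z1] o len B first left by simp
      have e2: "al A1 B Z1 \<cdot> insert_unit A (M @ I # Z) = al A [] (M @ I # V @ m B # Z1) \<cdot>
          al (A @ M @ I # V) B Z1"
        using al_insert_unit_left[of A "M @ I # V" B Z1] o len B first left by simp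
      have e3: "al (A @ I # M @ V) B Z1 \<cdot> al A [] (M @ Z) = al A [] (M @ V @ m B # Z1) \<cdot> al (A @ M @ V) B Z1"
        using al_parallel[of A "[]" "M @ V" B Z1] o len B left by simp
      have e4: "al (A @ M @ I # V) B Z1 \<cdot> al (A @ M) [] Z = al (A @ M) [] (V @ m B # Z1) \<cdot> al (A @ M @ V) B Z1"
        using al_parallel[of "A @ M" "[]" V B Z1] o len B left by simp
      have e5: "al (A @ I # M) [] (V @ m B # Z1) \<cdot> al A [] (M @ V @ m B # Z1) =
          al A [] (M @ I # V @ m B # Z1) \<cdot> al (A @ M) [] (V @ m B # Z1)"
        using al_parallel[of A "[]" M "[]" "V @ m B # Z1"] o len B by simp
      show ?thesis
        by (rule slide[OF e1 e2 e3 e4 e5]) (use o len B first left in simp_all)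
    qed
  qed
qed

definition al' :: "'o list \<Rightarrow> 'o list \<Rightarrow> 'o list \<Rightarrow> 'm" where
  "al' A B Z = (if B = [] \<and> length A + length Z = N then insert_unit A Z else al A B Z)"

lemma al'_parallel:
  assumes o: "A \<in> objs" "B \<in> objs" "M \<in> objs" "B' \<in> objs" "Z \<in> objs"
    and len: "length A + length B + length M + length B' + length Z \<le> Suc N"
      "length A + length M + length B' + length Z < Suc N + length B"
      "length A + length B + length M + length Z < Suc N + length B'"
      "Suc (length A + length M + length Z) < Suc N + length B"
      "Suc (length A + length M + length Z) < Suc N + length B'"
  shows "al' (A @ m B # M) B' Z \<cdot> al' A B (M @ B' @ Z) = al' A B (M @ m B' # Z) \<cdot> al' (A @ B @ M) B' Z"
proof -
  \<comment> \<open>a block with a single entry is multiplied by an identity, so new cases arise only for empty blocks\<close>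
  consider (nil_nil) "B = []" "B' = []" | (nil_one) b' where "B = []" "B' = [b']"
    | (one_nil) b where "B = [b]" "B' = []" | (nil_more) "B = []" "2 \<le> length B'"
    | (more_nil) "2 \<le> length B" "B' = []" | (other) "B \<noteq> []" "B' \<noteq> []"
    by (cases B; cases B'; cases "tl B"; cases "tl B'") auto
  then show ?thesis
  proof cases
    case nil_nil
    then show ?thesis
      using o len insert_unit_insert_unit[of A M Z] al_parallel[of A B M B' Z]
      by (cases "Suc (length A + length M + length Z) = N") (auto simp: al'_def)
  next
    case nil_one
    then show ?thesis
      using o len by (simp add: al'_def al_single)
  next
    case one_nil
    then show ?thesis
      using o len by (simp add: al'_def al_single)
  next
    case nil_more
    then have "B' \<noteq> []"
      by auto
    then show ?thesis
      using nil_more o len al_insert_unit_left[of A M B' Z] al_parallel[of A B M B' Z]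
      by (cases "length A + length M + length B' + length Z = N") (auto simp: al'_def)
  next
    case more_nil
    then have "B \<noteq> []"
      by auto
    then show ?thesis
      using more_nil o len al_insert_unit_right[of A B M Z] al_parallel[of A B M B' Z]
      by (cases "length A + length B + length M + length Z = N") (auto simp: al'_def)
  next
    case other
    then have "1 \<le> length B" "1 \<le> length B'"
      by (simp_all add: Suc_le_eq)
    then show ?thesis
      using other o len al_parallel[of A B M B' Z] by (simp add: al'_def)
  qed
qed

text \<open>
  The only new case is a unit inserted in degree \<open>N\<close> into the block \<open>P @ R\<close>. If the block is a proper one,
  the equation is a leg of \<open>insert_unit\<close>; if it is empty or the whole tuple, the other maps are identities.
\<close>

lemma al'_nested:
  assumes o: "A \<in> objs" "P \<in> objs" "Q \<in> objs" "R \<in> objs" "Z \<in> objs"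
    and len: "length A + length P + length Q + length R + length Z \<le> Suc N"
      "length A + length P + length R + length Z < Suc N + length Q"
  shows "whisker A (al' P Q R) Z \<cdot> al' A (P @ Q @ R) Z = al' A (P @ m Q # R) Z \<cdot> al' (A @ P) Q (R @ Z)"
proof -
  consider (non_nil) "1 \<le> length Q" | (low) "Q = []" "length A + length P + length R + length Z < N"
    | (top) "Q = []" "length A + length P + length R + length Z = N"
    using len(2) by (cases Q) (auto simp: less_Suc_eq)
  then show ?thesis
  proof cases
    case non_nil
    then have "Q \<noteq> []"
      by auto
    then show ?thesis
      using non_nil o len al_nested_whisker[of A P Q R Z] by (simp add: al'_def)
  next
    case low
    then show ?thesis
      using o len al_nested_whisker[of A P Q R Z] by (simp add: al'_def)
  next
    case top
    consider (empty) "P = []" "R = []" | (whole) "A = []" "Z = []" "1 \<le> length P + length R"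
      | (proper) "1 \<le> length P + length R" "length P + length R < N"
      using top by (cases P; cases R; cases A; cases Z) auto
    then show ?thesis
    proof cases
      case empty
      then show ?thesis
        using top o N_pos by (simp add: al'_def al_whole al_single)
    next
      case whole
      then show ?thesis
        using top o N_pos by (auto simp add: al'_def al_whole)
    next
      case proper
      then show ?thesis
        using top o al_insert_unit_inside[of A P R Z] by (auto simp add: al'_def)
    qed
  qed
qed

lemma unit_extension: "oplax_blocks C (Suc N) (Suc N) m ma al'"
proof
  show "Suc N \<le> Suc N" "Suc N \<le> Suc (Suc N)" "0 < Suc N"
    by simp_all
  show "m X \<in> Obj C" if "X \<in> objs" "length X \<le> Suc N" for X
    using that by simp
  show "ma F \<in> hom C (m (map (dom C) F)) (m (map (cod C) F))" if "F \<in> arrs" "length F \<le> Suc N" for F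
    using that by (rule ma_in_hom)
  show "ma (map (ident C) X) = ident C (m X)" if "X \<in> objs" "length X \<le> Suc N" for X
    using that by (rule ma_ident)
  show "ma (map2 (comp C) G F) = ma G \<cdot> ma F"
    if "F \<in> arrs" "G \<in> arrs" "map (cod C) F = map (dom C) G" "length F \<le> Suc N" for F G
    using that by (rule ma_comp)
  show "m [x] = x" if "x \<in> Obj C" for x
    using that by simp
  show "ma [f] = f" if "f \<in> Arr C" for f
    using that by simp
  show "al' A B Z \<in> hom C (m (A @ B @ Z)) (m (A @ m B # Z))"
    if "A \<in> objs" "B \<in> objs" "Z \<in> objs" "length A + length B + length Z \<le> Suc N"
      "length A + length Z < Suc N + length B" for A B Z
    using that by (cases B) (auto simp: al'_def hom_def)
  show "al' (map (cod C) F) (map (cod C) G) (map (cod C) H) \<cdot> ma (F @ G @ H) =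
      ma (F @ ma G # H) \<cdot> al' (map (dom C) F) (map (dom C) G) (map (dom C) H)"
    if "F \<in> arrs" "G \<in> arrs" "H \<in> arrs"
      "length F + length G + length H \<le> Suc N" "length F + length H < Suc N + length G" for F G H
    using that insert_unit_natural[of F H] al_natural[of F G H]
    by (cases G) (auto simp: al'_def)
  show "al' A [x] Z = ident C (m (A @ x # Z))"
    if "A \<in> objs" "x \<in> Obj C" "Z \<in> objs" "length A + length Z < Suc N" for A x Z
    using that by (simp add: al'_def al_single)
  show "al' [] B [] = ident C (m B)" if "B \<in> objs" "length B \<le> Suc N" "0 < Suc N + length B" for B
    using that N_pos by (simp add: al'_def al_whole)
  show "ma (map (ident C) A @ al' P Q R # map (ident C) Z) \<cdot> al' A (P @ Q @ R) Z =
      al' A (P @ m Q # R) Z \<cdot> al' (A @ P) Q (R @ Z)"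
    if "A \<in> objs" "P \<in> objs" "Q \<in> objs" "R \<in> objs" "Z \<in> objs"
      "length A + length P + length Q + length R + length Z \<le> Suc N"
      "length A + length P + length R + length Z < Suc N + length Q" for A P Q R Z
    using al'_nested[OF that] by (simp add: whisker_def)
qed (rule al'_parallel)

end

section \<open>Extension to all degrees\<close>

definition agree_upto :: "nat \<Rightarrow> ('o list \<Rightarrow> 'o) \<Rightarrow> ('m list \<Rightarrow> 'm) \<Rightarrow> ('o list \<Rightarrow> 'o list \<Rightarrow> 'o list \<Rightarrow> 'm) \<Rightarrow>
    ('o list \<Rightarrow> 'o) \<Rightarrow> ('m list \<Rightarrow> 'm) \<Rightarrow> ('o list \<Rightarrow> 'o list \<Rightarrow> 'o list \<Rightarrow> 'm) \<Rightarrow> bool" where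
  "agree_upto N m ma al m' ma' al' \<longleftrightarrow>
    (\<forall>X. length X \<le> N \<longrightarrow> m' X = m X) \<and> (\<forall>F. length F \<le> N \<longrightarrow> ma' F = ma F) \<and>
    (\<forall>A B Z. length A + length B + length Z \<le> N \<longrightarrow> length A + length Z < N + length B \<longrightarrow> al' A B Z = al A B Z)"

lemma oplax_blocks_cong:
  assumes "oplax_blocks C N N m ma al" "agree_upto N m ma al m' ma' al'"
  shows "oplax_blocks C N N m' ma' al'"
proof -
  interpret oplax_blocks C N N m ma al
    by fact
  have [simp]: "m' X = m X" if "length X \<le> N" for X
    using that assms(2) by (simp add: agree_upto_def)
  have [simp]: "ma' F = ma F" if "length F \<le> N" for F
    using that assms(2) by (simp add: agree_upto_def)
  have [simp]: "al' A B Z = al A B Z"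
    if "length A + length B + length Z \<le> N" "length A + length Z < N + length B" for A B Z
    using that assms(2) by (simp add: agree_upto_def)
  have [simp]: "Suc 0 \<le> N" "N \<noteq> 0"
    using bounds by simp_all
  show ?thesis
  proof
    show "0 < N"
      by (rule bounds)
    show "ma' F \<in> hom C (m' (map (dom C) F)) (m' (map (cod C) F))" if "F \<in> arrs" "length F \<le> N" for F
      using that ma_in_hom[OF that] by simp
    show "ma' (map2 (comp C) G F) = ma' G \<cdot> ma' F"
      if "F \<in> arrs" "G \<in> arrs" "map (cod C) F = map (dom C) G" "length F \<le> N" for F G
    proof -
      have "length G = length F"
        using that(3) by (metis length_map)
      then show ?thesis
        using that ma_comp[OF that] by simp
    qed
    show "al' A B Z \<in> hom C (m' (A @ B @ Z)) (m' (A @ m' B # Z))"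
      if "A \<in> objs" "B \<in> objs" "Z \<in> objs" "length A + length B + length Z \<le> N"
        "length A + length Z < N + length B" for A B Z
      using that al_in_hom[OF that] by simp
    show "al' (map (cod C) F) (map (cod C) G) (map (cod C) H) \<cdot> ma' (F @ G @ H) =
        ma' (F @ ma' G # H) \<cdot> al' (map (dom C) F) (map (dom C) G) (map (dom C) H)"
      if "F \<in> arrs" "G \<in> arrs" "H \<in> arrs"
        "length F + length G + length H \<le> N" "length F + length H < N + length G" for F G H
      using that al_natural[OF that] by simp
    show "al' (A @ m' B # M) B' Z \<cdot> al' A B (M @ B' @ Z) = al' A B (M @ m' B' # Z) \<cdot> al' (A @ B @ M) B' Z"
      if "A \<in> objs" "B \<in> objs" "M \<in> objs" "B' \<in> objs" "Z \<in> objs"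
        "length A + length B + length M + length B' + length Z \<le> N"
        "length A + length M + length B' + length Z < N + length B"
        "length A + length B + length M + length Z < N + length B'"
        "Suc (length A + length M + length Z) < N + length B"
        "Suc (length A + length M + length Z) < N + length B'" for A B M B' Z
      using that al_parallel[OF that] by simp
    show "ma' (map (ident C) A @ al' P Q R # map (ident C) Z) \<cdot> al' A (P @ Q @ R) Z =
        al' A (P @ m' Q # R) Z \<cdot> al' (A @ P) Q (R @ Z)"
      if "A \<in> objs" "P \<in> objs" "Q \<in> objs" "R \<in> objs" "Z \<in> objs"
        "length A + length P + length Q + length R + length Z \<le> N"
        "length A + length P + length R + length Z < N + length Q" for A P Q R Z
      using that al_nested[OF that] by simp
  qed (simp_all add: ma_ident al_single al_whole)
qed

text \<open>
  Cones over \<open>X\<close> involve only multiplications up to the degree of \<open>X\<close> and structure maps for nonempty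
  blocks, so they are the same before and after a step of the construction.
\<close>

lemma block_limit_cong:
  assumes "oplax_blocks C K L m ma al" "oplax_blocks C K' L' m' ma' al'"
    and m: "\<And>Y. length Y \<le> length X \<Longrightarrow> m' Y = m Y"
    and ma: "\<And>F. length F < length X \<Longrightarrow> ma' F = ma F"
    and al: "\<And>A B Z. length A + length B + length Z \<le> length X \<Longrightarrow> 1 \<le> length B \<Longrightarrow> al' A B Z = al A B Z"
  shows "oplax_blocks.block_limit C m' ma' al' X \<longleftrightarrow> oplax_blocks.block_limit C m ma al X"
proof -
  interpret O: oplax_blocks C K L m ma al
    by fact
  interpret E: oplax_blocks C K' L' m' ma' al'
    by fact
  have cone_iff: "E.block_cone X y q \<longleftrightarrow> O.block_cone X y q" for y q
  proof -
    have "m' (A @ m' B # Z) = m (A @ m B # Z)" if "X = A @ B @ Z" "2 \<le> length B" for A B Z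
      using that by (simp add: m)
    moreover have "al' (A @ m' B # M) B' Z = al (A @ m B # M) B' Z" "al' A B (M @ m' B' # Z) =
        al A B (M @ m B' # Z)"
      if "X = A @ B @ M @ B' @ Z" "2 \<le> length B" "2 \<le> length B'" for A B M B' Z
      using that by (simp_all add: m al)
    moreover have "E.whisker A (al' P Q R) Z = O.whisker A (al P Q R) Z" "al' A (P @ m' Q # R) Z =
        al A (P @ m Q # R) Z"
      if "X = A @ P @ Q @ R @ Z" "2 \<le> length Q" for A P Q R Z
      using that by (simp_all add: m al ma E.whisker_def O.whisker_def)
    ultimately show ?thesis
      unfolding E.block_cone_def O.block_cone_def by (intro conj_cong iff_allI imp_cong refl) simp_all
  qed
  have "al' A B Z = al A B Z" if "X = A @ B @ Z" "2 \<le> length B" for A B Z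
    using that by (simp add: al)
  then have "E.mediates X y q = O.mediates X y q" for y q
    unfolding E.mediates_def O.mediates_def fun_eq_iff by (simp add: m)
  then show ?thesis
    unfolding E.block_limit_def O.block_limit_def cone_iff by simp
qed

text \<open>
  One step of the construction: first the multiplication of degree \<open>N + 1\<close>, then the maps that insert
  units into tuples of degree \<open>N\<close>.
\<close>

lemma extend_blocks:
  assumes blocks: "oplax_blocks C N N m ma al"
    and lims: "has_small_limits TYPE('u) C" and inf: "infinite (UNIV :: 'u set)"
  shows "\<exists>m' ma' al'. oplax_blocks C (Suc N) (Suc N) m' ma' al' \<and> agree_upto N m ma al m' ma' al' \<and>
    (\<forall>X \<in> lists (Obj C). length X = Suc N \<longrightarrow> oplax_blocks.block_limit C m' ma' al' X)"
proof -
  interpret oplax_blocks C N N m ma al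
    by fact
  define is_lim where "is_lim X x p \<longleftrightarrow> block_cone X x p \<and>
      (\<forall>y q. block_cone X y q \<longrightarrow> (\<exists>!h. h \<in> Arr C \<and> dom C h = y \<and> cod C h = x \<and>
      (\<forall>A B Z. X = A @ B @ Z \<longrightarrow> 2 \<le> length B \<longrightarrow> length B < length X \<longrightarrow> p A B Z \<cdot> h = q A B Z)))" for X x p
  define lim where "lim X = (SOME x. \<exists>p. is_lim X x p)" for X
  define pr where "pr X = (SOME p. is_lim X (lim X) p)" for X
  have lim: "is_lim X (lim X) (pr X)" if "X \<in> objs" "length X = Suc N" for X
  proof -
    have "\<exists>x p. is_lim X x p"
      unfolding is_lim_def by (rule block_limit_exists[OF lims inf refl that])
    then have "\<exists>p. is_lim X (lim X) p"
      unfolding lim_def by (rule someI_ex)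
    then show ?thesis
      unfolding pr_def by (rule someI_ex)
  qed
  interpret limit_step C N m ma al lim pr
  proof
    fix X assume X: "X \<in> objs" "length X = Suc N"
    show "block_cone X (lim X) (pr X)"
      using lim[OF X] by (simp add: is_lim_def)
    show "\<exists>!h. h \<in> Arr C \<and> dom C h = y \<and> cod C h = lim X \<and>
        (\<forall>A B Z. X = A @ B @ Z \<longrightarrow> 2 \<le> length B \<longrightarrow> length B < length X \<longrightarrow> pr X A B Z \<cdot> h = q A B Z)"
      if "block_cone X y q" for y q
      using lim[OF X] that unfolding is_lim_def by blast
  qed
  interpret E: unit_step C N m' ma' al'
    by (intro unit_step.intro limit_extension unit_step_axioms.intro limit_extension_limit) (use bounds in auto)
  have blocks': "oplax_blocks C (Suc N) (Suc N) m' ma' E.al'"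
    by (rule E.unit_extension)
  have "agree_upto N m ma al m' ma' E.al'"
    by (auto simp: agree_upto_def E.al'_def)
  moreover have "oplax_blocks.block_limit C m' ma' E.al' X" if "X \<in> objs" "length X = Suc N" for X
  proof -
    have "E.al' A B Z = al' A B Z" if "1 \<le> length B" for A B Z
      using that by (auto simp: E.al'_def)
    then show ?thesis
      using block_limit_cong[OF limit_extension blocks' refl refl, of X] limit_extension_limit[OF that] by blast
  qed
  ultimately show ?thesis
    using blocks' by blast
qed

text \<open>
  Each step keeps what was there before, so the values at a given tuple become stationary, and every
  axiom involves only finitely many degrees.
\<close>

lemma universal_extension_exists:
  fixes C :: "('o, 'm) cat"
  assumes blocks: "oplax_blocks C K K m ma al"
    and lims: "has_small_limits TYPE('u) C" and inf: "infinite (UNIV :: 'u set)"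
  shows "\<exists>m' ma' al'. (\<forall>N \<ge> K. oplax_blocks C N N m' ma' al') \<and> agree_upto K m ma al m' ma' al' \<and>
    (\<forall>X \<in> lists (Obj C). K < length X \<longrightarrow> oplax_blocks.block_limit C m' ma' al' X)"
proof -
  define good where "good n s \<longleftrightarrow> (case s of (m', ma', al') \<Rightarrow> oplax_blocks C (K + n) (K + n) m' ma' al' \<and>
      (n = 0 \<longrightarrow> s = (m, ma, al)) \<and>
      (\<forall>X \<in> lists (Obj C). 0 < n \<and> length X = K + n \<longrightarrow> oplax_blocks.block_limit C m' ma' al' X))" for n
          and s :: "('o list \<Rightarrow> 'o) \<times> ('m list \<Rightarrow> 'm) \<times> ('o list \<Rightarrow> 'o list \<Rightarrow> 'o list \<Rightarrow> 'm)"
  define ext where "ext n s s' \<longleftrightarrow> (case s of (m1, ma1, al1) \<Rightarrow> case s' of (m2, ma2, al2) \<Rightarrow>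
      agree_upto (K + n) m1 ma1 al1 m2 ma2 al2)" for n
    and s s' :: "('o list \<Rightarrow> 'o) \<times> ('m list \<Rightarrow> 'm) \<times> ('o list \<Rightarrow> 'o list \<Rightarrow> 'o list \<Rightarrow> 'm)"
  have "\<exists>f. \<forall>n. good n (f n) \<and> ext n (f n) (f (Suc n))"
  proof (rule dependent_nat_choice)
    show "\<exists>s. good 0 s"
      using blocks by (auto simp: good_def)
    fix s n assume "good n s"
    then obtain m1 ma1 al1 where s: "s = (m1, ma1, al1)" "oplax_blocks C (K + n) (K + n) m1 ma1 al1"
      by (auto simp: good_def)
    from extend_blocks[OF s(2) lims inf] obtain m2 ma2 al2 where
      "oplax_blocks C (Suc (K + n)) (Suc (K + n)) m2 ma2 al2" "agree_upto (K + n) m1 ma1 al1 m2 ma2 al2"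
      "\<forall>X \<in> lists (Obj C). length X = Suc (K + n) \<longrightarrow> oplax_blocks.block_limit C m2 ma2 al2 X"
      by blast
    then show "\<exists>s'. good (Suc n) s' \<and> ext n s s'"
      by (intro exI[of _ "(m2, ma2, al2)"]) (simp add: good_def ext_def s(1))
  qed
  then obtain f where f: "\<And>n. good n (f n)" "\<And>n. ext n (f n) (f (Suc n))"
    by blast
  define mf where "mf n = fst (f n)" for n
  define af where "af n = fst (snd (f n))" for n
  define lf where "lf n = snd (snd (f n))" for n
  have f_eq: "f n = (mf n, af n, lf n)" for n
    by (simp add: mf_def af_def lf_def)
  have blocks_n: "oplax_blocks C (K + n) (K + n) (mf n) (af n) (lf n)" for n
    using f(1)[of n] by (simp add: f_eq good_def)
  have base: "mf 0 = m" "af 0 = ma" "lf 0 = al"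
    using f(1)[of 0] by (simp_all add: f_eq good_def)
  have limit_n: "oplax_blocks.block_limit C (mf n) (af n) (lf n) X" if "X \<in> lists (Obj C)" "0 < n" "length X =
      K + n" for n X
    using f(1)[of n] that by (simp add: f_eq good_def)
  have agree_Suc: "agree_upto (K + n) (mf n) (af n) (lf n) (mf (Suc n)) (af (Suc n)) (lf (Suc n))" for n
    using f(2)[of n] by (simp add: f_eq ext_def)
  have agree: "agree_upto (K + n) (mf n) (af n) (lf n) (mf (n + k)) (af (n + k)) (lf (n + k))" for n k
  proof (induction k)
    case 0
    then show ?case
      by (simp add: agree_upto_def)
  next
    case (Suc k)
    then show ?case
      using agree_Suc[of "n + k"] by (simp add: agree_upto_def)
  qed
  define M where "M X = mf (length X) X" for X
  define MA where "MA F = af (length F) F" for F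
  \<comment> \<open>one stage later than for \<open>M\<close>, so that the source and the target are in the range of the stage\<close>
  define AL where "AL A B Z = lf (Suc (length A + length B + length Z)) A B Z" for A B Z
  have agree_lim: "agree_upto (K + n) (mf n) (af n) (lf n) M MA AL" for n
    unfolding agree_upto_def
  proof (intro conjI allI impI)
    fix X :: "'o list" assume *: "length X \<le> K + n"
    show "M X = mf n X"
    proof (cases "n \<le> length X")
      case True
      then show ?thesis
        using agree[of n "length X - n"] * by (simp add: agree_upto_def M_def)
    next
      case False
      then show ?thesis
        using agree[of "length X" "n - length X"] * by (simp add: agree_upto_def M_def)
    qed
  next
    fix F :: "'m list" assume *: "length F \<le> K + n"
    show "MA F = af n F"
    proof (cases "n \<le> length F")
      case True
      then show ?thesis
        using agree[of n "length F - n"] * by (simp add: agree_upto_def MA_def)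
    next
      case False
      then show ?thesis
        using agree[of "length F" "n - length F"] * by (simp add: agree_upto_def MA_def)
    qed
  next
    fix A B Z :: "'o list"
    assume *: "length A + length B + length Z \<le> K + n" "length A + length Z < K + n + length B"
    define k where "k = Suc (length A + length B + length Z)"
    have AL: "AL A B Z = lf k A B Z"
      by (simp add: AL_def k_def)
    have k: "length A + length B + length Z \<le> K + k" "length A + length Z < K + k + length B"
      by (simp_all add: k_def)
    show "AL A B Z = lf n A B Z"
    proof (cases "n \<le> k")
      case True
      then show ?thesis
        using agree[of n "k - n"] * AL by (simp add: agree_upto_def)
    next
      case False
      then show ?thesis
        using agree[of k "n - k"] k AL by (simp add: agree_upto_def)
    qed
  qed
  have blocks_lim: "oplax_blocks C (K + n) (K + n) M MA AL" for n
    using oplax_blocks_cong[OF blocks_n agree_lim] .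
  have "oplax_blocks C N N M MA AL" if "K \<le> N" for N
    using blocks_lim[of "N - K"] that by simp
  moreover have "agree_upto K m ma al M MA AL"
    using agree_lim[of 0] by (simp add: base)
  moreover have "oplax_blocks.block_limit C M MA AL X" if "X \<in> lists (Obj C)" "K < length X" for X
  proof -
    define n where "n = length X - K"
    have n: "length X = K + n" "0 < n"
      using that(2) by (simp_all add: n_def)
    show ?thesis
      using block_limit_cong[OF blocks_n[of n] blocks_lim[of n], of X] agree_lim[of n] limit_n[OF that(1)
          n(2,1)] n(1)
      by (simp add: agree_upto_def)
  qed
  ultimately show ?thesis
    by blast
qed

section \<open>Translation to and from the indexed form\<close>

lemma plug_append [simp]: "length A = l \<Longrightarrow> length B = r \<Longrightarrow> plug l r u (A @ B @ Z) = A @ u B # Z"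
  by (simp add: plug_def)

lemma plug_arr_append [simp]: "length A = l \<Longrightarrow> length B = r \<Longrightarrow>
    plug_arr C l r \<tau> (A @ B @ Z) = map (ident C) A @ \<tau> B # map (ident C) Z"
  by (simp add: plug_arr_def)

text \<open>
  The block form of a structure given by indexed functors: the index is the length of the tuple.
\<close>

definition block_mult :: "('o, 'm) oplax_data \<Rightarrow> 'o list \<Rightarrow> 'o" where
  "block_mult S X = fobj (mult S (length X)) X"

definition block_mult_arr :: "('o, 'm) oplax_data \<Rightarrow> 'm list \<Rightarrow> 'm" where
  "block_mult_arr S F = farr (mult S (length F)) F"

definition block_assoc :: "('o, 'm) oplax_data \<Rightarrow> 'o list \<Rightarrow> 'o list \<Rightarrow> 'o list \<Rightarrow> 'm" where
  "block_assoc S A B Z = oassoc S (length A + length B + length Z) (length A) (length B) (A @ B @ Z)"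

text \<open>
  The hypothesis on \<open>D\<close> only asks for the structure maps whose source and target have degree at most
  \<open>N\<close>. In this form the result applies to complete structures, for all \<open>N\<close>, and to the given partial data, for
  \<open>N = 3\<close>.
\<close>

lemma blocks_of_partial_oplax:
  fixes C :: "('o, 'm) cat"
  assumes "partial_oplax C M D S"
    and N: "0 < N" and M: "\<And>n. n \<le> N \<Longrightarrow> M n"
    and D: "\<And>n l r. l + r \<le> n \<Longrightarrow> n \<le> N \<Longrightarrow> n - r < N \<Longrightarrow> D n l r"
  shows "oplax_blocks C N N (block_mult S) (block_mult_arr S) (block_assoc S)"
proof -
  interpret partial_oplax C M D S
    by fact
  have fn: "cat_functor (power_cat C n) C (mult S n)" if "n \<le> N" for n
    using mult_functor[OF M[OF that]] .
  have nt: "nat_trans (power_cat C n) C (mult S n) (plug_ftor l r (mult S (n - r + 1)) (mult S r)) (oassoc S n l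
      r)"
    if "l + r \<le> n" "n \<le> N" "n - r < N" for n l r
    using that by (intro oassoc_nat_trans D M) simp_all
  show ?thesis
  proof
    show "N \<le> N" "N \<le> Suc N" "0 < N"
      using N by simp_all
    show "block_mult S X \<in> Obj C" if "X \<in> objs" "length X \<le> N" for X
      using cat_functor.fobj_in_Obj[OF fn[OF that(2)], of X] that(1) by (simp add: block_mult_def Obj_power_cat)
    show "block_mult_arr S F \<in> hom C (block_mult S (map (dom C) F)) (block_mult S (map (cod C) F))"
      if "F \<in> arrs" "length F \<le> N" for F
      using cat_functor.farr_in_hom[OF fn[OF that(2)], of F "map (dom C) F" "map (cod C) F"] that(1)
      by (simp add: block_mult_def block_mult_arr_def hom_power_cat)
    show "block_mult_arr S (map (ident C) X) = ident C (block_mult S X)" if "X \<in> objs" "length X \<le> N" for X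
      using cat_functor.farr_ident[OF fn[OF that(2)], of X] that(1)
      by (simp add: block_mult_def block_mult_arr_def Obj_power_cat)
    show "block_mult_arr S (map2 (comp C) G F) = block_mult_arr S G \<cdot> block_mult_arr S F"
      if "F \<in> arrs" "G \<in> arrs" "map (cod C) F = map (dom C) G" "length F \<le> N" for F G
    proof -
      have "length G = length F"
        using that(3) by (metis length_map)
      then show ?thesis
        using cat_functor.farr_comp[OF fn[OF that(4)], of F "map (dom C) F"
            "map (cod C) F" G "map (cod C) G"] that(1-3)
        by (simp add: block_mult_def block_mult_arr_def hom_power_cat)
    qed
    show "block_mult S [x] = x" if "x \<in> Obj C" for x
      using mult_1_obj M[of 1] N that by (simp add: block_mult_def)
    show "block_mult_arr S [f] = f" if "f \<in> Arr C" for f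
      using mult_1_arr M[of 1] N that by (simp add: block_mult_arr_def)
    show "block_assoc S A B Z \<in> hom C (block_mult S (A @ B @ Z)) (block_mult S (A @ block_mult S B # Z))"
      if "A \<in> objs" "B \<in> objs" "Z \<in> objs" "length A + length B + length Z \<le> N"
        "length A + length Z < N + length B" for A B Z
    proof -
      have "length A + length Z < N"
        using that(4,5) by linarith
      then show ?thesis
        using nat_trans.component_in_hom[OF nt[of "length A" "length B" "length A + length B + length Z"], of "A
            @ B @ Z"] that
        by (simp add: block_mult_def block_assoc_def Obj_power_cat plug_ftor_def add.assoc)
    qed
    show "block_assoc S (map (cod C) F) (map (cod C) G) (map (cod C) H) \<cdot> block_mult_arr S (F @ G @ H) =
        block_mult_arr S (F @ block_mult_arr S G # H) \<cdot> block_assoc S (map (dom C) F) (map (dom C) G)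
            (map (dom C) H)"
      if "F \<in> arrs" "G \<in> arrs" "H \<in> arrs" "length F + length G + length H \<le> N"
        "length F + length H < N + length G" for F G H
    proof -
      have "length F + length H < N"
        using that(4,5) by linarith
      then show ?thesis
        using nat_trans.naturality[OF nt[of "length F" "length G" "length F + length G + length H"], of "F @ G @
            H"
            "map (dom C) (F @ G @ H)" "map (cod C) (F @ G @ H)"] that
        by (simp add: block_mult_arr_def block_assoc_def hom_power_cat plug_ftor_def add.assoc)
    qed
    show "block_assoc S A [x] Z = ident C (block_mult S (A @ x # Z))"
      if "A \<in> objs" "x \<in> Obj C" "Z \<in> objs" "length A + length Z < N" for A x Z
      using oassoc_1[of "length A" "length A + 1 + length Z" "A @ x # Z"] that
      by (simp add: block_assoc_def block_mult_def M D Obj_power_cat)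
    show "block_assoc S [] B [] = ident C (block_mult S B)"
      if "B \<in> objs" "length B \<le> N" "0 < N + length B" for B
      using oassoc_n[of "length B" B] that N
      by (simp add: block_assoc_def block_mult_def M D Obj_power_cat)
    show "block_assoc S (A @ block_mult S B # M') B' Z \<cdot> block_assoc S A B (M' @ B' @ Z) =
        block_assoc S A B (M' @ block_mult S B' # Z) \<cdot> block_assoc S (A @ B @ M') B' Z"
      if o: "A \<in> objs" "B \<in> objs" "M' \<in> objs" "B' \<in> objs" "Z \<in> objs" and len:
        "length A + length B + length M' + length B' + length Z \<le> N"
        "length A + length M' + length B' + length Z < N + length B"
        "length A + length B + length M' + length Z < N + length B'"
        "Suc (length A + length M' + length Z) < N + length B"
        "Suc (length A + length M' + length Z) < N + length B'" for A B M' B' Z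
    proof -
      let ?n = "length A + length B + length M' + length B' + length Z"
      have len': "length A + length M' + length B' + length Z < N"
          "length A + length B + length M' + length Z < N"
        "Suc (length A + length M' + length Z) < N" "length B \<le> N" "length B' \<le> N"
        using len by linarith+
      have [simp]: "?n - length B = length A + length M' + length B' + length Z"
        "?n - length B' = length A + length B + length M' + length Z"
        "length A + length B + length M' - length B = length A + length M'"
        by simp_all
      have "oassoc S (?n - length B + 1) (length A + length B + length M' - length B + 1) (length B')
              (plug (length A) (length B) (fobj (mult S (length B))) (A @ B @ (M' @ B' @ Z))) \<cdot>
            oassoc S ?n (length A) (length B) (A @ B @ (M' @ B' @ Z)) =
          oassoc S (?n - length B' + 1) (length A) (length B)
              (plug (length A + length B + length M') (length B') (fobj (mult S (length B'))) ((A @ B @ M') @ B'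
                  @ Z)) \<cdot>
            oassoc S ?n (length A + length B + length M') (length B') (A @ B @ (M' @ B' @ Z))"
        using oassoc_parallel[of "length A" "length B" "length A + length B + length M'"
            "length B'" ?n "A @ B @ M' @ B' @ Z"]
          o len' len(1) by (simp add: M D Obj_power_cat)
      then show ?thesis
        using plug_append[of "A @ B @ M'" _ B' _ "fobj (mult S (length B'))" Z, OF refl refl]
        by (simp add: block_assoc_def block_mult_def add_ac)
    qed
    show "block_mult_arr S (map (ident C) A @ block_assoc S P Q R # map (ident C) Z) \<cdot>
        block_assoc S A (P @ Q @ R) Z =
        block_assoc S A (P @ block_mult S Q # R) Z \<cdot> block_assoc S (A @ P) Q (R @ Z)"
      if o: "A \<in> objs" "P \<in> objs" "Q \<in> objs" "R \<in> objs" "Z \<in> objs" and len: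
        "length A + length P + length Q + length R + length Z \<le> N"
        "length A + length P + length R + length Z < N + length Q" for A P Q R Z
    proof -
      let ?n = "length A + length P + length Q + length R + length Z"
      let ?r = "length P + length Q + length R"
      have len': "length A + length P + length R + length Z < N" "length A + length Z < N"
          "length P + length R < N"
        "length Q \<le> N"
        using len by linarith+
      have [simp]: "?n - ?r = length A + length Z" "?n - length Q = length A + length P + length R + length Z"
        "?r - length Q = length P + length R" "length A + length P - length A = length P"
        by simp_all
      have "farr (mult S (?n - ?r + 1)) (plug_arr C (length A) ?r (oassoc S ?r (length A + length P - length A)
          (length Q)) (A @ (P @ Q @ R) @ Z)) \<cdot>
            oassoc S ?n (length A) ?r (A @ (P @ Q @ R) @ Z) =
          oassoc S (?n - length Q + 1) (length A) (?r - length Q + 1)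
              (plug (length A + length P) (length Q) (fobj (mult S (length Q))) ((A @ P) @ Q @ (R @ Z))) \<cdot>
            oassoc S ?n (length A + length P) (length Q) ((A @ P) @ Q @ (R @ Z))"
        using oassoc_nested[of "length A" "length A + length P" "length Q" ?r ?n "A @ P @ Q @ R @ Z"]
          o len' len(1) by (simp add: M D Obj_power_cat)
      then show ?thesis
        using plug_append[of "A @ P" _ Q _ "fobj (mult S (length Q))" "R @ Z", OF refl refl]
          plug_arr_append[of A _ "P @ Q @ R" _ C _ Z, OF refl refl]
        by (simp add: block_mult_arr_def block_assoc_def block_mult_def add_ac)
    qed
  qed
qed

definition oplax_of_blocks :: "('o list \<Rightarrow> 'o) \<Rightarrow> ('m list \<Rightarrow> 'm) \<Rightarrow> ('o list \<Rightarrow> 'o list \<Rightarrow> 'o list \<Rightarrow> 'm) \<Rightarrow>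
    ('o, 'm) oplax_data" where
  "oplax_of_blocks m ma al =
    \<lparr> unit_obj = m [],
      mult = \<lambda>n. \<lparr> fobj = m, farr = ma \<rparr>,
      oassoc = \<lambda>n l r X. al (take l X) (take r (drop l X)) (drop (l + r) X) \<rparr>"

lemma oplax_of_blocks_simps [simp]:
  "unit_obj (oplax_of_blocks m ma al) = m []"
  "fobj (mult (oplax_of_blocks m ma al) n) = m"
  "farr (mult (oplax_of_blocks m ma al) n) = ma"
  "oassoc (oplax_of_blocks m ma al) n l r X = al (take l X) (take r (drop l X)) (drop (l + r) X)"
  by (simp_all add: oplax_of_blocks_def)

lemma block_oplax_of_blocks [simp]:
  "block_mult (oplax_of_blocks m ma al) = m"
  "block_mult_arr (oplax_of_blocks m ma al) = ma"
  "block_assoc (oplax_of_blocks m ma al) = al"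
  by (simp_all add: fun_eq_iff block_mult_def block_mult_arr_def block_assoc_def)

lemma split_block:
  assumes "l + r \<le> length X"
  obtains A B Z where "X = A @ B @ Z" "length A = l" "length B = r"
  using that[of "take l X" "take r (drop l X)" "drop (l + r) X"] assms
  by (simp add: add.commute[of l r] flip: drop_drop)

lemma normal_oplax_of_blocks:
  fixes C :: "('o, 'm) cat"
  assumes blocks: "\<And>N. 3 \<le> N \<Longrightarrow> oplax_blocks C N N m ma al"
  shows "normal_oplax C (oplax_of_blocks m ma al)"
proof -
  interpret category C
    using blocks[of 3] by (simp add: oplax_blocks_def)
  let ?S = "oplax_of_blocks m ma al"
  have b: "oplax_blocks C (n + 3) (n + 3) m ma al" for n
    using blocks by simp
  have fn: "cat_functor (power_cat C n) C (mult ?S n)" for n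
  proof -
    interpret oplax_blocks C "n + 3" "n + 3" m ma al
      by (rule b)
    interpret power: category "power_cat C n"
      by (rule power_cat_category)
    show ?thesis
      by unfold_locales (auto simp: Obj_power_cat hom_power_cat ma_ident ma_comp simp del: in_lists_conv_set
          intro!: ma_in_hom)
  qed
  have pf: "cat_functor (power_cat C n) C (plug_ftor l r (mult ?S (n - r + 1)) (mult ?S r))"
    if "l + r \<le> n" for n l r
  proof -
    interpret oplax_blocks C "n + 3" "n + 3" m ma al
      by (rule b)
    interpret power: category "power_cat C n"
      by (rule power_cat_category)
    show ?thesis
    proof
      show "fobj (plug_ftor l r (mult ?S (n - r + 1)) (mult ?S r)) X \<in> Obj C" if "X \<in> Obj (power_cat C n)" for X
      proof -
        obtain A B Z where "X = A @ B @ Z" "length A = l" "length B = r"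
          using \<open>l + r \<le> n\<close> \<open>X \<in> Obj (power_cat C n)\<close> split_block[of l r X] by (auto simp: Obj_power_cat)
        then show ?thesis
          using that by (simp add: Obj_power_cat plug_ftor_def)
      qed
      show "farr (plug_ftor l r (mult ?S (n - r + 1)) (mult ?S r)) f \<in>
          hom C (fobj (plug_ftor l r (mult ?S (n - r + 1)) (mult ?S r)) X)
              (fobj (plug_ftor l r (mult ?S (n - r + 1)) (mult ?S r)) Y)"
        if f: "f \<in> hom (power_cat C n) X Y" for f X Y
      proof -
        obtain F G H where "f = F @ G @ H" "length F = l" "length G = r"
          using \<open>l + r \<le> n\<close> f split_block[of l r f] by (auto simp: hom_power_cat)
        then show ?thesis
          using that ma_in_hom[of "F @ ma G # H"] by (auto simp: hom_power_cat plug_ftor_def simp del: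
              in_lists_conv_set)
      qed
      show "farr (plug_ftor l r (mult ?S (n - r + 1)) (mult ?S r)) (ident (power_cat C n) X) =
          ident C (fobj (plug_ftor l r (mult ?S (n - r + 1)) (mult ?S r)) X)" if "X \<in> Obj (power_cat C n)" for X
      proof -
        obtain A B Z where "X = A @ B @ Z" "length A = l" "length B = r"
          using \<open>l + r \<le> n\<close> \<open>X \<in> Obj (power_cat C n)\<close> split_block[of l r X] by (auto simp: Obj_power_cat)
        then show ?thesis
          using that ma_ident[of "A @ m B # Z"] by (simp add: Obj_power_cat plug_ftor_def ma_ident)
      qed
      show "farr (plug_ftor l r (mult ?S (n - r + 1)) (mult ?S r)) (comp (power_cat C n) g f) =
          farr (plug_ftor l r (mult ?S (n - r + 1)) (mult ?S r)) g \<cdot> farr (plug_ftor l r (mult ?S (n - r + 1))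
              (mult ?S r)) f"
        if fg: "f \<in> hom (power_cat C n) X Y" "g \<in> hom (power_cat C n) Y Z" for f g X Y Z
      proof -
        obtain F1 F2 F3 where F: "f = F1 @ F2 @ F3" "length F1 = l" "length F2 = r"
          using \<open>l + r \<le> n\<close> fg(1) split_block[of l r f] by (auto simp: hom_power_cat)
        obtain G1 G2 G3 where G: "g = G1 @ G2 @ G3" "length G1 = l" "length G2 = r"
          using \<open>l + r \<le> n\<close> fg(2) split_block[of l r g] by (auto simp: hom_power_cat)
        have l3: "length F3 = length G3"
          using F G that by (simp add: hom_power_cat)
        have "map (cod C) f = map (dom C) g"
          using that by (simp add: hom_power_cat)
        then have cd: "map (cod C) F1 = map (dom C) G1" "map (cod C) F2 = map (dom C) G2" "map (cod C) F3 =
            map (dom C) G3"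
          using F G by simp_all
        have o: "F1 \<in> arrs" "F2 \<in> arrs" "F3 \<in> arrs" "G1 \<in> arrs" "G2 \<in> arrs" "G3 \<in> arrs"
          and len: "length F1 + length F2 + length F3 = n"
          using that F(1) G(1) by (simp_all add: hom_power_cat)
        have "ma (map2 (comp C) (G1 @ ma G2 # G3) (F1 @ ma F2 # F3)) =
            ma (G1 @ ma G2 # G3) \<cdot> ma (F1 @ ma F2 # F3)"
          using o cd len F G by (intro ma_comp) simp_all
        moreover have "ma (map2 (comp C) G2 F2) = ma G2 \<cdot> ma F2"
          using o cd len by (intro ma_comp) simp_all
        ultimately show ?thesis
          using F G l3 by (simp add: plug_ftor_def)
      qed
    qed
  qed
  interpret B3: oplax_blocks C 3 3 m ma al
    using blocks by simp
  have "partial_oplax C (\<lambda>_. True) (\<lambda>_ _ _. True) ?S"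
  proof (intro partial_oplax.intro partial_oplax_axioms.intro)
    show "category C"
      by (rule category_axioms)
    show "unit_obj ?S \<in> Obj C" "fobj (mult ?S 0) [] = unit_obj ?S"
      by simp_all
    show "x \<in> Obj C \<Longrightarrow> fobj (mult ?S 1) [x] = x" for x
      by simp
    show "f \<in> Arr C \<Longrightarrow> farr (mult ?S 1) [f] = f" for f
      by simp
    show "cat_functor (power_cat C n) C (mult ?S n)" for n
      by (rule fn)
    show "nat_trans (power_cat C n) C (mult ?S n) (plug_ftor l r (mult ?S (n - r + 1)) (mult ?S r)) (oassoc ?S n
        l r)"
      if "l + r \<le> n" for l r n
    proof -
      interpret oplax_blocks C "n + 3" "n + 3" m ma al
        by (rule b)
      interpret F: cat_functor "power_cat C n" C "mult ?S n"
        by (rule fn)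
      interpret G: cat_functor "power_cat C n" C "plug_ftor l r (mult ?S (n - r + 1)) (mult ?S r)"
        by (rule pf[OF that])
      show ?thesis
      proof
        show "oassoc ?S n l r X \<in> hom C (fobj (mult ?S n) X) (fobj (plug_ftor l r (mult ?S (n - r + 1))
            (mult ?S r)) X)"
          if "X \<in> Obj (power_cat C n)" for X
        proof -
          obtain A B Z where "X = A @ B @ Z" "length A = l" "length B = r"
            using \<open>l + r \<le> n\<close> \<open>X \<in> Obj (power_cat C n)\<close> split_block[of l r X] by (auto simp: Obj_power_cat)
          then show ?thesis
            using that al_in_hom[of A B Z] by (simp add: Obj_power_cat plug_ftor_def)
        qed
        show "oassoc ?S n l r Y \<cdot> farr (mult ?S n) f =
            farr (plug_ftor l r (mult ?S (n - r + 1)) (mult ?S r)) f \<cdot> oassoc ?S n l r X"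
          if f: "f \<in> hom (power_cat C n) X Y" for f X Y
        proof -
          obtain F G H where F: "f = F @ G @ H" "length F = l" "length G = r"
            using \<open>l + r \<le> n\<close> f split_block[of l r f] by (auto simp: hom_power_cat)
          have "X = map (dom C) f" "Y = map (cod C) f" "f \<in> arrs" "length f = n"
            using that by (simp_all add: hom_power_cat)
          then show ?thesis
            using F al_natural[of F G H] by (simp add: plug_ftor_def)
        qed
      qed
    qed
    show "oassoc ?S n l 1 X = ident C (fobj (mult ?S n) X)" if asm: "l + 1 \<le> n"
        "X \<in> Obj (power_cat C n)" for l n X
    proof -
      interpret oplax_blocks C "n + 3" "n + 3" m ma al
        by (rule b)
      obtain A B Z where X: "X = A @ B @ Z" "length A = l" "length B = 1"
        using asm split_block[of l 1 X] by (auto simp: Obj_power_cat)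
      then obtain x where "B = [x]"
        by (auto simp: length_Suc_conv)
      then show ?thesis
        using X that al_single[of A x Z] by (simp add: Obj_power_cat)
    qed
    show "oassoc ?S n 0 n X = ident C (fobj (mult ?S n) X)" if "X \<in> Obj (power_cat C n)" for n X
    proof -
      interpret oplax_blocks C "n + 3" "n + 3" m ma al
        by (rule b)
      show ?thesis
        using that al_whole[of X] by (simp add: Obj_power_cat)
    qed
    show "oassoc ?S (n - r + 1) (k - r + 1) s (plug l r (fobj (mult ?S r)) X) \<cdot> oassoc ?S n l r X =
        oassoc ?S (n - s + 1) l r (plug k s (fobj (mult ?S s)) X) \<cdot> oassoc ?S n k s X"
      if asm: "l + r \<le> k" "k + s \<le> n" "X \<in> Obj (power_cat C n)" for l r k s n X
    proof -
      interpret oplax_blocks C "n + 3" "n + 3" m ma al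
        by (rule b)
      obtain A B X' where 1: "X = A @ B @ X'" "length A = l" "length B = r"
        using asm split_block[of l r X] by (auto simp: Obj_power_cat)
      have lX: "length X' = n - l - r"
        using 1 that by (auto simp: Obj_power_cat)
      have "k - l - r + s \<le> length X'"
        using asm(1,2) lX by linarith
      then obtain M B' Z where 2: "X' = M @ B' @ Z" "length M = k - l - r" "length B' = s"
        by (rule split_block)
      have k: "k = length A + length B + length M"
        using 1(2,3) 2(2) asm(1) by linarith
      note 1 = 1[unfolded 2(1)]
      have p2: "plug k s m X = A @ B @ M @ m B' # Z"
        using plug_append[of "A @ B @ M" k B' s m Z] 1(1) 2(3) k by simp
      have t2: "take k X = A @ B @ M" "take s (drop k X) = B'" "drop (k + s) X = Z"
        using 1(1) 2(3) k by simp_all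
      show ?thesis
        unfolding oplax_of_blocks_simps p2 t2
        using 1 2(3) k that(2,3) al_parallel[of A B M B' Z]
            by (auto simp: Obj_power_cat simp del: in_lists_conv_set)
    qed
    show "farr (mult ?S (n - r + 1)) (plug_arr C l r (oassoc ?S r (k - l) s) X) \<cdot> oassoc ?S n l r X =
        oassoc ?S (n - s + 1) l (r - s + 1) (plug k s (fobj (mult ?S s)) X) \<cdot> oassoc ?S n k s X"
      if asm: "l \<le> k" "k + s \<le> l + r" "l + r \<le> n" "X \<in> Obj (power_cat C n)" for l k s r n X
    proof -
      interpret oplax_blocks C "n + 3" "n + 3" m ma al
        by (rule b)
      obtain A B Z where 1: "X = A @ B @ Z" "length A = l" "length B = r"
        using asm split_block[of l r X] by (auto simp: Obj_power_cat)
      have "k - l + s \<le> length B"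
        using asm(1,2) 1(3) by linarith
      then obtain P Q R where 2: "B = P @ Q @ R" "length P = k - l" "length Q = s"
        by (rule split_block)
      have k: "k = length A + length P"
        using 1(2) 2(2) asm(1) by linarith
      have r: "r = length P + length Q + length R" "r - s + 1 = length (P @ m Q # R)"
        using 1(3) 2(1,3) by auto
      note 1 = 1[unfolded 2(1)]
      have p2: "plug k s m X = A @ P @ m Q # R @ Z"
        using plug_append[of "A @ P" k Q s m "R @ Z"] 1(1) 2(3) k by simp
      have t2: "take k X = A @ P" "take s (drop k X) = Q" "drop (k + s) X = R @ Z"
        using 1(1) 2(3) k by simp_all
      have pa: "plug_arr C l r (oassoc ?S r (k - l) s) X = map (ident C) A @ al P Q R # map (ident C) Z"
        using 1(1,2) 2(3) k r(1) by (simp add: plug_arr_def)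
      show ?thesis
        unfolding pa oplax_of_blocks_simps p2 t2 r(2)
        using 1(1,2) 2(3) r(1) that(4) al_nested[of A P Q R Z]
            by (auto simp: Obj_power_cat simp del: in_lists_conv_set)
    qed
  qed
  then show ?thesis
    by (simp add: normal_oplax_def)
qed

section \<open>Comparison with a structure of limits\<close>

text \<open>
  A morphism in degrees at most \<open>N\<close> between structures that are defined up to some degree \<open>K\<close>, which is
  kept independent of \<open>N\<close> since the step to degree \<open>N + 1\<close> uses both structures in that degree.
\<close>

locale comparison = category C + S: oplax_blocks C K K mS maS alS + T: oplax_blocks C K K mT maT alT
  for C :: "('o, 'm) cat" and K mS maS alS mT maT alT +
  fixes N :: nat and t :: "'o list \<Rightarrow> 'm"
  assumes N_le: "N \<le> K"
    and t_in_hom: "X \<in> objs \<Longrightarrow> length X \<le> N \<Longrightarrow> t X \<in> hom C (mS X) (mT X)"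
    and t_natural: "F \<in> arrs \<Longrightarrow> length F \<le> N \<Longrightarrow> t (map (cod C) F) \<cdot> maS F = maT F \<cdot> t (map (dom C) F)"
    and t_empty: "t [] = ident C (mS [])"
    and t_single: "x \<in> Obj C \<Longrightarrow> t [x] = ident C x"
    and t_compat: "A \<in> objs \<Longrightarrow> B \<in> objs \<Longrightarrow> Z \<in> objs \<Longrightarrow> length A + length B + length Z \<le> N \<Longrightarrow>
      length A + length Z < N + length B \<Longrightarrow>
      alT A B Z \<cdot> t (A @ B @ Z) = (T.whisker A (t B) Z \<cdot> t (A @ mS B # Z)) \<cdot> alS A B Z"
begin

lemma
  assumes "X \<in> objs" "length X \<le> N"
  shows t_Arr [simp]: "t X \<in> Arr C"
    and dom_t [simp]: "dom C (t X) = mS X"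
    and cod_t [simp]: "cod C (t X) = mT X"
  using t_in_hom[OF assms] by (auto simp: hom_def)

lemma unit_eq: "mT [] = mS []"
  using cod_t[of "[]"] by (simp add: t_empty)

text \<open>
  Compatibility of \<open>t\<close> with the structure maps is the equation
  \<open>alT A B Z \<cdot> t (A @ B @ Z) = t_block A B Z \<cdot> alS A B Z\<close>.
\<close>

definition t_block :: "'o list \<Rightarrow> 'o list \<Rightarrow> 'o list \<Rightarrow> 'm" where
  "t_block A B Z = T.whisker A (t B) Z \<cdot> t (A @ mS B # Z)"

lemma
  assumes "A \<in> objs" "B \<in> objs" "Z \<in> objs" "length A + length Z < N" "length B \<le> N"
  shows t_block_Arr [simp]: "t_block A B Z \<in> Arr C"
    and dom_t_block [simp]: "dom C (t_block A B Z) = mS (A @ mS B # Z)"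
    and cod_t_block [simp]: "cod C (t_block A B Z) = mT (A @ mT B # Z)"
  using assms N_le by (simp_all add: t_block_def)

lemma compat: "A \<in> objs \<Longrightarrow> B \<in> objs \<Longrightarrow> Z \<in> objs \<Longrightarrow> length A + length B + length Z \<le> N \<Longrightarrow>
    length A + length Z < N + length B \<Longrightarrow> alT A B Z \<cdot> t (A @ B @ Z) = t_block A B Z \<cdot> alS A B Z"
  using t_compat by (simp add: t_block_def)

lemma t_block_empty:
  assumes "A \<in> objs" "Z \<in> objs" "length A + length Z < N"
  shows "t_block A [] Z = t (A @ mS [] # Z)"
  using assms N_le by (simp add: t_block_def t_empty unit_eq)

lemma t_whisker:
  assumes "A \<in> objs" "Z \<in> objs" "f \<in> Arr C" "dom C f = x" "cod C f = y" "length A + length Z < N"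
  shows "t (A @ y # Z) \<cdot> S.whisker A f Z = T.whisker A f Z \<cdot> t (A @ x # Z)"
  using t_natural[of "map (ident C) A @ f # map (ident C) Z"] assms
  by (simp add: S.whisker_def T.whisker_def)

end

text \<open>
  If the target is a limit in degree \<open>N + 1\<close>, then compatibility with the structure maps prescribes the
  next component of the morphism through its composites with the projections.
\<close>

locale comparison_step = comparison C K mS maS alS mT maT alT N t
  for C :: "('o, 'm) cat" and K mS maS alS mT maT alT N t +
  assumes Suc_N_le: "Suc N \<le> K" and N_pos: "0 < N"
    and top_limit: "X \<in> objs \<Longrightarrow> length X = Suc N \<Longrightarrow> T.block_limit X"
begin

definition comparison_leg :: "'o list \<Rightarrow> 'o list \<Rightarrow> 'o list \<Rightarrow> 'm" where
  "comparison_leg A B Z = t_block A B Z \<cdot> alS A B Z"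

text \<open>
  Both composites multiply the two blocks in the source and then apply \<open>t\<close> to each block and to the
  result.
\<close>

lemma comparison_leg_parallel:
  assumes o: "A \<in> objs" "B \<in> objs" "M \<in> objs" "B' \<in> objs" "Z \<in> objs"
    and len: "length A + length B + length M + length B' + length Z = Suc N" "2 \<le> length B" "2 \<le> length B'"
  shows "alT (A @ mT B # M) B' Z \<cdot> comparison_leg A B (M @ B' @ Z) =
      alT A B (M @ mT B' # Z) \<cdot> comparison_leg (A @ B @ M) B' Z"
proof -
  let ?v = "T.whisker A (t B) (M @ mT B' # Z) \<cdot> t_block (A @ mS B # M) B' Z"
  have n1: "alT (A @ mT B # M) B' Z \<cdot> T.whisker A (t B) (M @ B' @ Z) =
      T.whisker A (t B) (M @ mT B' # Z) \<cdot> alT (A @ mS B # M) B' Z"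
    using T.al_natural_left[of A M B' Z "t B"] o len Suc_N_le by simp
  have c1: "alT (A @ mS B # M) B' Z \<cdot> t (A @ mS B # M @ B' @ Z) =
      t_block (A @ mS B # M) B' Z \<cdot> alS (A @ mS B # M) B' Z"
    using compat[of "A @ mS B # M" B' Z] o len Suc_N_le by simp
  have e1: "alT (A @ mT B # M) B' Z \<cdot> t_block A B (M @ B' @ Z) = ?v \<cdot> alS (A @ mS B # M) B' Z"
    unfolding t_block_def[of A B] by (rule paste[OF n1 c1]) (use o len Suc_N_le in simp_all)
  have n2: "alT A B (M @ mT B' # Z) \<cdot> T.whisker (A @ B @ M) (t B') Z =
      T.whisker (A @ mT B # M) (t B') Z \<cdot> alT A B (M @ mS B' # Z)"
    using T.al_natural_right[of A B M Z "t B'"] o len Suc_N_le by simp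
  have c2: "alT A B (M @ mS B' # Z) \<cdot> t (A @ B @ M @ mS B' # Z) =
      t_block A B (M @ mS B' # Z) \<cdot> alS A B (M @ mS B' # Z)"
    using compat[of A B "M @ mS B' # Z"] o len Suc_N_le by simp
  have e2': "alT A B (M @ mT B' # Z) \<cdot> t_block (A @ B @ M) B' Z =
      (T.whisker (A @ mT B # M) (t B') Z \<cdot> t_block A B (M @ mS B' # Z)) \<cdot> alS A B (M @ mS B' # Z)"
    unfolding t_block_def[of "A @ B @ M" B'] using paste[OF n2 c2] o len Suc_N_le by simp
  have "T.whisker (A @ mT B # M) (t B') Z \<cdot> T.whisker A (t B) (M @ mS B' # Z) =
      T.whisker A (t B) (M @ mT B' # Z) \<cdot> T.whisker (A @ mS B # M) (t B') Z"
    using o len Suc_N_le by (intro T.whisker_interchange) simp_all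
  then have "(T.whisker (A @ mT B # M) (t B') Z \<cdot> T.whisker A (t B) (M @ mS B' # Z)) \<cdot>
      t (A @ mS B # M @ mS B' # Z) =
      (T.whisker A (t B) (M @ mT B' # Z) \<cdot> T.whisker (A @ mS B # M) (t B') Z) \<cdot> t (A @ mS B # M @ mS B' # Z)"
    by simp
  then have "T.whisker (A @ mT B # M) (t B') Z \<cdot> t_block A B (M @ mS B' # Z) = ?v"
    unfolding t_block_def using o len Suc_N_le by (simp add: seq_assoc)
  with e2' have e2: "alT A B (M @ mT B' # Z) \<cdot> t_block (A @ B @ M) B' Z = ?v \<cdot> alS A B (M @ mS B' # Z)"
    by simp
  have e3: "alS (A @ mS B # M) B' Z \<cdot> alS A B (M @ B' @ Z) = alS A B (M @ mS B' # Z) \<cdot> alS (A @ B @ M) B' Z"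
    using o len Suc_N_le by (intro S.al_parallel) simp_all
  show ?thesis
    unfolding comparison_leg_def by (rule cube[OF e1 e2 e3]) (use o len Suc_N_le in simp_all)
qed

text \<open>
  Compatibility of \<open>t\<close> inside the block \<open>P @ Q @ R\<close>, followed by naturality of \<open>t\<close> outside of it.
\<close>

lemma whisker_alT_t_block:
  assumes o: "A \<in> objs" "P \<in> objs" "Q \<in> objs" "R \<in> objs" "Z \<in> objs"
    and len: "length A + length Z < N" "length P + length Q + length R \<le> N" "length P + length R < N"
  shows "T.whisker A (alT P Q R) Z \<cdot> t_block A (P @ Q @ R) Z =
    (T.whisker A (t_block P Q R) Z \<cdot> t (A @ mS (P @ mS Q # R) # Z)) \<cdot> S.whisker A (alS P Q R) Z"
proof -
  have len': "length Q \<le> N" "length P + length R < K" "length A + length Z < K"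
      "length P + length Q + length R \<le> K"
    "length A + length Z < N" "length P + length R < N + length Q" "length P + length R < K + length Q"
        "length Q \<le> K"
    using len Suc_N_le by linarith+
  have "T.whisker A (alT P Q R \<cdot> t (P @ Q @ R)) Z = T.whisker A (t_block P Q R \<cdot> alS P Q R) Z"
    using compat[of P Q R] o len len' by simp
  then have 1: "T.whisker A (alT P Q R) Z \<cdot> T.whisker A (t (P @ Q @ R)) Z = T.whisker A (t_block P Q R) Z \<cdot>
      T.whisker A (alS P Q R) Z"
    using o len len' by (simp add: T.whisker_seq)
  have 2: "T.whisker A (alS P Q R) Z \<cdot> t (A @ mS (P @ Q @ R) # Z) = t (A @ mS (P @ mS Q # R) # Z) \<cdot>
      S.whisker A (alS P Q R) Z"
    using t_whisker[of A Z "alS P Q R"] o len len' by simp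
  show ?thesis
    unfolding t_block_def[of A "P @ Q @ R"] by (rule paste[OF 1 2]) (use o len len' in simp_all)
qed

lemma comparison_leg_nested:
  assumes o: "A \<in> objs" "P \<in> objs" "Q \<in> objs" "R \<in> objs" "Z \<in> objs"
    and len: "length A + length P + length Q + length R + length Z = Suc N" "2 \<le> length Q"
      "length P + length Q + length R \<le> N"
  shows "T.whisker A (alT P Q R) Z \<cdot> comparison_leg A (P @ Q @ R) Z =
      alT A (P @ mT Q # R) Z \<cdot> comparison_leg (A @ P) Q (R @ Z)"
proof -
  have len': "length P + length R < N" "length A + length Z < N" "length A + length P + length R + length Z < N"
    using len by linarith+
  let ?v = "T.whisker A (t_block P Q R) Z \<cdot> t (A @ mS (P @ mS Q # R) # Z)"
  have e1: "T.whisker A (alT P Q R) Z \<cdot> t_block A (P @ Q @ R) Z = ?v \<cdot> S.whisker A (alS P Q R) Z"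
    using o len len' by (intro whisker_alT_t_block)
  have n2: "alT A (P @ mT Q # R) Z \<cdot> T.whisker (A @ P) (t Q) (R @ Z) = T.whisker A (T.whisker P (t Q) R) Z \<cdot>
      alT A (P @ mS Q # R) Z"
    using T.al_natural_inside[of A P R Z "t Q"] o len len' Suc_N_le by simp
  have c2: "alT A (P @ mS Q # R) Z \<cdot> t (A @ P @ mS Q # R @ Z) =
      t_block A (P @ mS Q # R) Z \<cdot> alS A (P @ mS Q # R) Z"
    using compat[of A "P @ mS Q # R" Z] o len len' Suc_N_le by simp
  have e2': "alT A (P @ mT Q # R) Z \<cdot> t_block (A @ P) Q (R @ Z) =
      (T.whisker A (T.whisker P (t Q) R) Z \<cdot> t_block A (P @ mS Q # R) Z) \<cdot> alS A (P @ mS Q # R) Z"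
    unfolding t_block_def[of "A @ P" Q] using paste[OF n2 c2] o len len' Suc_N_le by simp
  have "T.whisker A (T.whisker P (t Q) R) Z \<cdot> t_block A (P @ mS Q # R) Z = ?v"
    unfolding t_block_def using o len len' Suc_N_le by (simp add: T.whisker_seq seq_assoc)
  with e2' have e2: "alT A (P @ mT Q # R) Z \<cdot> t_block (A @ P) Q (R @ Z) = ?v \<cdot> alS A (P @ mS Q # R) Z"
    by simp
  have e3: "S.whisker A (alS P Q R) Z \<cdot> alS A (P @ Q @ R) Z = alS A (P @ mS Q # R) Z \<cdot> alS (A @ P) Q (R @ Z)"
    using o len Suc_N_le by (intro S.al_nested_whisker) simp_all
  show ?thesis
    unfolding comparison_leg_def by (rule cube[OF e1 e2 e3]) (use o len len' Suc_N_le in simp_all)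
qed

lemma comparison_leg_cone:
  assumes X: "X \<in> objs" "length X = Suc N"
  shows "T.block_cone X (mS X) comparison_leg"
  unfolding T.block_cone_def
proof (intro conjI allI impI)
  show "mS X \<in> Obj C"
    using X Suc_N_le by simp
next
  fix A B Z assume *: "X = A @ B @ Z" "2 \<le> length B" "length B < length X"
  then have o: "A \<in> objs" "B \<in> objs" "Z \<in> objs" and len: "length A + length B + length Z = Suc N"
    using X by auto
  have "length B \<le> N" "length A + length Z < N"
    using *(2,3) X(2) len by linarith+
  then show "comparison_leg A B Z \<in> Arr C" "dom C (comparison_leg A B Z) = mS X" "cod C (comparison_leg A B Z) =
      mT (A @ mT B # Z)"
    using *(1) o len Suc_N_le by (simp_all add: comparison_leg_def)
next
  fix A B M B' Z assume *: "X = A @ B @ M @ B' @ Z" "2 \<le> length B" "2 \<le> length B'"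
  then show "alT (A @ mT B # M) B' Z \<cdot> comparison_leg A B (M @ B' @ Z) =
      alT A B (M @ mT B' # Z) \<cdot> comparison_leg (A @ B @ M) B' Z"
    using X by (intro comparison_leg_parallel) auto
next
  fix A P Q R Z assume *: "X = A @ P @ Q @ R @ Z" "2 \<le> length Q" "length (P @ Q @ R) < length X"
  have "length P + length Q + length R \<le> N"
    using *(3) X(2) by simp
  then show "T.whisker A (alT P Q R) Z \<cdot> comparison_leg A (P @ Q @ R) Z =
      alT A (P @ mT Q # R) Z \<cdot> comparison_leg (A @ P) Q (R @ Z)"
    using *(1,2) X by (intro comparison_leg_nested) auto
qed

definition t' :: "'o list \<Rightarrow> 'm" where
  "t' X = (if length X \<le> N then t X else T.mediator X (mS X) comparison_leg)"

lemma t'_low [simp]: "length X \<le> N \<Longrightarrow> t' X = t X"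
  by (simp add: t'_def)

lemma t'_in_hom:
  assumes "X \<in> objs" "length X \<le> Suc N"
  shows "t' X \<in> hom C (mS X) (mT X)"
proof (cases "length X = Suc N")
  case True
  then show ?thesis
    using T.mediator(1-3)[OF top_limit[OF assms(1) True] comparison_leg_cone[OF assms(1) True]] True
        by (simp add: t'_def hom_def)
qed (use assms in \<open>simp add: hom_def\<close>)

lemma
  assumes "X \<in> objs" "length X \<le> Suc N"
  shows t'_Arr [simp]: "t' X \<in> Arr C"
    and dom_t' [simp]: "dom C (t' X) = mS X"
    and cod_t' [simp]: "cod C (t' X) = mT X"
  using t'_in_hom[OF assms] by (auto simp: hom_def)

lemma alT_t':
  assumes o: "A \<in> objs" "B \<in> objs" "Z \<in> objs"
    and len: "length A + length B + length Z = Suc N" "2 \<le> length B" "length B \<le> N"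
  shows "alT A B Z \<cdot> t' (A @ B @ Z) = t_block A B Z \<cdot> alS A B Z"
proof -
  have "length B < length (A @ B @ Z)"
    unfolding length_append using len by linarith
  then show ?thesis
    using T.mediator(4)[OF top_limit comparison_leg_cone, of "A @ B @ Z" A B Z] o len
    by (simp add: t'_def comparison_leg_def)
qed

lemma top_monic:
  assumes "X \<in> objs" "length X = Suc N"
    and "h \<in> Arr C" "cod C h = mT X" "k \<in> Arr C" "cod C k = mT X" "dom C h = dom C k"
    and "\<And>A B Z. A @ B @ Z = X \<Longrightarrow> A \<in> objs \<Longrightarrow> B \<in> objs \<Longrightarrow> Z \<in> objs \<Longrightarrow>
      length A + length B + length Z = Suc N \<Longrightarrow> 2 \<le> length B \<Longrightarrow>
      length B \<le> N \<Longrightarrow> alT A B Z \<cdot> h = alT A B Z \<cdot> k"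
  shows "h = k"
proof (rule T.block_limit_jointly_monic[OF top_limit])
  fix A B Z
  assume *: "X = A @ B @ Z" "A \<in> objs" "B \<in> objs" "Z \<in> objs" "2 \<le> length B" "length B < length X"
  have "length A + length B + length Z = Suc N"
    using *(1) assms(2) by simp
  moreover have "length B \<le> N"
    using *(6) assms(2) by simp
  ultimately show "alT A B Z \<cdot> h = alT A B Z \<cdot> k"
    using assms(8)[of A B Z] * by simp
qed (use assms Suc_N_le in simp_all)

lemma t'_natural_top:
  assumes F: "F \<in> arrs" "length F = Suc N"
  shows "t' (map (cod C) F) \<cdot> maS F = maT F \<cdot> t' (map (dom C) F)"
proof (rule top_monic[of "map (cod C) F"])
  let ?c = "map (cod C)" and ?d = "map (dom C)"
  show "?c F \<in> objs" "length (?c F) = Suc N" "t' (?c F) \<cdot> maS F \<in> Arr C" "cod C (t' (?c F) \<cdot> maS F) = mT (?c F)"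
    "maT F \<cdot> t' (?d F) \<in> Arr C" "cod C (maT F \<cdot> t' (?d F)) = mT (?c F)"
    "dom C (t' (?c F) \<cdot> maS F) = dom C (maT F \<cdot> t' (?d F))"
    using F Suc_N_le by simp_all
  fix A B Z assume *: "A @ B @ Z = ?c F" "2 \<le> length B" "length B \<le> N"
  obtain F1 G H where e: "F = F1 @ G @ H" "?c F1 = A" "?c G = B" "?c H = Z"
    using map_eq_append3[OF *(1)[symmetric]] by metis
  have o: "F1 \<in> arrs" "G \<in> arrs" "H \<in> arrs" and len: "length F1 + length G + length H = Suc N"
    and G: "2 \<le> length G" "length G \<le> N"
    using F e(1) *(2,3) unfolding e(3)[symmetric] by auto
  have len': "length F1 + length H < N" "length F1 + length H < K"
    using len G Suc_N_le by linarith+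
  have e1: "alT (?c F1) (?c G) (?c H) \<cdot> t' (?c F1 @ ?c G @ ?c H) = t_block (?c F1) (?c G) (?c H) \<cdot>
      alS (?c F1) (?c G) (?c H)"
    using alT_t'[of "?c F1" "?c G" "?c H"] o len G by simp
  have e2: "alT (?c F1) (?c G) (?c H) \<cdot> maT (F1 @ G @ H) = maT (F1 @ maT G # H) \<cdot> alT (?d F1) (?d G) (?d H)"
    using o len G Suc_N_le by (intro T.al_natural) simp_all
  have e3: "alS (?c F1) (?c G) (?c H) \<cdot> maS (F1 @ G @ H) = maS (F1 @ maS G # H) \<cdot> alS (?d F1) (?d G) (?d H)"
    using o len G Suc_N_le by (intro S.al_natural) simp_all
  have e4: "alT (?d F1) (?d G) (?d H) \<cdot> t' (?d F1 @ ?d G @ ?d H) = t_block (?d F1) (?d G) (?d H) \<cdot>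
      alS (?d F1) (?d G) (?d H)"
    using alT_t'[of "?d F1" "?d G" "?d H"] o len G by simp
  have n1: "t (?c F1 @ mS (?c G) # ?c H) \<cdot> maS (F1 @ maS G # H) =
      maT (F1 @ maS G # H) \<cdot> t (?d F1 @ mS (?d G) # ?d H)"
    using t_natural[of "F1 @ maS G # H"] o len' G Suc_N_le by simp
  have n2: "t (?c G) \<cdot> maS G = maT G \<cdot> t (?d G)"
    using t_natural[of G] o G by simp
  have n3: "T.whisker (?c F1) (t (?c G)) (?c H) \<cdot> maT (F1 @ maS G # H) =
      maT (F1 @ maT G # H) \<cdot> T.whisker (?d F1) (t (?d G)) (?d H)"
    using T.ma_whisker(1)[of F1 H "maS G" "t (?c G)"] T.ma_whisker(2)[of F1 H "t (?d G)"
        "maT G"] n2 o len' G Suc_N_le by simp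
  have "t_block (?c F1) (?c G) (?c H) \<cdot> maS (F1 @ maS G # H) =
      T.whisker (?c F1) (t (?c G)) (?c H) \<cdot> maT (F1 @ maS G # H) \<cdot> t (?d F1 @ mS (?d G) # ?d H)"
    unfolding t_block_def n1[symmetric] using o len' G Suc_N_le by (simp add: seq_assoc)
  also have "\<dots> = (T.whisker (?c F1) (t (?c G)) (?c H) \<cdot> maT (F1 @ maS G # H)) \<cdot> t (?d F1 @ mS (?d G) # ?d H)"
    using o len' G Suc_N_le by (simp add: seq_assoc)
  also have "\<dots> = maT (F1 @ maT G # H) \<cdot> t_block (?d F1) (?d G) (?d H)"
    unfolding t_block_def n3 using o len' G Suc_N_le by (simp add: seq_assoc)
  finally have e5: "t_block (?c F1) (?c G) (?c H) \<cdot> maS (F1 @ maS G # H) =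
      maT (F1 @ maT G # H) \<cdot> t_block (?d F1) (?d G) (?d H)" .
  have "alT (?c F1) (?c G) (?c H) \<cdot> t' (?c F1 @ ?c G @ ?c H) \<cdot> maS (F1 @ G @ H) =
      alT (?c F1) (?c G) (?c H) \<cdot> maT (F1 @ G @ H) \<cdot> t' (?d F1 @ ?d G @ ?d H)"
    by (rule slide[OF e1 e2 e3 e4 e5]) (use o len len' G Suc_N_le in simp_all)
  then show "alT A B Z \<cdot> t' (?c F) \<cdot> maS F = alT A B Z \<cdot> maT F \<cdot> t' (?d F)"
    unfolding e(2-4)[symmetric] by (simp add: e(1))
qed

text \<open>
  Here the compatibility is not part of the construction of the new component. It holds after each
  projection of the limit in the target, for each of the three positions of the unit relative to the block.
\<close>

lemma t'_insert_unit:
  assumes o: "A \<in> objs" "Z \<in> objs" and len: "length A + length Z = N"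
  shows "alT A [] Z \<cdot> t (A @ Z) = t' (A @ mS [] # Z) \<cdot> alS A [] Z"
proof (rule top_monic[of "A @ mS [] # Z"])
  show "A @ mS [] # Z \<in> objs" "length (A @ mS [] # Z) = Suc N"
    "alT A [] Z \<cdot> t (A @ Z) \<in> Arr C" "cod C (alT A [] Z \<cdot> t (A @ Z)) = mT (A @ mS [] # Z)"
    "t' (A @ mS [] # Z) \<cdot> alS A [] Z \<in> Arr C" "cod C (t' (A @ mS [] # Z) \<cdot> alS A [] Z) = mT (A @ mS [] # Z)"
    "dom C (alT A [] Z \<cdot> t (A @ Z)) = dom C (t' (A @ mS [] # Z) \<cdot> alS A [] Z)"
    using o len Suc_N_le by (simp_all add: unit_eq)
  fix A1 B Z1
  assume X: "A1 @ B @ Z1 = A @ mS [] # Z" and B: "2 \<le> length B" "length B \<le> N"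
  show "alT A1 B Z1 \<cdot> alT A [] Z \<cdot> t (A @ Z) = alT A1 B Z1 \<cdot> t' (A @ mS [] # Z) \<cdot> alS A [] Z"
    using X
  proof (cases rule: append3_eq_insert_cases)
    case (right M)
    then have o': "A1 \<in> objs" "B \<in> objs" "M \<in> objs" "Z \<in> objs"
      and len': "length A1 + length B + length M + length Z = N"
      using o len by auto
    have e1: "alT A1 B Z1 \<cdot> alT A [] Z = alT (A1 @ mT B # M) [] Z \<cdot> alT A1 B (M @ Z)"
      using T.al_parallel[of A1 B M "[]" Z] o' len' B Suc_N_le right by (simp add: unit_eq)
    have e2: "alT A1 B Z1 \<cdot> t' (A @ mS [] # Z) = t_block A1 B (M @ mS [] # Z) \<cdot> alS A1 B (M @ mS [] # Z)"
      using alT_t'[of A1 B "M @ mS [] # Z"] o' len' B right by simp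
    have e3: "alT A1 B (M @ Z) \<cdot> t (A @ Z) = t_block A1 B (M @ Z) \<cdot> alS A1 B (M @ Z)"
      using compat[of A1 B "M @ Z"] o' len' B right by simp
    have e4: "alS A1 B (M @ mS [] # Z) \<cdot> alS A [] Z = alS (A1 @ mS B # M) [] Z \<cdot> alS A1 B (M @ Z)"
      using S.al_parallel[of A1 B M "[]" Z] o' len' B Suc_N_le right by simp
    have n1: "alT (A1 @ mT B # M) [] Z \<cdot> T.whisker A1 (t B) (M @ Z) = T.whisker A1 (t B) (M @ mS [] # Z) \<cdot>
        alT (A1 @ mS B # M) [] Z"
      using T.al_natural_left[of A1 M "[]" Z "t B"] o' len' B Suc_N_le by (simp add: unit_eq)
    have c1: "alT (A1 @ mS B # M) [] Z \<cdot> t (A1 @ mS B # M @ Z) = t (A1 @ mS B # M @ mS [] # Z) \<cdot>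
        alS (A1 @ mS B # M) [] Z"
      using compat[of "A1 @ mS B # M" "[]" Z] o' len' B Suc_N_le by (simp add: t_block_empty)
    have e5: "alT (A1 @ mT B # M) [] Z \<cdot> t_block A1 B (M @ Z) = t_block A1 B (M @ mS [] # Z) \<cdot>
        alS (A1 @ mS B # M) [] Z"
      unfolding t_block_def by (rule paste[OF n1 c1]) (use o' len' B Suc_N_le unit_eq in simp_all)
    show ?thesis
      by (rule slide[OF e1 e2 e3 e4 e5]) (use o' len' B Suc_N_le right unit_eq in simp_all)
  next
    case (left M)
    then have o': "A \<in> objs" "M \<in> objs" "B \<in> objs" "Z1 \<in> objs"
      and len': "length A + length M + length B + length Z1 = N"
      using o len by auto
    have e1: "alT A1 B Z1 \<cdot> alT A [] Z = alT A [] (M @ mT B # Z1) \<cdot> alT (A @ M) B Z1"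
      using T.al_parallel[of A "[]" M B Z1] o' len' B Suc_N_le left by (simp add: unit_eq)
    have e2: "alT A1 B Z1 \<cdot> t' (A @ mS [] # Z) = t_block (A @ mS [] # M) B Z1 \<cdot> alS (A @ mS [] # M) B Z1"
      using alT_t'[of "A @ mS [] # M" B Z1] o' len' B left by simp
    have e3: "alT (A @ M) B Z1 \<cdot> t (A @ Z) = t_block (A @ M) B Z1 \<cdot> alS (A @ M) B Z1"
      using compat[of "A @ M" B Z1] o' len' B left by simp
    have e4: "alS (A @ mS [] # M) B Z1 \<cdot> alS A [] Z = alS A [] (M @ mS B # Z1) \<cdot> alS (A @ M) B Z1"
      using S.al_parallel[of A "[]" M B Z1] o' len' B Suc_N_le left by simp
    have n1: "alT A [] (M @ mT B # Z1) \<cdot> T.whisker (A @ M) (t B) Z1 = T.whisker (A @ mS [] # M) (t B) Z1 \<cdot>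
        alT A [] (M @ mS B # Z1)"
      using T.al_natural_right[of A "[]" M Z1 "t B"] o' len' B Suc_N_le by (simp add: unit_eq)
    have c1: "alT A [] (M @ mS B # Z1) \<cdot> t (A @ M @ mS B # Z1) = t (A @ mS [] # M @ mS B # Z1) \<cdot>
        alS A [] (M @ mS B # Z1)"
      using compat[of A "[]" "M @ mS B # Z1"] o' len' B Suc_N_le by (simp add: t_block_empty)
    have e5: "alT A [] (M @ mT B # Z1) \<cdot> t_block (A @ M) B Z1 = t_block (A @ mS [] # M) B Z1 \<cdot>
        alS A [] (M @ mS B # Z1)"
      unfolding t_block_def using paste[OF n1 c1] o' len' B Suc_N_le unit_eq by simp
    show ?thesis
      by (rule slide[OF e1 e2 e3 e4 e5]) (use o' len' B Suc_N_le left unit_eq in simp_all)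
  next
    case (inside P R)
    then have o': "A1 \<in> objs" "P \<in> objs" "R \<in> objs" "Z1 \<in> objs"
      and len': "length A1 + length P + length R + length Z1 = N" "1 \<le> length P + length R"
          "length P + length R < N"
      using o len B by auto
    have e1: "alT A1 B Z1 \<cdot> alT A [] Z = T.whisker A1 (alT P [] R) Z1 \<cdot> alT A1 (P @ R) Z1"
      using T.al_nested_whisker[of A1 P "[]" R Z1] o' len' Suc_N_le inside by (simp add: unit_eq)
    have e2: "alT A1 B Z1 \<cdot> t' (A @ mS [] # Z) = t_block A1 (P @ mS [] # R) Z1 \<cdot> alS A1 (P @ mS [] # R) Z1"
      using alT_t'[of A1 "P @ mS [] # R" Z1] o' len' B inside by simp
    have e3: "alT A1 (P @ R) Z1 \<cdot> t (A @ Z) = t_block A1 (P @ R) Z1 \<cdot> alS A1 (P @ R) Z1"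
      using compat[of A1 "P @ R" Z1] o' len' inside by simp
    have e4: "alS A1 (P @ mS [] # R) Z1 \<cdot> alS A [] Z = S.whisker A1 (alS P [] R) Z1 \<cdot> alS A1 (P @ R) Z1"
      using S.al_nested_whisker[of A1 P "[]" R Z1] o' len' Suc_N_le inside by simp
    have "T.whisker A1 (alT P [] R) Z1 \<cdot> t_block A1 (P @ R) Z1 =
        (T.whisker A1 (t_block P [] R) Z1 \<cdot> t (A1 @ mS (P @ mS [] # R) # Z1)) \<cdot> S.whisker A1 (alS P [] R) Z1"
      using whisker_alT_t_block[of A1 P "[]" R Z1] o' len' by simp
    then have e5: "T.whisker A1 (alT P [] R) Z1 \<cdot> t_block A1 (P @ R) Z1 = t_block A1 (P @ mS [] # R) Z1 \<cdot>
        S.whisker A1 (alS P [] R) Z1"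
      using o' len' by (simp add: t_block_empty) (simp add: t_block_def)
    show ?thesis
      by (rule slide[OF e1 e2 e3 e4 e5]) (use o' len' B Suc_N_le inside unit_eq in simp_all)
  qed
qed

lemma t'_compat:
  assumes o: "A \<in> objs" "B \<in> objs" "Z \<in> objs"
    and len: "length A + length B + length Z \<le> Suc N" "length A + length Z < Suc N + length B"
  shows "alT A B Z \<cdot> t' (A @ B @ Z) = (T.whisker A (t' B) Z \<cdot> t' (A @ mS B # Z)) \<cdot> alS A B Z"
proof -
  consider (low) "length A + length B + length Z \<le> N" "length A + length Z < N"
    | (unit) "B = []" "length A + length Z = N" | (single) x where "B = [x]" "length A + length Z = N"
    | (whole) "A = []" "Z = []" "length B = Suc N"
    | (proper) "length A + length B + length Z = Suc N" "2 \<le> length B" "length B \<le> N"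
  proof -
    consider "length B = 0" | "length B = 1" | "2 \<le> length B"
      by linarith
    then show ?thesis
    proof cases
      case 1
      then show ?thesis
        using low unit len by (cases "length A + length Z = N") auto
    next
      case 2
      then show ?thesis
        using low single len by (cases "length A + length Z = N") (auto simp: length_Suc_conv)
    next
      case 3
      then show ?thesis
        using low whole proper len
        by (cases "length A + length B + length Z = Suc N"; cases "length B = Suc N") force+
    qed
  qed
  then show ?thesis
  proof cases
    case low
    then show ?thesis
      using o t_compat[of A B Z] by simp
  next
    case unit
    then show ?thesis
      using o t'_insert_unit[of A Z] N_pos Suc_N_le by (simp add: t_empty unit_eq)
  next
    case (single x)
    then show ?thesis
      using o Suc_N_le N_pos by (simp add: t_single S.al_single T.al_single)
  next
    case whole
    have "t' [mS B] = ident C (mS B)"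
      using o whole N_pos Suc_N_le by (simp add: t_single)
    then show ?thesis
      using o whole Suc_N_le by (simp add: S.al_whole T.al_whole)
  next
    case proper
    then have "length A + length Z < N"
      by linarith
    then show ?thesis
      using o proper alT_t'[of A B Z] by (simp add: t_block_def)
  qed
qed

lemma comparison_extension: "comparison C K mS maS alS mT maT alT (Suc N) t'"
proof unfold_locales
  show "Suc N \<le> K"
    by (rule Suc_N_le)
  show "t' (map (cod C) F) \<cdot> maS F = maT F \<cdot> t' (map (dom C) F)" if "F \<in> arrs" "length F \<le> Suc N" for F
    using that t_natural[of F] t'_natural_top[of F] by (cases "length F = Suc N") auto
  show "t' [] = ident C (mS [])"
    by (simp add: t_empty)
  show "t' [x] = ident C x" if "x \<in> Obj C" for x
    using that N_pos by (simp add: t_single)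
qed (fact t'_in_hom t'_compat)+

end

section \<open>Completions and their terminal object\<close>

lemma normal_oplax_blocks:
  assumes "normal_oplax C S" "3 \<le> N"
  shows "oplax_blocks C N N (block_mult S) (block_mult_arr S) (block_assoc S)"
  using assms by (intro blocks_of_partial_oplax[of C "\<lambda>_. True" "\<lambda>_ _ _. True"]) (simp_all add:
      normal_oplax_def)

lemma low_oplax_blocks:
  assumes "low_oplax C P"
  shows "oplax_blocks C 3 3 (block_mult P) (block_mult_arr P) (block_assoc P)"
  using assms by (intro blocks_of_partial_oplax[of C low_mult low_assoc])
    (auto simp: low_oplax_def low_mult_def low_assoc_def)

lemma completes_blocks:
  assumes "category C" "completes C P S"
  shows "\<And>X. X \<in> lists (Obj C) \<Longrightarrow> length X \<le> 3 \<Longrightarrow> block_mult S X = block_mult P X"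
    and "\<And>F. F \<in> lists (Arr C) \<Longrightarrow> length F \<le> 3 \<Longrightarrow> block_mult_arr S F = block_mult_arr P F"
    and "\<And>A B Z. A \<in> lists (Obj C) \<Longrightarrow> B \<in> lists (Obj C) \<Longrightarrow> Z \<in> lists (Obj C) \<Longrightarrow>
      length A + length B + length Z \<le> 3 \<Longrightarrow> length A + length Z < 3 + length B \<Longrightarrow>
      block_assoc S A B Z = block_assoc P A B Z"
proof -
  interpret category C
    by fact
  show "block_mult S X = block_mult P X" if "X \<in> lists (Obj C)" "length X \<le> 3" for X
    using assms(2) that by (simp add: completes_def low_mult_def block_mult_def Obj_power_cat)
  show "block_mult_arr S F = block_mult_arr P F" if "F \<in> lists (Arr C)" "length F \<le> 3" for F
    using assms(2) that by (simp add: completes_def low_mult_def block_mult_arr_def Arr_power_cat)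
  show "block_assoc S A B Z = block_assoc P A B Z"
    if "A \<in> lists (Obj C)" "B \<in> lists (Obj C)" "Z \<in> lists (Obj C)"
      "length A + length B + length Z \<le> 3" "length A + length Z < 3 + length B" for A B Z
  proof -
    let ?n = "length A + length B + length Z"
    have "length A + length B \<le> ?n \<and> low_assoc ?n (length A) (length B)"
      using that(4,5) by (auto simp: low_assoc_def)
    moreover have "A @ B @ Z \<in> Obj (power_cat C ?n)"
      using that by (simp add: Obj_power_cat)
    ultimately show ?thesis
      using assms(2) unfolding completes_def block_assoc_def by blast
  qed
qed

lemma completes_of_blocks:
  fixes C :: "('o, 'm) cat"
  assumes P: "low_oplax C P" and blocks: "\<And>N. 3 \<le> N \<Longrightarrow> oplax_blocks C N N m ma al"
    and agree: "agree_upto 3 (block_mult P) (block_mult_arr P) (block_assoc P) m ma al"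
  shows "completes C P (oplax_of_blocks m ma al)"
proof -
  interpret partial_oplax C low_mult low_assoc P
    using P by (simp add: low_oplax_def)
  have m: "m X = fobj (mult P (length X)) X" if "length X \<le> 3" for X
    using agree that by (simp add: agree_upto_def block_mult_def)
  have ma: "ma F = farr (mult P (length F)) F" if "length F \<le> 3" for F
    using agree that by (simp add: agree_upto_def block_mult_arr_def)
  have al: "al (take l X) (take r (drop l X)) (drop (l + r) X) = oassoc P n l r X"
    if lr: "l + r \<le> n" "low_assoc n l r" "X \<in> Obj (power_cat C n)" for l r n X
  proof -
    have "l + r \<le> length X"
      using lr by (simp add: Obj_power_cat)
    then obtain A B Z where X: "X = A @ B @ Z" "length A = l" "length B = r"
      by (rule split_block)
    have n: "n = length A + length B + length Z"
      using lr(3) X(1) by (simp add: Obj_power_cat)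
    have "length A + length B + length Z \<le> 3" "length A + length Z < 3 + length B"
      using lr(2) n X(2,3) by (auto simp: low_assoc_def)
    then have "al A B Z = block_assoc P A B Z"
      using agree unfolding agree_upto_def by blast
    then show ?thesis
      using X n by (simp add: block_assoc_def)
  qed
  show ?thesis
    unfolding completes_def
    using normal_oplax_of_blocks[OF blocks] m ma al mult_0
    by (auto simp: low_mult_def Obj_power_cat Arr_power_cat simp del: in_lists_conv_set)
qed

lemma oplax_morphism_blocks:
  assumes "oplax_morphism C S T t" "A \<in> lists (Obj C)" "B \<in> lists (Obj C)" "Z \<in> lists (Obj C)"
  shows "comp C (block_assoc T A B Z) (t (length (A @ B @ Z)) (A @ B @ Z)) =
    comp C (oplax_blocks.whisker C (block_mult_arr T) A (t (length B) B) Z)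
      (comp C (t (length (A @ block_mult S B # Z)) (A @ block_mult S B # Z)) (block_assoc S A B Z))"
proof -
  interpret oplax_morphism C S T t
    by fact
  interpret S: partial_oplax C "\<lambda>_. True" "\<lambda>_ _ _. True" S
    using source by (simp add: normal_oplax_def)
  interpret T: oplax_blocks C 3 3 "block_mult T" "block_mult_arr T" "block_assoc T"
    using target by (rule normal_oplax_blocks) simp
  have "A @ B @ Z \<in> Obj (power_cat C (length A + length B + length Z))"
    using assms by (simp add: S.Obj_power_cat)
  from t_compat[OF _ this, of "length A" "length B"] show ?thesis
    by (simp add: block_assoc_def block_mult_def T.whisker_def block_mult_arr_def add.assoc)
qed

text \<open>
  By induction on the degree: above degree 3, the composite of a component with a projection of the target
  is expressed by components of smaller degree.
\<close>

lemma low_id_morphism_unique: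
  fixes C :: "('o, 'm) cat"
  assumes t: "low_id_morphism C S T t" and t': "low_id_morphism C S T t'"
    and limits: "\<And>X. X \<in> lists (Obj C) \<Longrightarrow> 3 < length X \<Longrightarrow>
      oplax_blocks.block_limit C (block_mult T) (block_mult_arr T) (block_assoc T) X"
  shows "same_components C t t'"
proof -
  have mt: "oplax_morphism C S T t" and mt': "oplax_morphism C S T t'"
    using t t' by (simp_all add: low_id_morphism_def)
  interpret t: oplax_morphism C S T t
    by fact
  interpret t': oplax_morphism C S T t'
    by fact
  interpret category C
    using t.source by (simp add: normal_oplax_def partial_oplax_def)
  have "t (length X) X = t' (length X) X" if "X \<in> objs" for X
    using that
  proof (induction "length X" arbitrary: X rule: less_induct)
    case less
    show ?case
    proof (cases "length X \<le> 3")
      case True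
      then show ?thesis
        using t t' less.prems by (simp add: low_id_morphism_def Obj_power_cat)
    next
      case False
      interpret T: oplax_blocks C "length X" "length X" "block_mult T" "block_mult_arr T" "block_assoc T"
        using t.target False by (intro normal_oplax_blocks) simp_all
      have X: "X \<in> Obj (power_cat C (length X))"
        using less.prems by (simp add: Obj_power_cat)
      have hom: "t (length X) X \<in> hom C (block_mult S X) (block_mult T X)"
        "t' (length X) X \<in> hom C (block_mult S X) (block_mult T X)"
        using nat_trans.component_in_hom[OF t.t_nat_trans X] nat_trans.component_in_hom[OF t'.t_nat_trans X]
        by (simp_all add: block_mult_def)
      show ?thesis
      proof (rule T.block_limit_jointly_monic[OF limits])
        fix A B Z
        assume *: "X = A @ B @ Z" "A \<in> objs" "B \<in> objs" "Z \<in> objs" "2 \<le> length B" "length B < length X"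
        have SB: "A @ block_mult S B # Z \<in> objs"
        proof -
          have "block_mult S B \<in> Obj C"
            using oplax_blocks.m_Obj[OF normal_oplax_blocks[OF t.source, of "length B + 3"], of B] *(3) by simp
          then show ?thesis
            using *(2,4) by simp
        qed
        have len: "length (A @ block_mult S B # Z) < length X"
          using *(1,5) by simp
        show "block_assoc T A B Z \<cdot> t (length X) X = block_assoc T A B Z \<cdot> t' (length X) X"
          using oplax_morphism_blocks[OF mt *(2-4)] oplax_morphism_blocks[OF mt' *(2-4)]
            less.hyps[OF *(6,3)] less.hyps[OF len SB] *(1) by simp
      qed (use hom less.prems False in \<open>simp_all add: hom_def\<close>)
    qed
  qed
  then show ?thesis
    by (auto simp: same_components_def Obj_power_cat simp del: in_lists_conv_set)
qed

text \<open>
  The components are constructed degree by degree, beginning with identities up to degree 3, where the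
  two structures agree.
\<close>

lemma low_id_morphism_exists:
  fixes C :: "('o, 'm) cat"
  assumes S: "completes C P S" and T: "completes C P T"
    and limits: "\<And>X. X \<in> lists (Obj C) \<Longrightarrow> 3 < length X \<Longrightarrow>
      oplax_blocks.block_limit C (block_mult T) (block_mult_arr T) (block_assoc T) X"
  shows "\<exists>t. low_id_morphism C S T t"
proof -
  have nS: "normal_oplax C S" and nT: "normal_oplax C T"
    using S T by (simp_all add: completes_def)
  interpret category C
    using nS by (simp add: normal_oplax_def partial_oplax_def)
  interpret S: partial_oplax C "\<lambda>_. True" "\<lambda>_ _ _. True" S
    using nS by (simp add: normal_oplax_def)
  interpret T: partial_oplax C "\<lambda>_. True" "\<lambda>_ _ _. True" T
    using nT by (simp add: normal_oplax_def)
  let ?mS = "block_mult S" and ?maS = "block_mult_arr S" and ?alS = "block_assoc S"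
  let ?mT = "block_mult T" and ?maT = "block_mult_arr T" and ?alT = "block_assoc T"
  note lowS = completes_blocks[OF category_axioms S] and lowT = completes_blocks[OF category_axioms T]
  have mTS: "?mT X = ?mS X" if "X \<in> objs" "length X \<le> 3" for X
    using lowS(1)[OF that] lowT(1)[OF that] by simp
  define t0 where "t0 X = ident C (?mS X)" for X
  have base: "comparison C K ?mS ?maS ?alS ?mT ?maT ?alT 3 t0" if "3 \<le> K" for K
  proof -
    interpret SB: oplax_blocks C K K ?mS ?maS ?alS
      by (rule normal_oplax_blocks[OF nS that])
    interpret TB: oplax_blocks C K K ?mT ?maT ?alT
      by (rule normal_oplax_blocks[OF nT that])
    show ?thesis
    proof unfold_locales
      show "3 \<le> K"
        by fact
      show "t0 X \<in> hom C (?mS X) (?mT X)" if "X \<in> objs" "length X \<le> 3" for X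
        using that mTS[OF that] \<open>3 \<le> K\<close> by (simp add: t0_def hom_def)
      show "t0 (map (cod C) F) \<cdot> ?maS F = ?maT F \<cdot> t0 (map (dom C) F)"
        if "F \<in> arrs" "length F \<le> 3" for F
      proof -
        have "?maT F = ?maS F"
          using lowS(2)[OF that] lowT(2)[OF that] by simp
        then show ?thesis
          using that \<open>3 \<le> K\<close> by (simp add: t0_def)
      qed
      show "t0 [] = ident C (?mS [])"
        by (simp add: t0_def)
      show "t0 [x] = ident C x" if "x \<in> Obj C" for x
        using that by (simp add: t0_def)
      show "?alT A B Z \<cdot> t0 (A @ B @ Z) = (TB.whisker A (t0 B) Z \<cdot> t0 (A @ ?mS B # Z)) \<cdot> ?alS A B Z"
        if o: "A \<in> objs" "B \<in> objs" "Z \<in> objs" and len: "length A + length B + length Z \<le> 3"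
          "length A + length Z < 3 + length B" for A B Z
      proof -
        have al: "?alT A B Z = ?alS A B Z"
          using lowS(3)[OF o len] lowT(3)[OF o len] by simp
        have len': "length A + length B + length Z \<le> K" "length A + length Z < K + length B"
            "length A + length Z < 3"
          "length A + length Z < K" "length B \<le> 3" "length B \<le> K"
          using len \<open>3 \<le> K\<close> by linarith+
        have mT: "?mT (A @ ?mS B # Z) = ?mS (A @ ?mS B # Z)"
          using o len' by (intro mTS) simp_all
        show ?thesis
          using o len' by (simp add: t0_def al mT)
      qed
    qed
  qed
  define good where "good n t \<longleftrightarrow> (\<forall>K \<ge> n + 3. comparison C K ?mS ?maS ?alS ?mT ?maT ?alT (n + 3) t) \<and>
    (n = 0 \<longrightarrow> t = t0)" for n t
  have "\<exists>f. \<forall>n. good n (f n) \<and> (\<forall>X. length X \<le> n + 3 \<longrightarrow> f (Suc n) X = f n X)"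
  proof (rule dependent_nat_choice)
    show "\<exists>t. good 0 t"
      using base by (auto simp: good_def)
    fix t n assume t: "good n t"
    let ?t' = "comparison_step.t' C ?mS ?alS ?mT ?maT ?alT (n + 3) t"
    have step: "comparison_step C K ?mS ?maS ?alS ?mT ?maT ?alT (n + 3) t" if "Suc n + 3 \<le> K" for K
    proof (rule comparison_step.intro)
      show "comparison C K ?mS ?maS ?alS ?mT ?maT ?alT (n + 3) t"
        using t that by (simp add: good_def)
      show "comparison_step_axioms C K ?mT ?maT ?alT (n + 3)"
        by unfold_locales (use that limits in auto)
    qed
    have "good (Suc n) ?t'"
      using comparison_step.comparison_extension[OF step] by (simp add: good_def)
    moreover have "?t' X = t X" if "length X \<le> n + 3" for X
      using comparison_step.t'_low[OF step[OF order_refl] that] .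
    ultimately show "\<exists>t'. good (Suc n) t' \<and> (\<forall>X. length X \<le> n + 3 \<longrightarrow> t' X = t X)"
      by blast
  qed
  then obtain f where f: "\<And>n. good n (f n)" "\<And>n X. length X \<le> n + 3 \<Longrightarrow> f (Suc n) X = f n X"
    by blast
  have comparison: "comparison C (n + 3) ?mS ?maS ?alS ?mT ?maT ?alT (n + 3) (f n)" for n
    using f(1)[of n] by (simp add: good_def)
  have f_add: "f (n + k) X = f n X" if "length X \<le> n + 3" for n k X
    using that by (induction k) (simp_all add: f(2))
  define t where "t X = f (length X) X" for X
  have t_eq: "t X = f n X" if "length X \<le> n + 3" for X n
  proof (cases "n \<le> length X")
    case True
    then show ?thesis
      using f_add[of X n "length X - n"] that by (simp add: t_def)
  next
    case False
    then show ?thesis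
      using f_add[of X "length X" "n - length X"] by (simp add: t_def)
  qed
  have t_low: "t X = ident C (?mS X)" if "length X \<le> 3" for X
    using t_eq[of X 0] f(1)[of 0] that by (simp add: good_def t0_def)
  have "oplax_morphism C S T (\<lambda>_. t)"
  proof (rule oplax_morphism.intro)
    show "normal_oplax C S" "normal_oplax C T"
      by fact+
    show "unit_obj S = unit_obj T"
      using S T by (simp add: completes_def)
    show "nat_trans (power_cat C n) C (mult S n) (mult T n) t" for n
    proof -
      interpret comparison C "n + 3" ?mS ?maS ?alS ?mT ?maT ?alT "n + 3" "f n"
        by (rule comparison)
      show ?thesis
      proof (intro nat_trans.intro nat_trans_axioms.intro S.mult_functor T.mult_functor TrueI)
        show "t X \<in> hom C (fobj (mult S n) X) (fobj (mult T n) X)" if "X \<in> Obj (power_cat C n)" for X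
          using that t_in_hom[of X] t_eq[of X n] by (simp add: Obj_power_cat block_mult_def)
        show "t Y \<cdot> farr (mult S n) g = farr (mult T n) g \<cdot> t X"
          if "g \<in> hom (power_cat C n) X Y" for g X Y
        proof -
          have "g \<in> arrs" "length g = n" "X = map (dom C) g" "Y = map (cod C) g"
            using that by (auto simp: hom_power_cat simp del: in_lists_conv_set)
          then show ?thesis
            using t_natural[of g] t_eq[of X n] t_eq[of Y n] by (simp add: block_mult_arr_def)
        qed
      qed
    qed
    show "t X = ident C (fobj (mult S n) X)" if "n \<le> 1" "X \<in> Obj (power_cat C n)" for n X
      using that t_low[of X] by (simp add: Obj_power_cat block_mult_def)
    show "oassoc T n l r X \<cdot> t X =
        farr (mult T (n - r + 1)) (plug_arr C l r t X) \<cdot>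
          t (plug l r (fobj (mult S r)) X) \<cdot> oassoc S n l r X"
      if lr: "l + r \<le> n" and X: "X \<in> Obj (power_cat C n)" for l r n X
    proof -
      interpret comparison C "n + 3" ?mS ?maS ?alS ?mT ?maT ?alT "n + 3" "f n"
        by (rule comparison)
      have "l + r \<le> length X"
        using lr X by (simp add: Obj_power_cat)
      then obtain A B Z where e: "X = A @ B @ Z" "length A = l" "length B = r"
        by (rule split_block)
      have o: "A \<in> objs" "B \<in> objs" "Z \<in> objs" and len: "length A + length B + length Z = n"
        using X e(1) by (simp_all add: Obj_power_cat)
      have "?alT A B Z \<cdot> t (A @ B @ Z) =
          (T.whisker A (t B) Z \<cdot> t (A @ ?mS B # Z)) \<cdot> ?alS A B Z"
        using t_compat[OF o] len t_eq[of "A @ B @ Z" n] t_eq[of B n] t_eq[of "A @ ?mS B # Z" n] by simp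
      also have "\<dots> = T.whisker A (t B) Z \<cdot> t (A @ ?mS B # Z) \<cdot> ?alS A B Z"
        using o len t_eq[of B n] t_eq[of "A @ ?mS B # Z" n] by (simp add: seq_assoc)
      finally show ?thesis
        using e len by (auto simp: block_assoc_def block_mult_def block_mult_arr_def T.whisker_def add.assoc)
    qed
  qed
  moreover have "t X = ident C (fobj (mult S n) X)" if "n \<le> 3" "X \<in> Obj (power_cat C n)" for n X
    using that t_low[of X] by (simp add: Obj_power_cat block_mult_def)
  ultimately have "low_id_morphism C S T (\<lambda>_. t)"
    by (simp add: low_id_morphism_def)
  then show ?thesis
    by blast
qed

theorem theorem4p28:
  fixes E :: "('o, 'm) cat" and P :: "('o, 'm) oplax_data"
  assumes "category E"
    and "infinite (UNIV :: 'u set)"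
    and "has_small_limits TYPE('u) E"
    and "low_oplax E P"
  shows "(\<exists>S. completes E P S) \<and>
    (\<exists>T. terminal_completion E P T) \<and>
    (\<forall>S S'. completes E P S \<and> completes E P S' \<longrightarrow> oplax_equivalent E S S')"
proof -
  obtain m ma al where blocks: "\<And>N. 3 \<le> N \<Longrightarrow> oplax_blocks E N N m ma al"
    and agree: "agree_upto 3 (block_mult P) (block_mult_arr P) (block_assoc P) m ma al"
    and limits: "\<And>X. X \<in> lists (Obj E) \<Longrightarrow> 3 < length X \<Longrightarrow> oplax_blocks.block_limit E m ma al X"
    using universal_extension_exists[OF low_oplax_blocks[OF assms(4)] assms(3,2)] by blast
  define T where "T = oplax_of_blocks m ma al"
  have T: "completes E P T"
    unfolding T_def using assms(4) blocks agree by (rule completes_of_blocks)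
  have limT: "oplax_blocks.block_limit E (block_mult T) (block_mult_arr T) (block_assoc T) X"
    if "X \<in> lists (Obj E)" "3 < length X" for X
    using limits[OF that] by (simp add: T_def)
  have to_T: "\<exists>t. low_id_morphism E S T t" if "completes E P S" for S
    using that T limT by (rule low_id_morphism_exists)
  have "terminal_completion E P T"
    unfolding terminal_completion_def
  proof (intro conjI allI impI)
    show "completes E P T"
      by (rule T)
    fix S assume "completes E P S"
    then obtain t where t: "low_id_morphism E S T t"
      using to_T by blast
    then show "\<exists>t. low_id_morphism E S T t \<and> (\<forall>t'. low_id_morphism E S T t' \<longrightarrow> same_components E t' t)"
      using low_id_morphism_unique[OF _ t limT] by blast
  qed
  moreover have "oplax_equivalent E S S'" if S: "completes E P S" and S': "completes E P S'" for S S'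
  proof -
    let ?r = "\<lambda>S T. \<exists>t. low_id_morphism E S T t"
    have "equivclp ?r S T" "equivclp ?r T S'"
      using to_T[OF S] to_T[OF S'] by (auto intro: r_into_equivclp converse_r_into_equivclp)
    then have "equivclp ?r S S'"
      by (rule equivclp_trans)
    then show ?thesis
      using S S' by (simp add: oplax_equivalent_def completes_def)
  qed
  ultimately show ?thesis
    using T by blast
qed

end
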